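(* Let $(K,\Sigma)$ be a Coxeter link and let $p(x)$ be the characteristic polynomial of its monodromy $h_*:\mathrm{H}_1(\Sigma;\mathbb{R})\to\mathrm{H}_1(\Sigma;\mathbb{R})$. Then $\mu(p(x))\ge\mu(p_L(x))$, where $p_L(x)=x^{10}+x^9-x^7-x^6-x^5-x^4-x^3+x+1$ is Lehmer's polynomial and $\mu$ denotes Mahler measure.
   Context: The Mahler measure $\mu(p)$ of a polynomial $p\in\mathbb{Z}[x]$ (monic here) is the product of the absolute values of its roots outside the unit circle. Chord systems. A chord diagram is a finite collection of straight segments (chords) in the closed unit disk $D\subset\mathbb{R}^2$, joining mutually disjoint pairs of points of $\partial D$. A chord system is a chord diagram whose chords are ordered $\ell_1,\dots,\ell_n$ and oriented. For distinct oriented chords $\ell,\ell'$, $\mathrm{link}(\ell,\ell')$ is the linking number of their endpoints, considered as oriented $0$-spheres in $S^1$: it is $0$ if the chords do not meet; if they cross, with direction vectors $u,u'$, it is $-1$ if $(u,u')$ is a positively oriented basis of $\mathbb{R}^2$ and $+1$ otherwise. The chord system is of Coxeter-type if $\mathrm{link}(\ell_i,\ell_j)\le 0$ for all $i<j$. Coxeter links. View $D\subset\mathbb{R}^2\times\{0\}\subset\mathbb{R}^3\subset S^3$. Given a chord system $\ell_1,\dots,\ell_n$, for each $i$ attach to $D$, near the endpoints of $\ell_i$, a band $T_i$ with two positive half-twists (one full twist), whose core is an arch in the half-space $z\ge 0$ passing over $D$ along $\ell_i$; the bands are disjoint and $T_i$ lies over $T_j$ when $i>j$. Let $\Sigma=D\cup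 T_1\cup\dots\cup T_n$, oriented by $D$, and let $K=\partial\Sigma$. Let $\gamma_i$ be the loop formed by $\ell_i$ (with its orientation) and the core of $T_i$; the classes of $\gamma_1,\dots,\gamma_n$ form a basis of $\mathrm{H}_1(\Sigma;\mathbb{R})$. Write $\gamma^+$ (resp. $\gamma^-$) for the push-off of $\gamma$ off $\Sigma$ to the side which along $D$ is $z<0$ (resp. $z>0$), and $\mathrm{lk}$ for the linking number in $S^3$. The sign of the twists is such that the Seifert matrix $M=[\mathrm{lk}(\gamma_i^+,\gamma_j)]$ has diagonal entries $1$; its entries are $0$ for $i>j$ and $\mathrm{link}(\ell_i,\ell_j)$ for $i<j$. The surface $\Sigma$ is obtained from $D$ by a sequence of Murasugi sums of Hopf bands, so $(K,\Sigma)$ is a fibered link with fiber $\Sigma$. It is called a Coxeter link if the chord system is of Coxeter-type. Monodromy. $h_*$ is the map on $\mathrm{H}_1(\Sigma;\mathbb{R})$ induced by the gluing homeomorphism $h:\Sigma\to\Sigma$ of the fibration; it is characterized by: $\alpha^+$ and $(h_*\alpha)^-$ are homologous in $S^3\setminus\Sigma$ for all $\alpha\in\mathrm{H}_1(\Sigma;\mathbb{R})$. In the basis $\gamma_1,\dots,\gamma_n$ its matrix is $M^{-1}M^t$.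
   Formalization: The formal theorem adds the hypothesis μ(p) ≠ 1: as stated the claim fails, e.g. for a single chord p(x) = x − 1 and μ(p) = 1 < μ(p_L); only links with μ(p) = 1 are excluded. The surface Σ is a fixed concrete model of the construction, which is up to isotopy. *)

theory Defs
  imports
    "HOL-Analysis.Urysohn"
    "HOL-Homology.Homology"
    "Jordan_Normal_Form.Char_Poly"
    "Berlekamp_Zassenhaus.Mahler_Measure"
begin

section \<open>Chord systems\<close>

text \<open>The disk lives in the plane \<^typ>\<open>complex\<close>.  An oriented chord is the pair of its
  initial and final point, and the position in the list gives the ordering.\<close>

type_synonym chord = "complex \<times> complex"

definition chord_system :: "chord list \<Rightarrow> bool" where
  "chord_system ls \<longleftrightarrow>
     distinct (map fst ls @ map snd ls) \<and>
     (\<forall>(a, b) \<in> set ls. cmod a = 1 \<and> cmod b = 1)"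

text \<open>\<open>Im (cnj u * u')\<close> is the determinant of the pair of plane vectors \<open>(u, u')\<close>.\<close>

definition chord_link :: "chord \<Rightarrow> chord \<Rightarrow> int" where
  "chord_link l l' =
     (if closed_segment (fst l) (snd l) \<inter> closed_segment (fst l') (snd l') = {} then 0
      else if Im (cnj (snd l - fst l) * (snd l' - fst l')) > 0 then -1 else 1)"

definition coxeter_type :: "chord list \<Rightarrow> bool" where
  "coxeter_type ls \<longleftrightarrow>
     (\<forall>i j. i < j \<and> j < length ls \<longrightarrow> chord_link (ls ! i) (ls ! j) \<le> 0)"

section \<open>The surface and its boundary link\<close>

text \<open>Three-space is \<open>complex \<times> real\<close>, with the usual orientation of the coordinates \<open>x, y, z\<close>.\<close>

type_synonym space3 = "complex \<times> real"

definition disk :: "space3 set" where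
  "disk = cball 0 1 \<times> {0}"

definition chord_dir :: "chord \<Rightarrow> complex" where
  "chord_dir l = sgn (snd l - fst l)"

definition chord_offset :: "chord \<Rightarrow> real" where
  "chord_offset l = (\<i> * chord_dir l) \<bullet> fst l"

text \<open>Coordinates on a strip around the chord: \<open>y\<close> is the signed distance to the chord, and
  \<open>\<tau> \<in> [-1, 1]\<close> is the position along the parallel chord at distance \<open>y\<close>, so that
  \<open>\<tau> = -1\<close> and \<open>\<tau> = 1\<close> give the arcs of the circle near the initial and the final point.\<close>

definition strip_point :: "chord \<Rightarrow> real \<Rightarrow> real \<Rightarrow> complex" where
  "strip_point l \<tau> y =
     of_real (sqrt (1 - (chord_offset l + y)\<^sup>2) * \<tau>) * chord_dir l +
     of_real (chord_offset l + y) * (\<i> * chord_dir l)"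

text \<open>A model of the band over a chord.  Its core (\<open>t = 0\<close>) is the lift of the chord to the
  paraboloid \<open>z = c (1 - |x|\<^sup>2)\<close>, which meets \<open>z = 0\<close> exactly in the unit circle.  In the
  cross-section orthogonal to the chord, in coordinates given by \<open>y\<close> and by the height above the
  paraboloid, the transverse segment \<open>t \<in> [-\<epsilon>, \<epsilon>]\<close> is rotated by \<open>\<theta> = \<pi> (\<tau> + 1)\<close>.  This makes
  one full turn, and as \<open>\<theta>\<close> increases along the chord the turn is right-handed, which is the
  sign for which the core loop has linking number \<open>+1\<close> with its push-off.\<close>

definition band_point :: "real \<Rightarrow> chord \<Rightarrow> real \<Rightarrow> real \<Rightarrow> space3" where
  "band_point c l \<tau> t =
     (let \<theta> = pi * (\<tau> + 1); x = strip_point l \<tau> (t * cos \<theta>)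
      in (x, c * (1 - (cmod x)\<^sup>2) + t * sin \<theta>))"

definition band :: "chord list \<Rightarrow> real \<Rightarrow> nat \<Rightarrow> space3 set" where
  "band ls \<epsilon> i =
     (\<lambda>(\<tau>, t). band_point (real (Suc i)) (ls ! i) \<tau> t) ` ({-1..1} \<times> {-\<epsilon>..\<epsilon>})"

text \<open>The bands must be narrow enough: they meet the disk only in the attaching arcs, and a band
  with larger index lies over one with smaller index; the latter contains the disjointness of the
  bands.  Every sufficiently small \<open>\<epsilon> > 0\<close> satisfies this.\<close>

definition band_width :: "chord list \<Rightarrow> real \<Rightarrow> bool" where
  "band_width ls \<epsilon> \<longleftrightarrow> 0 < \<epsilon> \<and>
     (\<forall>i < length ls. \<bar>chord_offset (ls ! i)\<bar> + \<epsilon> < 1 \<and>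
        band ls \<epsilon> i \<inter> disk \<subseteq> sphere 0 1 \<times> {0}) \<and>
     (\<forall>j i x s t. j < i \<and> i < length ls \<and> (x, s) \<in> band ls \<epsilon> i \<and> (x, t) \<in> band ls \<epsilon> j
        \<longrightarrow> t < s)"

definition chord_surface :: "chord list \<Rightarrow> real \<Rightarrow> space3 set" where
  "chord_surface ls \<epsilon> = disk \<union> (\<Union>i < length ls. band ls \<epsilon> i)"

definition surface_boundary :: "space3 set \<Rightarrow> space3 set" where
  "surface_boundary S =
     {x \<in> S. \<not> (\<exists>U. openin (top_of_set S) U \<and> x \<in> U \<and> U homeomorphic (UNIV :: complex set))}"

definition coxeter_link :: "chord list \<Rightarrow> real \<Rightarrow> space3 set \<Rightarrow> space3 set \<Rightarrow> bool" where
  "coxeter_link ls \<epsilon> K S \<longleftrightarrow>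
     chord_system ls \<and> coxeter_type ls \<and> band_width ls \<epsilon> \<and>
     S = chord_surface ls \<epsilon> \<and> K = surface_boundary S"

definition core_path :: "chord list \<Rightarrow> nat \<Rightarrow> real \<Rightarrow> space3" where
  "core_path ls i s = band_point (real (Suc i)) (ls ! i) (2 * s - 1) 0"

definition chord_loop :: "chord list \<Rightarrow> nat \<Rightarrow> real \<Rightarrow> space3" where
  "chord_loop ls i =
     linepath (fst (ls ! i), 0) (snd (ls ! i), 0) +++ reversepath (core_path ls i)"

section \<open>First singular homology with real coefficients\<close>

text \<open>The library has singular homology over the integers only.  The real version below reuses its
  singular simplices and face maps; a chain is a finitely supported real function on simplices.\<close>

type_synonym 'a real_chain = "((nat \<Rightarrow> real) \<Rightarrow> 'a) \<Rightarrow> real"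

definition is_chain :: "nat \<Rightarrow> 'a topology \<Rightarrow> 'a real_chain \<Rightarrow> bool" where
  "is_chain p X c \<longleftrightarrow> finite {\<sigma>. c \<sigma> \<noteq> 0} \<and> {\<sigma>. c \<sigma> \<noteq> 0} \<subseteq> singular_simplex_set p X"

definition real_boundary :: "nat \<Rightarrow> 'a real_chain \<Rightarrow> 'a real_chain" where
  "real_boundary p c =
     (\<lambda>\<rho>. \<Sum>\<sigma> | c \<sigma> \<noteq> 0. \<Sum>k\<le>p. if singular_face p k \<sigma> = \<rho> then (-1) ^ k * c \<sigma> else 0)"

definition real_chain_map :: "nat \<Rightarrow> ('a \<Rightarrow> 'b) \<Rightarrow> 'a real_chain \<Rightarrow> 'b real_chain" where
  "real_chain_map p f c = (\<lambda>\<rho>. \<Sum>\<sigma> | c \<sigma> \<noteq> 0 \<and> simplex_map p f \<sigma> = \<rho>. c \<sigma>)"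

definition cycles1 :: "'a topology \<Rightarrow> 'a real_chain set" where
  "cycles1 X = {c. is_chain 1 X c \<and> real_boundary 1 c = (\<lambda>_. 0)}"

definition boundaries1 :: "'a topology \<Rightarrow> 'a real_chain set" where
  "boundaries1 X = real_boundary 2 ` {d. is_chain 2 X d}"

definition hclass :: "'a topology \<Rightarrow> 'a real_chain \<Rightarrow> 'a real_chain set" where
  "hclass X c = {c' \<in> cycles1 X. (\<lambda>\<sigma>. c' \<sigma> - c \<sigma>) \<in> boundaries1 X}"

definition H1 :: "'a topology \<Rightarrow> 'a real_chain set set" where
  "H1 X = hclass X ` cycles1 X"

definition H1_linear :: "'a topology \<Rightarrow> ('a real_chain set \<Rightarrow> 'a real_chain set) \<Rightarrow> bool" where
  "H1_linear X h \<longleftrightarrow> h \<in> H1 X \<rightarrow> H1 X \<and>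
     (\<forall>a \<in> cycles1 X. \<forall>b \<in> cycles1 X. \<forall>a' \<in> h (hclass X a). \<forall>b' \<in> h (hclass X b). \<forall>r s.
        h (hclass X (\<lambda>\<sigma>. r * a \<sigma> + s * b \<sigma>)) = hclass X (\<lambda>\<sigma>. r * a' \<sigma> + s * b' \<sigma>))"

text \<open>The matrix of \<open>h\<close> with respect to the classes of the cycles \<open>b 0, \<dots>, b (n - 1)\<close>; column \<open>j\<close>
  holds the coefficients of the image of the \<open>j\<close>th class.\<close>

definition H1_matrix ::
  "'a topology \<Rightarrow> ('a real_chain set \<Rightarrow> 'a real_chain set) \<Rightarrow> nat \<Rightarrow> (nat \<Rightarrow> 'a real_chain)
     \<Rightarrow> real mat \<Rightarrow> bool" where
  "H1_matrix X h n b A \<longleftrightarrow> A \<in> carrier_mat n n \<and>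
     (\<forall>j < n. h (hclass X (b j)) = hclass X (\<lambda>\<sigma>. \<Sum>i < n. A $$ (i, j) * b i \<sigma>))"

definition path_chain :: "(real \<Rightarrow> 'a) \<Rightarrow> 'a real_chain" where
  "path_chain g =
     (\<lambda>\<sigma>. if \<sigma> = restrict (\<lambda>x. g (x 1)) (standard_simplex 1) then 1 else 0)"

section \<open>Push-offs and monodromy\<close>

definition S3 :: "space3 option topology" where
  "S3 = Alexandroff_compactification euclidean"

definition complement_in_S3 :: "space3 set \<Rightarrow> space3 option topology" where
  "complement_in_S3 S = subtopology S3 (topspace S3 - Some ` S)"

text \<open>A thickening of the surface; its positive side is \<open>z < 0\<close> along the open disk.\<close>

definition bicollar :: "space3 set \<Rightarrow> (space3 \<Rightarrow> real \<Rightarrow> space3) \<Rightarrow> bool" where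
  "bicollar S \<Phi> \<longleftrightarrow>
     continuous_on (S \<times> {-1..1}) (\<lambda>(x, t). \<Phi> x t) \<and>
     inj_on (\<lambda>(x, t). \<Phi> x t) (S \<times> {-1..1}) \<and>
     (\<forall>x \<in> S. \<Phi> x 0 = x) \<and>
     (\<forall>x. cmod x < 1 \<longrightarrow>
        (\<forall>\<^sub>F t in at_right 0. snd (\<Phi> (x, 0) t) < 0 \<and> snd (\<Phi> (x, 0) (-t)) > 0))"

definition push_plus ::
    "(space3 \<Rightarrow> real \<Rightarrow> space3) \<Rightarrow> space3 real_chain \<Rightarrow> space3 option real_chain" where
  "push_plus \<Phi> = real_chain_map 1 (\<lambda>x. Some (\<Phi> x 1))"

definition push_minus ::
    "(space3 \<Rightarrow> real \<Rightarrow> space3) \<Rightarrow> space3 real_chain \<Rightarrow> space3 option real_chain" where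
  "push_minus \<Phi> = real_chain_map 1 (\<lambda>x. Some (\<Phi> x (-1)))"

text \<open>The action of the monodromy on first homology, through the property characterizing it: the
  positive push-off of a cycle \<open>\<alpha>\<close> and the negative push-off of any cycle representing the image
  of its class are homologous in the complement of the surface.\<close>

definition homology_monodromy ::
  "space3 set \<Rightarrow> (space3 \<Rightarrow> real \<Rightarrow> space3) \<Rightarrow> (space3 real_chain set \<Rightarrow> space3 real_chain set)
     \<Rightarrow> bool" where
  "homology_monodromy S \<Phi> h \<longleftrightarrow> H1_linear (top_of_set S) h \<and>
     (\<forall>\<alpha> \<in> cycles1 (top_of_set S). \<forall>\<beta> \<in> h (hclass (top_of_set S) \<alpha>).
        hclass (complement_in_S3 S) (push_plus \<Phi> \<alpha>) =
        hclass (complement_in_S3 S) (push_minus \<Phi> \<beta>))"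

section \<open>Mahler measure\<close>

definition mahler_real :: "real poly \<Rightarrow> real" where
  "mahler_real p = mahler_measure_poly (map_poly complex_of_real p)"

definition lehmer_poly :: "int poly" where
  "lehmer_poly = [:1, 1, 0, -1, -1, -1, -1, -1, 0, 1, 1:]"

end

theory Submission
  imports "HOL-Complex_Analysis.Winding_Numbers" Defs
begin

text \<open>A chord together with the core of its band bounds a planar region, and linking numbers with this
  loop are winding numbers of an explicit map from the 3-sphere to the plane that vanishes only on the
  loop.  Evaluating them on both push-offs of the basis loops gives \<open>M\<^sup>t = M A\<close> for the Seifert matrix
  \<open>M\<close> and the matrix \<open>A\<close> of the monodromy.

  For a Coxeter link \<open>M + M\<^sup>t = 2 - B\<close> with the adjacency matrix \<open>B\<close> of a simple graph.  If this form is
  positive semidefinite, all eigenvalues of \<open>A\<close> lie on the unit circle.  Otherwise suppose that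
  \<open>l M + M\<^sup>t\<close> is nonsingular for all \<open>l \<ge> \<lambda>\<close>, where \<open>\<lambda>\<close> is Lehmer's number.  Then, by continuity from large
  \<open>l\<close>, it is a nonsingular M-matrix for \<open>l = \<lambda>\<close>, and the geometric mean of positive vectors for it and for its
  transpose is a positive vector \<open>z\<close> with \<open>B z < a z\<close>, \<open>a\<^sup>2 = \<lambda> + 1/\<lambda> + 2\<close>.  Since \<open>a\<close> is the spectral radius
  of the graph \<open>E\<^bsub>10\<^esub>\<close>, this confines the graph to the finite and affine types A, D, E, for which
  \<open>M + M\<^sup>t\<close> is semidefinite.  Hence \<open>A\<close> has an eigenvalue \<open>-l\<close> with \<open>l \<ge> \<lambda>\<close>.\<close>

text \<open>If every vertex is a source or a sink, rescaling the sources against the sinks turns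
  \<open>l M + M^t\<close> into \<open>(l + 1) - sqrt l * B\<close>, so this matrix is singular
  exactly if \<open>(l + 1) / sqrt l\<close> is an eigenvalue of \<open>B\<close>; this is the
  origin of \<open>a\<close>. The order of the chords gives an arbitrary acyclic orientation, for
  which the inequality \<open>B z < a z\<close> is what survives. Its strictness matters:
  \<open>E_10\<close> itself has a positive vector with equality. The types A, D, E are never
  identified as graphs. Semidefiniteness follows from a positive \<open>u\<close> with
  \<open>B u <= 2 u\<close>, and the null vectors of the affine types serve as templates for
  \<open>u\<close>.

  In the topological part the collar is the obstacle: it is merely continuous, and its sides are
  fixed along the open disk only, for times that depend on the point. Push-offs are therefore never
  computed but deformed in the complement of the surface until a loop in the surface decides the
  winding number.\<close>

section \<open>Graphs with a supersolution for the spectral radius of \<open>E\<^bsub>10\<^esub>\<close>\<close>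

text \<open>If \<open>B z < a z\<close>, then \<open>z\<close> decreases by at most the factor \<open>arm_ratio a k\<close> along the first edge of a
  walk with \<open>k\<close> edges.\<close>

primrec arm_ratio :: "real \<Rightarrow> nat \<Rightarrow> real" where
  "arm_ratio a 0 = 0"
| "arm_ratio a (Suc k) = 1 / (a - arm_ratio a k)"

section \<open>Walks, arms and superharmonic functions on a finite graph\<close>

locale finite_graph =
  fixes V :: "'a set" and nb :: "'a \<Rightarrow> 'a set"
  assumes fin: "finite V"
    and nb_V: "w \<in> nb v \<Longrightarrow> w \<in> V"
    and nb_sym: "w \<in> nb v \<Longrightarrow> v \<in> nb w"
    and nb_irrefl: "v \<notin> nb v"
begin

lemma fin_nb [simp]: "finite (nb v)"
  using fin nb_V by (meson finite_subset subsetI)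

definition leaf :: "'a \<Rightarrow> bool" where "leaf v \<longleftrightarrow> card (nb v) = 1"

text \<open>Walks are only required not to turn back; a cycle is an endless walk and needs no separate treatment.\<close>

primrec walk :: "nat \<Rightarrow> 'a \<Rightarrow> 'a \<Rightarrow> bool" where
  "walk 0 x y = True"
| "walk (Suc k) x y \<longleftrightarrow> y \<in> nb x \<and> (k = 0 \<or> (\<exists>w \<in> nb y. w \<noteq> x \<and> walk k y w))"

text \<open>No length is attached to the walk, so that a single constant can be propagated along it.
  If this fails for every edge at \<open>b\<close>, the arms of \<open>b\<close> are
  unbranched.\<close>

inductive meets_branch :: "'a \<Rightarrow> 'a \<Rightarrow> bool" where
  here: "y \<in> nb x \<Longrightarrow> card (nb y) \<ge> 3 \<Longrightarrow> meets_branch x y"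
| beyond: "y \<in> nb x \<Longrightarrow> w \<in> nb y \<Longrightarrow> w \<noteq> x \<Longrightarrow> meets_branch y w \<Longrightarrow> meets_branch x y"

text \<open>The whole last edge from \<open>x\<close> to \<open>y\<close> is recorded because the
  next step must not turn back; \<open>k\<close> counts the edges walked from
  \<open>b\<close>.\<close>

inductive on_arm :: "'a \<Rightarrow> 'a \<Rightarrow> 'a \<Rightarrow> 'a \<Rightarrow> nat \<Rightarrow> bool" for b y0 where
  start: "y0 \<in> nb b \<Longrightarrow> on_arm b y0 b y0 1"
| step: "on_arm b y0 x y k \<Longrightarrow> w \<in> nb y \<Longrightarrow> w \<noteq> x \<Longrightarrow> on_arm b y0 y w (Suc k)"

text \<open>Without bad vertices a component has type A or D, finite or affine; a bad vertex will turn out to be the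
  branch vertex of a graph of type E.\<close>

definition bad :: "'a \<Rightarrow> bool" where
  "bad b \<longleftrightarrow> card (nb b) \<ge> 5 \<or> (card (nb b) = 4 \<and> (\<exists>y \<in> nb b. \<not> leaf y)) \<or>
     (card (nb b) = 3 \<and> (\<exists>y \<in> nb b. \<exists>y' \<in> nb b. y \<noteq> y' \<and> \<not> leaf y \<and> \<not> leaf y'))"

lemma walk_antimono: "walk k x y \<Longrightarrow> j \<le> k \<Longrightarrow> walk j x y"
proof (induction k arbitrary: j x y)
  case (Suc k)
  then show ?case by (cases j) fastforce+
qed auto

lemma not_leaf_walk: 
  assumes "y \<in> nb x" "\<not> leaf y" shows "walk 2 x y"
proof -
  have "x \<in> nb y" using assms nb_sym by blast
  then have "\<exists>w \<in> nb y. w \<noteq> x"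
    using assms(2) unfolding leaf_def by (metis card_1_singleton_iff is_singletonI' is_singleton_def One_nat_def empty_iff)
  then show ?thesis using assms by (auto simp: numeral_2_eq_2)
qed

lemma on_arm_nb: "on_arm b y0 x y k \<Longrightarrow> y \<in> nb x \<and> k \<ge> 1"
  by (induction rule: on_arm.induct) auto

text \<open>The edge from \<open>x\<close> to \<open>y\<close> is the last one of the arm and the
  first one of the walk, so it is counted once: \<open>m + k\<close> edges.\<close>

lemma on_arm_walk: "on_arm b y0 x y k \<Longrightarrow> walk (Suc m) x y \<Longrightarrow> walk (m + k) b y0"
proof (induction arbitrary: m rule: on_arm.induct)
  case start then show ?case by simp
next
  case (step x y k w)
  have "walk (Suc (Suc m)) x y" using step on_arm_nb by auto
  from step.IH[OF this] show ?case by simp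
qed

lemma on_arm_meets_branch: "on_arm b y0 x y k \<Longrightarrow> meets_branch x y \<Longrightarrow> meets_branch b y0"
proof (induction rule: on_arm.induct)
  case (step x y k w)
  then show ?case using meets_branch.beyond on_arm_nb by blast
qed auto

text \<open>A vertex may carry several labels when the walks from \<open>b\<close> revisit it; taking the least one
  keeps the function superharmonic.\<close>

lemma arm_superharmonic:
  fixes K :: "'a \<Rightarrow> nat"
  assumes capacity: "\<And>y. y \<in> nb b \<Longrightarrow> \<not> walk (Suc (K y)) b y"
    and no_branch: "\<And>y. y \<in> nb b \<Longrightarrow> \<not> meets_branch b y"
    and total: "(\<Sum>y \<in> nb b. 1 - 1 / (real (K y) + 1)) \<le> 2"
  obtains u where "\<And>v. u v \<ge> 0" "\<And>v. (\<Sum>w \<in> nb v. u w) \<le> 2 * u v"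
    "u b > 0" "\<And>v w. w \<in> nb v \<Longrightarrow> u v > 0 \<Longrightarrow> u w > (0::real)"
proof -
  \<comment> \<open>Along an arm with at most \<open>K y\<close> edges the label falls linearly from
    1 at \<open>b\<close> and would reach 0 one edge past the end. With this profile
    \<open>total\<close> is superharmonicity at \<open>b\<close>, with equality for the null vectors
    of affine \<open>E_6\<close>, \<open>E_7\<close>, \<open>E_8\<close>.\<close>
  define L where "L v = {l. l = 1 \<and> v = b} \<union>
     {1 - real k / (real (K y) + 1) | y x k. on_arm b y x v k}" for v
  have arm: "y \<in> nb b \<and> k \<le> K y \<and> card (nb v) \<le> 2 \<and> v \<in> nb x \<and> k \<ge> 1" if "on_arm b y x v k" for y x v k
  proof -
    have y: "y \<in> nb b" using that by (induction rule: on_arm.induct)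
    have n: "v \<in> nb x" "k \<ge> 1" using on_arm_nb[OF that] by auto
    have "walk k b y" using on_arm_walk[OF that, of 0] n by simp
    then have "k \<le> K y" using capacity[OF y] walk_antimono not_less_eq_eq by blast
    moreover have "card (nb v) \<le> 2"
      using no_branch[OF y] on_arm_meets_branch[OF that] meets_branch.here n by fastforce
    ultimately show ?thesis using y n by blast
  qed
  have "L v \<subseteq> insert 1 (\<Union>y \<in> nb b. (\<lambda>k. 1 - real k / (real (K y) + 1)) ` {..K y})" for v
    unfolding L_def using arm by fastforce
  then have finL: "finite (L v)" for v
    by (rule finite_subset) auto
  have Lpos: "l > 0" if "l \<in> L v" for l v
    using that unfolding L_def by (auto dest!: arm)
  define u where "u v = (if L v = {} then 0 else Min (L v))" for v
  have u_le: "u v \<le> l" if "l \<in> L v" for v l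
    using that finL unfolding u_def by auto
  have u_pos: "u v > 0" if "L v \<noteq> {}" for v
    using that finL Lpos unfolding u_def by auto
  have u0: "u v \<ge> 0" for v using u_pos[of v] unfolding u_def by force
  have armL: "1 - real k / (real (K y) + 1) \<in> L v" if "on_arm b y x v k" for y x v k
    unfolding L_def using that by blast
  \<comment> \<open>For \<open>k = 1\<close> the predecessor is \<open>b\<close>, whose label 1 fits
    the same formula.\<close>
  have prev: "\<exists>l \<in> L x. l = 1 - (real k - 1) / (real (K y) + 1)" if "on_arm b y x v k" for y x v k
    using that
  proof cases
    case start then show ?thesis unfolding L_def by auto
  next
    case (step x' k')
    then show ?thesis using armL[OF step(2)] by simp
  qed
  have closed: "L w \<noteq> {}" if "w \<in> nb v" "L v \<noteq> {}" for v w
  proof -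
    from that(2) consider "v = b" | y x k where "on_arm b y x v k" unfolding L_def by blast
    then show ?thesis
    proof cases
      case 1 then show ?thesis using armL[OF on_arm.start[of w b]] that by blast
    next
      case 2 
      show ?thesis
      proof (cases "w = x")
        case True then show ?thesis using prev[OF 2] by blast
      next
        case False
        then show ?thesis using armL[OF on_arm.step[OF 2 that(1)]] by blast
      qed
    qed
  qed
  have "(\<Sum>w \<in> nb v. u w) \<le> 2 * u v" for v
  proof (cases "L v = {}")
    case True
    then have "L w = {}" if "w \<in> nb v" for w using closed[of v w] nb_sym that by blast
    then show ?thesis using True by (simp add: u_def)
  next
    case False
    then have "u v \<in> L v" unfolding u_def using finL Min_in by auto
    then consider "v = b" "u v = 1" | y x k where "on_arm b y x v k" "u v = 1 - real k / (real (K y) + 1)"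
      unfolding L_def by blast
    then show ?thesis
    proof cases
      case 1
      have "(\<Sum>w \<in> nb b. u w) \<le> (\<Sum>y \<in> nb b. 1 - 1 / (real (K y) + 1))"
        using u_le[OF armL[OF on_arm.start]] by (intro sum_mono) auto
      then show ?thesis using total 1 by simp
    next
      case 2
      note a = arm[OF 2(1)]
      have vx: "x \<in> nb v" using a nb_sym by blast
      obtain l where l: "l \<in> L x" "l = 1 - (real k - 1) / (real (K y) + 1)" using prev[OF 2(1)] by blast
      have ux: "u x \<le> 1 - (real k - 1) / (real (K y) + 1)" using u_le[OF l(1)] l(2) by simp
      \<comment> \<open>At most one neighbour is left besides \<open>x\<close>. If there is none,
        the claim is \<open>k <= K y\<close>; if there is one, it is next on the arm, and the labels
        for \<open>k - 1\<close> and \<open>k + 1\<close> average to the one for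
        \<open>k\<close>.\<close>
      have rest: "(\<Sum>w \<in> nb v - {x}. u w) \<le> 1 - (real k + 1) / (real (K y) + 1)"
      proof (cases "nb v - {x} = {}")
        case True
        have "real k + 1 \<le> real (K y) + 1" using a by simp
        then show ?thesis unfolding True by simp
      next
        case False
        then obtain w where w: "w \<in> nb v" "w \<noteq> x" by blast
        have "card (nb v - {x}) \<le> 1" using a vx by (simp add: le_diff_conv)
        then have "nb v - {x} = {w}" using w
          by (metis False One_nat_def card_1_singletonE card_gt_0_iff fin_nb finite_Diff insertI1 le_antisym insertE emptyE Diff_iff singletonI Suc_leI)
        then show ?thesis using u_le[OF armL[OF on_arm.step[OF 2(1) w]]] by (simp add: algebra_simps)
      qed
      have "(\<Sum>w \<in> nb v. u w) = u x + (\<Sum>w \<in> nb v - {x}. u w)"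
        by (rule sum.remove[OF fin_nb vx])
      also have "\<dots> \<le> (1 - (real k - 1) / (real (K y) + 1)) + (1 - (real k + 1) / (real (K y) + 1))"
        using ux rest by linarith
      also have "\<dots> = 2 * u v" using 2(2) by (simp add: add_divide_distrib diff_divide_distrib)
      finally show ?thesis .
    qed
  qed
  moreover have "u b > 0" by (rule u_pos) (simp add: L_def)
  moreover have "u w > 0" if "w \<in> nb v" "u v > 0" for v w
    using closed[OF that(1)] u_pos that(2) u_def by fastforce
  ultimately show ?thesis using that u0 by blast
qed

text \<open>The null vector of affine D: 1 at the leaves attached to a branch vertex and 2
  elsewhere; for affine A it is constant. Outside the union of components \<open>C\<close> the
  function vanishes.\<close>

lemma superharmonic_no_bad:
  assumes C: "\<And>v w. v \<in> C \<Longrightarrow> w \<in> nb v \<Longrightarrow> w \<in> C" and nobad: "\<And>v. v \<in> C \<Longrightarrow> \<not> bad v"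
  obtains u where "\<And>v. u v \<ge> 0" "\<And>v. (\<Sum>w \<in> nb v. u w) \<le> 2 * u v"
    "\<And>v. v \<in> C \<Longrightarrow> u v > (0::real)"
proof -
  define s where "s v \<longleftrightarrow> leaf v \<and> (\<exists>w \<in> nb v. card (nb w) \<ge> 3)" for v
  define u :: "'a \<Rightarrow> real" where "u v = (if v \<notin> C then 0 else if s v then 1 else 2)" for v
  have u2: "u v \<le> 2" for v unfolding u_def by simp
  have "(\<Sum>w \<in> nb v. u w) \<le> 2 * u v" for v
  proof (cases "v \<in> C")
    case False
    then have "w \<notin> C" if "w \<in> nb v" for w using C[of w v] nb_sym that by blast
    then show ?thesis using False by (simp add: u_def)
  next
    case True
    have bnd: "(\<Sum>w \<in> nb v. u w) \<le> 2 * real (card (nb v))"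
      using sum_mono[of "nb v" u "\<lambda>_. 2"] u2 by simp
    show ?thesis
    proof (cases "s v")
      case s: True
      then show ?thesis using bnd True by (simp add: s_def leaf_def u_def)
    next
      case ns: False
      then have uv: "u v = 2" using True by (simp add: u_def)
      have nbad: "\<not> bad v" using nobad True by blast
      have leaf1: "u w \<le> 1" if "w \<in> nb v" "leaf w" "card (nb v) \<ge> 3" for w
        using that nb_sym[OF that(1)] unfolding u_def s_def by auto
      consider "card (nb v) \<le> 2" | "card (nb v) = 3" | "card (nb v) = 4"
        using nbad unfolding bad_def by linarith
      then show ?thesis
      proof cases
        case 1 then show ?thesis using bnd uv by simp
      next
        case 2
        obtain p q r where pqr: "nb v = {p,q,r}" "p \<noteq> q" "p \<noteq> r" "q \<noteq> r"
          using 2 card_3_iff[of "nb v"] by blast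
        have "(leaf p \<and> leaf q) \<or> (leaf p \<and> leaf r) \<or> (leaf q \<and> leaf r)"
          using nbad 2 pqr unfolding bad_def by blast
        then have "u p + u q + u r \<le> 4" using leaf1[of p] leaf1[of q] leaf1[of r] u2[of p] u2[of q] u2[of r] 2 pqr(1)
          by force
        then show ?thesis using pqr uv by simp
      next
        case 3
        then have "\<forall>w \<in> nb v. leaf w" using nbad unfolding bad_def by blast
        then have "(\<Sum>w \<in> nb v. u w) \<le> (\<Sum>w \<in> nb v. 1)" using leaf1 3 by (intro sum_mono) auto
        then show ?thesis using 3 uv by simp
      qed
    qed
  qed
  moreover have "u v \<ge> 0" "v \<in> C \<Longrightarrow> u v > 0" for v unfolding u_def by auto
  ultimately show ?thesis using that by blast
qed

end

section \<open>Numerical bounds along an arm and the exclusion of long arms\<close>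

lemma arm_ratio_bounds:
  assumes a: "20065 / 10000 < a" "a < (20066 / 10000 :: real)"
  shows "498 / 1000 < arm_ratio a 1" "arm_ratio a 1 < 499 / 1000"
    "662 / 1000 < arm_ratio a 2" "arm_ratio a 2 < 664 / 1000"
    "743 / 1000 < arm_ratio a 3" "arm_ratio a 3 < 746 / 1000"
    "79 / 100 < arm_ratio a 4" "arm_ratio a 4 < 794 / 1000"
    "81 / 100 < arm_ratio a 5" "arm_ratio a 5 < 826 / 1000"
proof -
  \<comment> \<open>\<open>1 / (a - t)\<close> increases with \<open>t\<close> and decreases with
    \<open>a\<close>, so the lower bound is taken at the largest \<open>a\<close> and the upper one
    at the smallest.\<close>
  have step: "l' < arm_ratio a (Suc k)" "arm_ratio a (Suc k) < h'"
    if "l \<le> arm_ratio a k" "arm_ratio a k \<le> h" "h < 2" "l' * (20066 / 10000 - l) \<le> 1" "1 \<le> h' * (20065 / 10000 - h)" "l' > 0" "h' > 0" 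
    for k l h l' h'
  proof -
    have p: "a - arm_ratio a k > 0" using that a by linarith
    have "l' * (a - arm_ratio a k) < l' * (20066 / 10000 - l)" using that a by (intro mult_strict_left_mono) auto
    then have "l' * (a - arm_ratio a k) < 1" using that by linarith
    then show "l' < arm_ratio a (Suc k)" using p by (simp add: less_divide_eq)
    have "h' * (20065 / 10000 - h) < h' * (a - arm_ratio a k)" using that a by (intro mult_strict_left_mono) auto
    then have "1 < h' * (a - arm_ratio a k)" using that by linarith
    then show "arm_ratio a (Suc k) < h'" using p by (simp add: divide_less_eq)
  qed
  show 1: "498 / 1000 < arm_ratio a 1" "arm_ratio a 1 < 499 / 1000"
    using step[of 0 0 0 "498 / 1000" "499 / 1000"] by auto
  show 2: "662 / 1000 < arm_ratio a 2" "arm_ratio a 2 < 664 / 1000"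
    using step[of "498 / 1000" 1 "499 / 1000" "662 / 1000" "664 / 1000"] 1 by (simp_all del: arm_ratio.simps add: eval_nat_numeral)
  show 3: "743 / 1000 < arm_ratio a 3" "arm_ratio a 3 < 746 / 1000"
    using step[of "662 / 1000" 2 "664 / 1000" "743 / 1000" "746 / 1000"] 2 by (simp_all del: arm_ratio.simps add: eval_nat_numeral)
  show 4: "79 / 100 < arm_ratio a 4" "arm_ratio a 4 < 794 / 1000"
    using step[of "743 / 1000" 3 "746 / 1000" "79 / 100" "794 / 1000"] 3 by (simp_all del: arm_ratio.simps add: eval_nat_numeral)
  show 5: "81 / 100 < arm_ratio a 5" "arm_ratio a 5 < 826 / 1000"
    using step[of "79 / 100" 4 "794 / 1000" "81 / 100" "826 / 1000"] 4 by (simp_all del: arm_ratio.simps add: eval_nat_numeral)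
qed

text \<open>The equation for \<open>a\<close> is the eigenvalue equation of \<open>E\<^bsub>10\<^esub>\<close> at its branch vertex, whose arms have
  1, 2 and 6 edges.\<close>

locale small_supersolution = finite_graph +
  fixes a :: real and z :: "'a \<Rightarrow> real"
  assumes a: "20065 / 10000 < a" "a < 20066 / 10000"
    and lehmer: "arm_ratio a 1 + arm_ratio a 2 + arm_ratio a 6 = a"
    and z_pos: "z v > 0"
    and z_super: "v \<in> V \<Longrightarrow> (\<Sum>w \<in> nb v. z w) < a * z v"
begin

lemmas bounds = arm_ratio_bounds[OF a]

lemma sum_less: "v \<in> V \<Longrightarrow> A \<subseteq> nb v \<Longrightarrow> (\<Sum>w \<in> A. z w) < a * z v"
  by (smt (verit) z_super fin_nb sum_mono2 z_pos less_imp_le Diff_iff)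

lemma nb_V': "w \<in> nb v \<Longrightarrow> v \<in> V"
  using nb_V nb_sym by blast

lemma arm_ratio_less_a: "k \<le> 5 \<Longrightarrow> arm_ratio a k < a"
proof -
  assume "k \<le> 5"
  then have "k \<in> {0,1,2,3,4,5}" by auto
  then show ?thesis using bounds a by auto
qed

text \<open>At \<open>y\<close> the neighbours \<open>x\<close> and \<open>w\<close> contribute at
  least \<open>z x + arm_ratio a k * z y\<close>, which must stay below \<open>a * z y\<close>;
  solving for \<open>z y\<close> is one step of the continued fraction. Up to six edges its
  denominators are known to be positive.\<close>

lemma walk_ratio: "walk k x y \<Longrightarrow> 1 \<le> k \<Longrightarrow> k \<le> 6 \<Longrightarrow> arm_ratio a k * z x < z y"
proof (induction k arbitrary: x y)
  case (Suc k)
  have y: "y \<in> nb x" using Suc by auto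
  have less: "arm_ratio a k < a" using arm_ratio_less_a Suc by simp
  have xy: "x \<in> nb y" "y \<in> V" using y nb_sym nb_V by auto
  have "z x + arm_ratio a k * z y < a * z y"
  proof (cases "k = 0")
    case True
    then show ?thesis using sum_less[of y "{x}"] xy by simp
  next
    case False
    then obtain w where w: "w \<in> nb y" "w \<noteq> x" "walk k y w" using Suc by auto
    have "z x + z w < a * z y" using sum_less[of y "{x,w}"] xy w by simp
    then show ?thesis using Suc.IH[OF w(3)] Suc.prems False by simp
  qed
  then show ?case using less by (simp add: field_simps)
qed auto

lemma nb_ratio: "y \<in> nb x \<Longrightarrow> arm_ratio a 1 * z x < z y"
  using walk_ratio[of 1] by simp

lemma nonleaf_ratio: "y \<in> nb x \<Longrightarrow> \<not> leaf y \<Longrightarrow> arm_ratio a 2 * z x < z y"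
  using walk_ratio[of 2] not_leaf_walk by simp

text \<open>The constant 9/10 has to fit three places. At a branch vertex the two other neighbours
  force \<open>z x < 1.011 * z y\<close>; a further edge preserves 9/10 because
  \<open>1 / (a - 9/10) > 9/10\<close>; and 9/10 is large enough to contradict the sum at a bad
  vertex.\<close>

lemma meets_branch_ratio: "meets_branch x y \<Longrightarrow> 9 / 10 * z x < z y"
proof (induction rule: meets_branch.induct)
  case (here y x)
  have xy: "x \<in> nb y" "y \<in> V" using here nb_sym nb_V by auto
  have "card (nb y - {x}) \<ge> 2" using here xy by simp
  then obtain A where A: "A \<subseteq> nb y - {x}" "card A = 2" by (meson obtain_subset_with_card_n)
  then obtain p q where pq: "A = {p, q}" "p \<noteq> q" by (meson card_2_iff)
  have "p \<noteq> x" "q \<noteq> x" "p \<in> nb y" "q \<in> nb y" using A pq by auto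
  then have "z x + (z p + z q) < a * z y" "arm_ratio a 1 * z y < z p" "arm_ratio a 1 * z y < z q"
    using sum_less[of y "{x,p,q}"] xy pq nb_ratio by auto
  moreover have "498 / 1000 * z y \<le> arm_ratio a 1 * z y" using bounds z_pos by (intro mult_right_mono) (auto simp: less_imp_le)
  moreover have "a * z y \<le> 20066 / 10000 * z y" using a z_pos by (intro mult_right_mono) (auto simp: less_imp_le)
  ultimately show ?case using z_pos[of y] z_pos[of x] by linarith
next
  case (beyond y x w)
  have xy: "x \<in> nb y" "y \<in> V" using beyond nb_sym nb_V by auto
  have "z x + z w < a * z y" using sum_less[of y "{x,w}"] xy beyond by simp
  moreover have "a * z y \<le> 20066 / 10000 * z y" using a z_pos by (intro mult_right_mono) (auto simp: less_imp_le)
  ultimately show ?case using beyond.IH z_pos[of x] z_pos[of y] by linarith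
qed

lemma center:
  assumes "p \<in> nb b" "q \<in> nb b" "r \<in> nb b" "p \<noteq> q" "p \<noteq> r" "q \<noteq> r"
    "P * z b < z p" "Q * z b < z q" "R * z b < z r"
  shows "P + Q + R < a"
proof -
  have "z p + z q + z r < a * z b"
    using sum_less[of b "{p,q,r}"] assms nb_V' by auto
  then have "(P + Q + R) * z b < a * z b" using assms by (simp add: algebra_simps)
  then show ?thesis using z_pos[of b] by simp
qed

text \<open>Five neighbours already give \<open>5 * 0.498 > a\<close>, and a non-leaf together with
  three others gives \<open>0.662 + 3 * 0.498 > a\<close>.\<close>

lemma bad_card: assumes "bad b" shows "card (nb b) = 3"
proof (rule ccontr)
  assume "card (nb b) \<noteq> 3"
  then consider "card (nb b) \<ge> 5" | y where "card (nb b) = 4" "y \<in> nb b" "\<not> leaf y"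
    using assms unfolding bad_def by blast
  then show False
  proof cases
    case 1
    then have ne: "nb b \<noteq> {}" by auto
    then have "b \<in> V" using nb_V' by blast
    have "(\<Sum>w \<in> nb b. 498 / 1000 * z b) \<le> (\<Sum>w \<in> nb b. z w)"
    proof (rule sum_mono)
      fix w assume "w \<in> nb b"
      then have "arm_ratio a 1 * z b < z w" by (rule nb_ratio)
      moreover have "498 / 1000 * z b \<le> arm_ratio a 1 * z b" using bounds z_pos by (intro mult_right_mono) (auto simp: less_imp_le)
      ultimately show "498 / 1000 * z b \<le> z w" by linarith
    qed
    then have "real (card (nb b)) * (498 / 1000 * z b) \<le> (\<Sum>w \<in> nb b. z w)" by simp
    moreover have "5 * (498 / 1000 * z b) \<le> real (card (nb b)) * (498 / 1000 * z b)" using 1 z_pos[of b] by (intro mult_right_mono) auto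
    moreover have "(\<Sum>w \<in> nb b. z w) < a * z b" using z_super \<open>b \<in> V\<close> by blast
    moreover have "a * z b \<le> 20066 / 10000 * z b" using a z_pos by (intro mult_right_mono) (auto simp: less_imp_le)
    ultimately show False using z_pos[of b] by linarith
  next
    case 2
    have "card (nb b - {y}) = 3" using 2 by simp
    then obtain p q r where pqr: "nb b - {y} = {p,q,r}" "p \<noteq> q" "p \<noteq> r" "q \<noteq> r"
      using card_3_iff[of "nb b - {y}"] by blast
    then have in3: "p \<in> nb b" "q \<in> nb b" "r \<in> nb b" "p \<noteq> y" "q \<noteq> y" "r \<noteq> y" by blast+
    have "z y + z p + z q + z r < a * z b" using sum_less[of b "{y,p,q,r}"] pqr in3 2 nb_V' by auto
    then have "(arm_ratio a 2 + 3 * arm_ratio a 1) * z b < a * z b"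
      using nonleaf_ratio[OF 2(2,3)] nb_ratio[OF in3(1)] nb_ratio[OF in3(2)] nb_ratio[OF in3(3)] by (simp add: algebra_simps del: arm_ratio.simps One_nat_def)
    then have "arm_ratio a 2 + 3 * arm_ratio a 1 < a" using z_pos[of b] by simp
    then show False using bounds a by linarith
  qed
qed

lemma bad_superharmonic:
  assumes "bad b"
  obtains u where "\<And>v. u v \<ge> 0" "\<And>v. (\<Sum>w \<in> nb v. u w) \<le> 2 * u v"
    "u b > 0" "\<And>v w. w \<in> nb v \<Longrightarrow> u v > 0 \<Longrightarrow> u w > (0::real)"
proof -
  obtain p q where pq: "p \<in> nb b" "q \<in> nb b" "p \<noteq> q" "\<not> leaf p" "\<not> leaf q"
    using assms bad_card[OF assms] unfolding bad_def by auto
  have "card (nb b - {p, q}) = 1" using bad_card[OF assms] pq by (simp add: card_Diff_subset)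
  then obtain r where "nb b - {p,q} = {r}" by (meson card_1_singletonE)
  then have nb: "nb b = {p,q,r}" "r \<noteq> p" "r \<noteq> q" and r: "r \<in> nb b" using pq by blast+
  have other: "\<exists>p' q'. {p', q'} \<subseteq> nb b \<and> p' \<noteq> q' \<and> p' \<noteq> y \<and> q' \<noteq> y \<and> \<not> leaf q'" if "y \<in> nb b" for y
    using that nb pq by blast
  \<comment> \<open>Besides \<open>y\<close> there are two more neighbours, one of them not a leaf,
    and \<open>9/10 + 0.498 + 0.662\<close> exceeds \<open>a\<close>.\<close>
  have no_branch: "\<not> meets_branch b y" if y: "y \<in> nb b" for y
  proof
    assume "meets_branch b y"
    then have "9 / 10 * z b < z y" by (rule meets_branch_ratio)
    moreover obtain p' q' where "{p', q'} \<subseteq> nb b" "p' \<noteq> q'" "p' \<noteq> y" "q' \<noteq> y" "\<not> leaf q'"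
      using other[OF y] by blast
    ultimately have "9 / 10 + arm_ratio a 1 + arm_ratio a 2 < a" using y
        nb_ratio[of p' b] nonleaf_ratio[of q' b] by (intro center[of y b p' q']) auto
    then show False using bounds a by linarith
  qed
  \<comment> \<open>Arms with 1, 2 and 6 edges form \<open>E_10\<close>, where the ratios add up to
    exactly \<open>a\<close>; the strict inequality of \<open>center\<close> excludes this.\<close>
  have no6: "\<not> walk 6 b y" if y: "y \<in> nb b" for y
  proof
    assume "walk 6 b y"
    then have "arm_ratio a 6 * z b < z y" using walk_ratio by simp
    moreover obtain p' q' where "{p', q'} \<subseteq> nb b" "p' \<noteq> q'" "p' \<noteq> y" "q' \<noteq> y" "\<not> leaf q'"
      using other[OF y] by blast
    ultimately have "arm_ratio a 1 + arm_ratio a 2 + arm_ratio a 6 < a" using y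
        nb_ratio[of p' b] nonleaf_ratio[of q' b] by (intro center[of p' b q' y]) auto
    then show False using lehmer by simp
  qed
  \<comment> \<open>The lengths are those of affine \<open>E_6\<close> and \<open>E_7\<close> with
    one arm prolonged by an edge; the ratios then add up to more than 2.03.\<close>
  have excl: False if "{x,y,w} \<subseteq> nb b" "x \<noteq> y" "x \<noteq> w" "y \<noteq> w" "walk i b x" "walk j b y" "walk k b w"
    "(i,j,k) \<in> {(2,2,3), (1,3,4)}" for x y w i j k
  proof -
    have ijk: "1 \<le> i" "i \<le> 6" "1 \<le> j" "j \<le> 6" "1 \<le> k" "k \<le> 6" using that by auto
    have "arm_ratio a i + arm_ratio a j + arm_ratio a k < a"
      using that ijk walk_ratio by (intro center[of x b y w]) blast+
    moreover have "(i = 2 \<and> j = 2 \<and> k = 3) \<or> (i = 1 \<and> j = 3 \<and> k = 4)" using that by blast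
    ultimately show False using bounds a by (elim disjE conjE; hypsubst; linarith)
  qed
  note wk = not_leaf_walk[OF pq(1,4)] not_leaf_walk[OF pq(2,5)]
  have w1: "walk 1 b r" using r by simp
  \<comment> \<open>The arm lengths \<open>(2, 2, 2)\<close>, \<open>(1, 2, 5)\<close>, \<open>(1, 3, 3)\<close> are those of affine \<open>E\<^sub>6\<close>, \<open>E\<^sub>8\<close>, \<open>E\<^sub>7\<close>.\<close>
  have "\<exists>K. (\<forall>y \<in> nb b. \<not> walk (Suc (K y)) b y) \<and> (\<Sum>y \<in> nb b. 1 - 1 / (real (K y) + 1)) \<le> 2"
  proof (cases "leaf r")
    case False
    note wr = not_leaf_walk[OF r False]
    have "\<not> walk 3 b y" if "y \<in> {p,q,r}" for y
      using that excl[of p q r 2 2 3] excl[of p r q 2 2 3] excl[of r q p 2 2 3] wk wr nb pq r by blast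
    then show ?thesis using nb pq by (intro exI[of _ "\<lambda>_. 2"]) (auto simp del: walk.simps simp: numeral_3_eq_3[symmetric])
  next
    case True
    have r2: "\<not> walk 2 b r"
    proof
      assume "walk 2 b r"
      then obtain w where "w \<in> nb r" "w \<noteq> b" by (auto simp: numeral_2_eq_2)
      moreover have "b \<in> nb r" using r nb_sym by blast
      ultimately show False using True unfolding leaf_def by (auto simp: card_1_singleton_iff)
    qed
    have n6: "\<not> walk 6 b p" "\<not> walk 6 b q" using no6 pq by auto
    show ?thesis
    proof (cases "walk 4 b p")
      case True
      then have "\<not> walk 3 b q" using excl[of r q p 1 3 4] nb pq r w1 by blast
      then show ?thesis using nb pq r2 n6 by (intro exI[of _ "\<lambda>y. if y = p then 5 else if y = q then 2 else 1"])
        (auto simp del: walk.simps simp: numeral_3_eq_3[symmetric] numeral_2_eq_2[symmetric])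
    next
      case p4: False
      show ?thesis
      proof (cases "walk 4 b q")
        case True
        then have "\<not> walk 3 b p" using excl[of r p q 1 3 4] nb pq r w1 by blast
        then show ?thesis using nb pq r2 n6 by (intro exI[of _ "\<lambda>y. if y = q then 5 else if y = p then 2 else 1"])
          (auto simp del: walk.simps simp: numeral_3_eq_3[symmetric] numeral_2_eq_2[symmetric])
      next
        case False
        then show ?thesis using nb pq r2 p4 by (intro exI[of _ "\<lambda>y. if y = r then 1 else 3"])
          (auto simp del: walk.simps simp: numeral_3_eq_3[symmetric] numeral_2_eq_2[symmetric])
      qed
    qed
  qed
  then obtain K where "\<And>y. y \<in> nb b \<Longrightarrow> \<not> walk (Suc (K y)) b y" "(\<Sum>y \<in> nb b. 1 - 1 / (real (K y) + 1)) \<le> 2"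
    by blast
  then show ?thesis using arm_superharmonic[of b K] no_branch that by blast
qed

text \<open>Superharmonicity is preserved by sums, so for each \<open>x\<close> a nonnegative
  function that is positive at \<open>x\<close> suffices. Which of the two constructions supplies it
  depends on whether the component of \<open>x\<close> has a bad vertex.\<close>

theorem superharmonic:
  obtains u where "\<And>v. v \<in> V \<Longrightarrow> u v > 0" "\<And>v. (\<Sum>w \<in> nb v. u w) \<le> 2 * (u v :: real)"
proof -
  let ?R = "{(v, w). w \<in> nb v}\<^sup>*"
  have "\<exists>u. (\<forall>v. u v \<ge> 0) \<and> (\<forall>v. (\<Sum>w \<in> nb v. u w) \<le> 2 * u v) \<and> u x > (0::real)" for x
  proof (cases "\<exists>b. bad b \<and> (b, x) \<in> ?R")
    case True
    then obtain b where b: "bad b" "(b, x) \<in> ?R" by blast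
    obtain u where u: "\<And>v. u v \<ge> 0" "\<And>v. (\<Sum>w \<in> nb v. u w) \<le> 2 * u v"
      "u b > 0" "\<And>v w. w \<in> nb v \<Longrightarrow> u v > 0 \<Longrightarrow> u w > (0::real)"
      using bad_superharmonic[OF b(1)] by blast
    have "u x > 0" using b(2) by (induction rule: rtrancl_induct) (use u in auto)
    then show ?thesis using u by blast
  next
    case False
    have "sym ?R" by (intro sym_rtrancl) (auto simp: sym_def nb_sym)
    then have nobad: "\<not> bad v" if "(x, v) \<in> ?R" for v using False that by (meson symD)
    have closed: "(x, w) \<in> ?R" if "(x, v) \<in> ?R" "w \<in> nb v" for v w
      using that by (meson CollectI case_prodI rtrancl.rtrancl_into_rtrancl)
    obtain u where "\<And>v. u v \<ge> 0" "\<And>v. (\<Sum>w \<in> nb v. u w) \<le> 2 * u v"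
      "\<And>v. v \<in> {v. (x, v) \<in> ?R} \<Longrightarrow> u v > (0::real)"
      by (rule superharmonic_no_bad[of "{v. (x, v) \<in> ?R}"]) (use closed nobad in blast)+
    then show ?thesis by blast
  qed
  then obtain U where U: "\<And>x v. U x v \<ge> 0" "\<And>x v. (\<Sum>w \<in> nb v. U x w) \<le> 2 * U x v"
    "\<And>x. U x x > (0::real)" by metis
  show ?thesis
  proof
    fix v assume "v \<in> V"
    then show "(\<Sum>x \<in> V. U x v) > 0" using U fin by (meson sum_pos2)
  next
    fix v
    show "(\<Sum>w \<in> nb v. \<Sum>x \<in> V. U x w) \<le> 2 * (\<Sum>x \<in> V. U x v)"
      by (subst sum.swap) (simp add: sum_distrib_left U sum_mono)
  qed
qed

end

section \<open>Lehmer's number\<close>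

text \<open>Lehmer's polynomial is \<open>x\<^sup>5\<close> times \<open>lehmer_trace (x + 1/x)\<close>.\<close>

definition lehmer_trace :: "real \<Rightarrow> real" where
  "lehmer_trace y = y^5 + y^4 - 5*y^3 - 5*y^2 + 4*y + 3"

text \<open>The ratios are quotients of consecutive Chebyshev polynomials of the second kind in
  \<open>a / 2\<close>; clearing denominators leaves a polynomial equation for
  \<open>a\<close>.\<close>

lemma arm_ratio_lehmer:
  assumes a: "20065 / 10000 < a" "a < (20066 / 10000 :: real)" and root: "lehmer_trace (a\<^sup>2 - 2) = 0"
  shows "arm_ratio a 1 + arm_ratio a 2 + arm_ratio a 6 = a"
proof -
  define U where "U = rec_nat (0::real, 1::real) (\<lambda>_ (p, q). (q, a * q - p))"
  have U: "U 0 = (0, 1)" "U (Suc k) = (snd (U k), a * snd (U k) - fst (U k))" for k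
    by (simp_all add: U_def split: prod.split)
  have inc: "0 \<le> fst (U k) \<and> fst (U k) < snd (U k)" for k
  proof (induction k)
    case (Suc k)
    have "2 * snd (U k) \<le> a * snd (U k)" using a Suc by (intro mult_right_mono) auto
    then have "snd (U k) < a * snd (U k) - fst (U k)" using Suc by linarith
    then show ?case using Suc U by (simp del: mult_le_cancel_right mult_le_cancel_right1)
  qed (simp add: U)
  have r: "arm_ratio a k = fst (U k) / snd (U k)" for k
  proof (induction k)
    case (Suc k)
    have "snd (U k) \<noteq> 0" using inc[of k] by linarith
    then have "a - fst (U k) / snd (U k) = (a * snd (U k) - fst (U k)) / snd (U k)"
      by (simp add: diff_divide_distrib)
    then show ?case using Suc U by simp
  qed (simp add: U)
  have s: "U 1 = (1, a)" "U 2 = (a, a\<^sup>2 - 1)"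
    "U 6 = (a^5 - 4*a^3 + 3*a, a^6 - 5*a^4 + 6*a^2 - 1)"
    by (simp_all add: U eval_nat_numeral algebra_simps)
  have nz: "a \<noteq> 0" "a\<^sup>2 - 1 \<noteq> 0" "a^6 - 5*a^4 + 6*a^2 - 1 \<noteq> 0"
    using inc[of 1] inc[of 2] inc[of 6] unfolding s by simp_all
  \<comment> \<open>Up to sign the left side is the characteristic polynomial of the tree
    \<open>E_10\<close> in the variable \<open>a\<close>, expanded at the branch vertex.\<close>
  have zero: "(a\<^sup>2 - 1) * (a^6 - 5*a^4 + 6*a^2 - 1) + a * a * (a^6 - 5*a^4 + 6*a^2 - 1)
       + (a^5 - 4*a^3 + 3*a) * a * (a\<^sup>2 - 1) - a * a * (a\<^sup>2 - 1) * (a^6 - 5*a^4 + 6*a^2 - 1)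
       = - lehmer_trace (a\<^sup>2 - 2)"
    unfolding lehmer_trace_def by (simp add: eval_nat_numeral algebra_simps)
  have "1 / x + x / y + z / w = x"
    if nz: "x \<noteq> 0" "y \<noteq> 0" "w \<noteq> 0" and 0: "y * w + x * x * w + z * x * y - x * x * y * w = 0" for x y z w :: real
  proof -
    have "1 / x = y * w / (x * y * w)" "x / y = x * x * w / (x * y * w)" "z / w = z * x * y / (x * y * w)"
      "x = x * x * y * w / (x * y * w)" using nz by simp_all
    then have "1 / x + x / y + z / w - x = (y * w + x * x * w + z * x * y - x * x * y * w) / (x * y * w)"
      by (simp only: add_divide_distrib diff_divide_distrib)
    then show ?thesis unfolding 0 by simp
  qed
  from this[OF nz trans[OF zero]] show ?thesis unfolding r s fst_conv snd_conv using root by simp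
qed

lemma poly_5_factor:
  fixes a b c d e :: complex and p :: "complex poly"
  assumes "distinct [a, b, c, d, e]" "p = [:p0, p1, p2, p3, p4, 1:]"
    "\<And>x. x \<in> {a, b, c, d, e} \<Longrightarrow> poly p x = 0"
  shows "p = [:-a, 1:] * [:-b, 1:] * [:-c, 1:] * [:-d, 1:] * [:-e, 1:]"
proof (rule ccontr)
  let ?q = "[:-a, 1:] * [:-b, 1:] * [:-c, 1:] * [:-d, 1:] * [:-e, 1:]"
  assume "p \<noteq> ?q"
  then have ne: "p - ?q \<noteq> 0" by simp
  have deg: "degree [:x0, x1, x2, x3, x4 :: complex:] < 5" for x0 x1 x2 x3 x4
    by (simp add: degree_pCons_eq_if)
  have "\<exists>x0 x1 x2 x3 x4. p - ?q = [:x0, x1, x2, x3, x4:]"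
    unfolding assms(2) by simp
  then have "degree (p - ?q) < 5" using deg by metis
  moreover have "{a, b, c, d, e} \<subseteq> {x. poly (p - ?q) x = 0}"
    using assms(3) by (auto simp del: mult_pCons_left mult_pCons_right)
  then have "card {a, b, c, d, e} \<le> degree (p - ?q)"
    using card_poly_roots_bound[OF ne] poly_roots_finite[OF ne] by (meson card_mono le_trans)
  ultimately show False using assms(1) by simp
qed

section \<open>The Mahler measure of Lehmer's polynomial\<close>

lemma mahler_measure_reciprocal_quadratic:
  assumes "w \<noteq> 0" shows "mahler_measure_poly [:1, - (w + 1 / w), 1:] = max 1 (cmod w) * max 1 (1 / cmod w)"
proof -
  have "[:1, - (w + 1 / w), 1:] = [:- w, 1:] * [:- (1 / w), 1:]" using assms by simp
  moreover have "mahler_measure_poly [:- a, 1:] = max 1 (cmod a)" for a by simp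
  ultimately show ?thesis by (simp only: measure_eq_prod norm_divide norm_one)
qed

lemma mahler_measure_trace_small:
  assumes "\<bar>y\<bar> \<le> 2" shows "mahler_measure_poly [:1, - complex_of_real y, 1:] = 1"
proof -
  define w where "w = Complex (y / 2) (sqrt (1 - (y / 2)\<^sup>2))"
  have "(y / 2)\<^sup>2 \<le> 1" using assms by (simp add: abs_square_le_1)
  then have w: "cmod w = 1" unfolding w_def by (simp add: cmod_def)
  then have "1 / w = cnj w" by (metis complex_div_cnj mult_1 norm_one one_power2 div_by_1 of_real_1)
  then have "w + 1 / w = of_real y" by (simp add: complex_eq_iff w_def)
  moreover have "w \<noteq> 0" using w by auto
  ultimately show ?thesis using mahler_measure_reciprocal_quadratic[of w] w
    by (simp only: max.idem div_by_1 mult_1 not_False_eq_True simp_thms)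
qed

lemma mahler_measure_trace_large:
  assumes "l > 1" shows "mahler_measure_poly [:1, - complex_of_real (l + 1 / l), 1:] = l"
  using mahler_measure_reciprocal_quadratic[of "of_real l"] assms by simp

text \<open>Each zero \<open>y\<close> of the trace polynomial stands for a reciprocal pair of roots
  with sum \<open>y\<close>. For nonzero \<open>x\<close> both sides are \<open>x^5\<close> times
  the trace polynomial at \<open>x + 1/x\<close>.\<close>

lemma lehmer_poly_factor:
  assumes "distinct ys" "length ys = 5" "\<And>y. y \<in> set ys \<Longrightarrow> lehmer_trace y = 0"
  shows "map_poly complex_of_int lehmer_poly = (\<Prod>y \<leftarrow> ys. [:1, - complex_of_real y, 1:])"
proof -
  obtain a b c d e where ys: "ys = [a, b, c, d, e]"
    using assms(2) by (auto simp: length_Suc_conv eval_nat_numeral)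
  define p :: "complex poly" where "p = [:3, 4, -5, -5, 1, 1:]"
  have root: "poly p (of_real y) = 0" if "y \<in> set ys" for y
  proof -
    have "poly p (of_real y) = of_real (lehmer_trace y)"
      unfolding p_def lehmer_trace_def by (simp add: algebra_simps eval_nat_numeral)
    then show ?thesis using assms(3)[OF that] by simp
  qed
  have fac: "p = [:-of_real a, 1:] * [:-of_real b, 1:] * [:-of_real c, 1:] * [:-of_real d, 1:] * [:-of_real e, 1:]"
    by (rule poly_5_factor[OF _ p_def]) (use root assms(1) ys in auto)
  then have p: "poly p w = (w - of_real a) * (w - of_real b) * (w - of_real c) * (w - of_real d) * (w - of_real e)" for w
    by (subst fac) (simp del: mult_pCons_left mult_pCons_right)
  have "poly (map_poly complex_of_int lehmer_poly) x = poly (\<Prod>y \<leftarrow> ys. [:1, - complex_of_real y, 1:]) x" for x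
  proof (cases "x = 0")
    case True then show ?thesis by (simp add: ys lehmer_poly_def)
  next
    case False
    define t where "t = x + 1 / x"
    have t: "x * t = x\<^sup>2 + 1" using False by (simp add: t_def power2_eq_square algebra_simps)
    have "poly [:1, - complex_of_real y, 1:] x = x * (t - of_real y)" for y
      using t by (simp add: algebra_simps power2_eq_square)
    then have "poly (\<Prod>y \<leftarrow> ys. [:1, - complex_of_real y, 1:]) x = x ^ 5 * poly p t"
      unfolding p ys by (simp add: eval_nat_numeral mult_ac del: mult_pCons_left mult_pCons_right poly_pCons)
    also have "\<dots> = (x * t)^5 + x * (x * t)^4 - 5 * x^2 * (x * t)^3 - 5 * x^3 * (x * t)^2 + 4 * x^4 * (x * t) + 3 * x^5"
      unfolding p_def by (simp add: eval_nat_numeral algebra_simps)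
    also have "\<dots> = poly (map_poly complex_of_int lehmer_poly) x"
      unfolding t lehmer_poly_def by (simp add: eval_nat_numeral algebra_simps)
    finally show ?thesis by simp
  qed
  then show ?thesis using poly_eq_poly_eq_iff by blast
qed

text \<open>Four zeros of the trace polynomial lie between -2 and 2 and give roots on the unit
  circle. The fifth is slightly above 2, and the larger root of its pair is the whole Mahler
  measure.\<close>

lemma lehmer_number:
  obtains l where "l > 1" "mahler_measure lehmer_poly = l" "lehmer_trace (l + 1 / l) = 0"
    "20264 / 10000 < l + 1 / l" "l + 1 / l < 202643 / 100000"
proof -
  have cont: "continuous_on A lehmer_trace" for A
    unfolding lehmer_trace_def by (intro continuous_intros)
  have up: "\<exists>y. a < y \<and> y < b \<and> lehmer_trace y = 0" if "lehmer_trace a * lehmer_trace b < 0" "a < b" for a b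
  proof -
    have "\<exists>y. a \<le> y \<and> y \<le> b \<and> lehmer_trace y = 0"
    proof (cases "lehmer_trace a < 0")
      case True
      then show ?thesis using that IVT'[of lehmer_trace a 0 b] cont by (auto simp: mult_less_0_iff)
    next
      case False
      then show ?thesis using that IVT2'[of lehmer_trace b 0 a] cont by (auto simp: mult_less_0_iff)
    qed
    then show ?thesis using that by (metis mult_zero_left mult_zero_right less_irrefl order_le_less)
  qed
  \<comment> \<open>Sign changes isolate the five zeros. The last interval is so narrow that
    \<open>y + 2\<close>, the later \<open>a^2\<close>, falls between the squares of 2.0065 and
    2.0066.\<close>
  have val: "lehmer_trace (-2) < 0" "lehmer_trace (-(16/10)) > 0" "lehmer_trace (-1) < 0" "lehmer_trace 0 > 0"
    "lehmer_trace 1 < 0" "lehmer_trace (20264/10000) < 0" "lehmer_trace (202643/100000) > 0"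
    by (simp_all add: lehmer_trace_def power_divide)
  obtain a where a: "-2 < a" "a < -(16/10)" "lehmer_trace a = 0"
    using up[of "-2" "-(16/10)"] val by (auto simp: mult_neg_pos)
  obtain b where b: "-(16/10) < b" "b < -1" "lehmer_trace b = 0"
    using up[of "-(16/10)" "-1"] val by (auto simp: mult_pos_neg)
  obtain c where c: "-1 < c" "c < 0" "lehmer_trace c = 0"
    using up[of "-1" 0] val by (auto simp: mult_neg_pos)
  obtain d where d: "0 < d" "d < 1" "lehmer_trace d = 0"
    using up[of 0 1] val by (auto simp: mult_pos_neg)
  obtain e where e: "20264/10000 < e" "e < 202643/100000" "lehmer_trace e = 0"
    using up[of "20264/10000" "202643/100000"] val by (auto simp: mult_neg_pos)
  define l where "l = (e + sqrt (e\<^sup>2 - 4)) / 2"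
  have e4: "e\<^sup>2 - 4 > 0" using e power_strict_mono[of 2 e 2] by simp
  have "e > 2" "sqrt (e\<^sup>2 - 4) > 0" using e e4 by simp_all
  then have "2 < e + sqrt (e\<^sup>2 - 4)" by linarith
  then have l1: "l > 1" unfolding l_def by simp
  have "l * l - e * l + 1 = 0" unfolding l_def using e4 by (simp add: field_simps power2_eq_square)
  then have le: "l + 1 / l = e" using l1 by (simp add: field_simps)
  have "map_poly complex_of_int lehmer_poly = (\<Prod>y \<leftarrow> [a, b, c, d, e]. [:1, - complex_of_real y, 1:])"
    by (rule lehmer_poly_factor) (use a b c d e in auto)
  then have "mahler_measure lehmer_poly = l"
    using mahler_measure_trace_small[of a] mahler_measure_trace_small[of b] mahler_measure_trace_small[of c]
      mahler_measure_trace_small[of d] mahler_measure_trace_large[OF l1] a b c d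
    unfolding mahler_measure_def le by (simp add: measure_eq_prod del: mult_pCons_left mult_pCons_right)
  then show ?thesis using that l1 le e by blast
qed

section \<open>Eigenvalues of Coxeter matrices\<close>

definition form_mul :: "nat \<Rightarrow> (nat \<Rightarrow> nat \<Rightarrow> real) \<Rightarrow> (nat \<Rightarrow> real) \<Rightarrow> nat \<Rightarrow> real" where
  "form_mul n R x i = (\<Sum>j<n. R i j * x j)"

text \<open>Consider the row where \<open>y i / x i\<close> attains its minimum \<open>m\<close>. If
  \<open>m\<close> is negative, the signs off the diagonal give \<open>R y <= m * R x < 0\<close> in
  this row, against the assumption on \<open>y\<close>.\<close>

lemma Z_matrix_monotone:
  assumes off: "\<And>i j. i < n \<Longrightarrow> j < n \<Longrightarrow> i \<noteq> j \<Longrightarrow> R i j \<le> 0"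
    and x: "\<And>i. i < n \<Longrightarrow> x i > 0" "\<And>i. i < n \<Longrightarrow> form_mul n R x i > 0"
    and y: "\<And>i. i < n \<Longrightarrow> form_mul n R y i \<ge> 0"
    and k: "k < n"
  shows "y k \<ge> 0"
proof (rule ccontr)
  assume neg: "\<not> y k \<ge> 0"
  define m where "m = Min ((\<lambda>i. y i / x i) ` {..<n})"
  have "m \<in> (\<lambda>i. y i / x i) ` {..<n}" unfolding m_def using k by (intro Min_in) auto
  then obtain i where i: "i < n" "m = y i / x i" by auto
  have le: "m \<le> y j / x j" if "j < n" for j unfolding m_def using that by auto
  have "y k / x k < 0" using neg x(1)[OF k] by (simp add: divide_neg_pos)
  then have m0: "m < 0" using le[OF k] by linarith
  have "R i j * y j \<le> m * (R i j * x j)" if j: "j < n" for j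
  proof (cases "j = i")
    case True then show ?thesis using i x(1)[OF i(1)] by simp
  next
    case False
    have "m * x j \<le> y j" using le[OF j] x(1)[OF j] by (simp add: pos_le_divide_eq)
    then have "R i j * y j \<le> R i j * (m * x j)" using off[of i j] i j False by (intro mult_left_mono_neg) auto
    then show ?thesis by (simp add: mult_ac)
  qed
  then have "form_mul n R y i \<le> m * form_mul n R x i"
    unfolding form_mul_def sum_distrib_left by (intro sum_mono) auto
  moreover have "m * form_mul n R x i < 0" using m0 x(2)[OF i(1)] by (simp add: mult_neg_pos)
  ultimately show False using y[OF i(1)] by linarith
qed

lemma isCont_det:
  fixes F :: "real \<Rightarrow> nat \<Rightarrow> nat \<Rightarrow> real"
  assumes "\<And>i j. isCont (\<lambda>l. F l i j) a"
  shows "isCont (\<lambda>l. det (mat n n (\<lambda>(i, j). F l i j))) a"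
proof -
  have "det (mat n n (\<lambda>(i, j). F l i j)) = (\<Sum>p \<in> {p. p permutes {0..<n}}. signof p * (\<Prod>i = 0..<n. F l i (p i)))" for l
    by (subst det_def'[of _ n]) (auto intro!: sum.cong prod.cong dest: permutes_in_image)
  then show ?thesis using assms by (simp only:) (intro continuous_intros, auto)
qed

locale acyclic_orientation =
  fixes n :: nat and U :: "nat \<Rightarrow> nat \<Rightarrow> real"
  assumes U01: "U i j \<in> {0, 1}" and U_upper: "U i j = 1 \<Longrightarrow> i < j"
begin

text \<open>\<open>R l = l M + M\<^sup>t\<close> for the matrix \<open>M\<close> below; \<open>-l\<close> is an eigenvalue of \<open>M\<^sup>-\<^sup>1 M\<^sup>t\<close> exactly if it is singular.\<close>

definition R :: "real \<Rightarrow> nat \<Rightarrow> nat \<Rightarrow> real" where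
  "R l i j = (if i = j then l + 1 else - (l * U i j + U j i))"

definition D :: "real \<Rightarrow> real" where "D l = det (mat n n (\<lambda>(i, j). R l i j))"

text \<open>The inverse of \<open>R l\<close> by Cramer's rule where \<open>D l\<close> is nonzero;
  as quotients of determinants its entries are continuous in \<open>l\<close> there.\<close>

definition X :: "real \<Rightarrow> nat \<Rightarrow> nat \<Rightarrow> real" where
  "X l i j = adj_mat (mat n n (\<lambda>(i, j). R l i j)) $$ (i, j) / D l"

text \<open>For \<open>l > 0\<close> this says that \<open>R l\<close> is a nonsingular M-matrix, in
  a form that is visibly an open condition on \<open>l\<close>.\<close>

definition good :: "real \<Rightarrow> bool" where
  "good l \<longleftrightarrow> (\<exists>x. (\<forall>i<n. x i > 0) \<and> (\<forall>i<n. form_mul n (R l) x i > 0))"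

lemma U_bounds: "0 \<le> U i j" "U i j \<le> 1"
  using U01[of i j] by auto

lemma U_zero: "\<not> i < j \<Longrightarrow> U i j = 0"
  using U01[of i j] U_upper[of i j] by auto

lemma R_off: "l > 0 \<Longrightarrow> i \<noteq> j \<Longrightarrow> R l i j \<le> 0"
proof -
  assume "l > 0" "i \<noteq> j"
  moreover have "l * U i j \<ge> 0" using \<open>l > 0\<close> U_bounds by (intro mult_nonneg_nonneg) auto
  ultimately show ?thesis using U_bounds[of j i] by (simp add: R_def)
qed

lemma cont_R: "isCont (\<lambda>l. R l i j) a"
  unfolding R_def by (cases "i = j") (auto intro!: continuous_intros)

lemma inverse:
  assumes "D l \<noteq> 0" "i < n" "j < n"
  shows "(\<Sum>k<n. R l i k * X l k j) = (if i = j then 1 else 0)"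
    and "(\<Sum>k<n. X l i k * R l k j) = (if i = j then 1 else 0)"
proof -
  let ?A = "mat n n (\<lambda>(i, j). R l i j)"
  have A: "?A \<in> carrier_mat n n" by simp
  note adj = adj_mat[OF A]
  have "(?A * adj_mat ?A) $$ (i, j) = (\<Sum>k<n. R l i k * adj_mat ?A $$ (k, j))"
    using assms adj(1) by (auto simp: scalar_prod_def lessThan_atLeast0 intro!: sum.cong)
  moreover have "(adj_mat ?A * ?A) $$ (i, j) = (\<Sum>k<n. adj_mat ?A $$ (i, k) * R l k j)"
    using assms adj(1) by (auto simp: scalar_prod_def lessThan_atLeast0 intro!: sum.cong)
  ultimately have "(\<Sum>k<n. R l i k * adj_mat ?A $$ (k, j)) = D l * (if i = j then 1 else 0)"
    "(\<Sum>k<n. adj_mat ?A $$ (i, k) * R l k j) = D l * (if i = j then 1 else 0)"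
    using assms unfolding adj(2,3) D_def by auto
  then show "(\<Sum>k<n. R l i k * X l k j) = (if i = j then 1 else 0)"
    "(\<Sum>k<n. X l i k * R l k j) = (if i = j then 1 else 0)"
    unfolding X_def using assms(1) by (auto simp: sum_divide_distrib[symmetric])
qed

lemma cont_D: "isCont D a"
  unfolding D_def[abs_def] by (intro isCont_det cont_R)

lemma cont_X:
  assumes "D a \<noteq> 0" "i < n" "j < n"
  shows "isCont (\<lambda>l. X l i j) a"
proof -
  have "adj_mat (mat n n (\<lambda>(i, j). R l i j)) $$ (i, j) = 
     (-1) ^ (j + i) * det (mat (n - 1) (n - 1) (\<lambda>(i', j'). R l (if i' < j then i' else Suc i') (if j' < i then j' else Suc j')))" for l
    using assms unfolding adj_mat_def cofactor_def mat_delete_def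
    by (auto intro!: arg_cong[where f = det] eq_matI)
  then show ?thesis unfolding X_def using assms(1)
    by (simp only:) (intro continuous_intros isCont_det cont_R cont_D, auto)
qed

text \<open>For large \<open>l\<close> the triangular part with the factor \<open>l\<close>
  dominates. On the vector \<open>c^i\<close> the entries right of the diagonal are damped by a
  factor \<open>c\<close>, those left of it contribute at most 1 each, and \<open>L\<close> makes
  half of \<open>l * c^i\<close> exceed \<open>n\<close>.\<close>

lemma good_large: "\<exists>L. \<forall>l\<ge>L. good l"
proof -
  define c :: real where "c = 1 / (2 * real n + 2)"
  have c: "0 < c" "c \<le> 1" unfolding c_def by auto
  define L where "L = (2 * real n + 2) / c ^ n"
  have "good l" if "l \<ge> L" for l
  proof -
    have cn: "c ^ n > 0" using c by simp
    have "L > 0" unfolding L_def using cn by (intro divide_pos_pos) auto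
    then have l: "l > 0" using that by simp
    have lc: "l * c ^ n \<ge> 2 * real n + 2" using that cn unfolding L_def by (simp add: pos_divide_le_eq)
    have "form_mul n (R l) (\<lambda>i. c ^ i) i > 0" if i: "i < n" for i
    proof -
      have "R l i j * c ^ j \<ge> (if j = i then (l + 1) * c ^ i else 0) - (l * c ^ Suc i + 1)" if "j < n" for j
      proof -
        have lci: "l * c ^ Suc i \<ge> 0" using l c by simp
        consider "j = i" | "i < j" | "j < i" by linarith
        then show ?thesis
        proof cases
          case 1 then show ?thesis using lci by (simp add: R_def)
        next
          case 2
          have "c ^ j \<le> c ^ Suc i" using c 2 by (intro power_decreasing) auto
          then have "(l * U i j) * c ^ j \<le> l * c ^ Suc i" using U_bounds[of i j] l c
            by (intro mult_mono) (auto simp: mult_left_le)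
          then show ?thesis using 2 U_zero[of j i] by (simp add: R_def)
        next
          case 3
          have "c ^ j \<le> 1" using c by (simp add: power_le_one)
          then have "U j i * c ^ j \<le> 1" using U_bounds[of j i] c by (simp add: mult_le_one)
          then show ?thesis using 3 lci U_zero[of i j] by (simp add: R_def)
        qed
      qed
      then have "form_mul n (R l) (\<lambda>i. c ^ i) i \<ge> (\<Sum>j<n. (if j = i then (l + 1) * c ^ i else 0) - (l * c ^ Suc i + 1))"
        unfolding form_mul_def by (intro sum_mono) auto
      moreover have "(\<Sum>j<n. (if j = i then (l + 1) * c ^ i else 0) - (l * c ^ Suc i + 1))
         = (l + 1) * c ^ i - real n * (l * c ^ Suc i + 1)"
        using i by (simp add: sum_subtractf sum.delta)
      moreover have "real n * c \<le> 1 / 2" unfolding c_def by (simp add: field_simps)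
      then have "l * c ^ i * (real n * c) \<le> l * c ^ i * (1 / 2)" using l c by (intro mult_left_mono) auto
      moreover have "l * c ^ i \<ge> l * c ^ n" using i c l by (intro mult_left_mono power_decreasing) auto
      moreover have "c ^ i > 0" using c by simp
      moreover have "real n * (l * c ^ Suc i + 1) = l * c ^ i * (real n * c) + real n" by (simp add: algebra_simps)
      moreover have "(l + 1) * c ^ i = l * c ^ i + c ^ i" by (simp add: algebra_simps)
      ultimately show ?thesis using lc by linarith
    qed
    then show ?thesis unfolding good_def using c by (intro exI[of _ "\<lambda>i. c ^ i"]) auto
  qed
  then show ?thesis by blast
qed

lemma good_open: assumes "good a" shows "\<forall>\<^sub>F l in nhds a. good l"
proof -
  obtain x where x: "\<forall>i<n. x i > 0" "\<forall>i<n. form_mul n (R a) x i > 0" using assms unfolding good_def by blast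
  have "\<forall>\<^sub>F l in nhds a. form_mul n (R l) x i > 0" if "i < n" for i
  proof (rule order_tendstoD(1))
    have "isCont (\<lambda>l. form_mul n (R l) x i) a" unfolding form_mul_def
      by (intro continuous_intros cont_R)
    then show "((\<lambda>l. form_mul n (R l) x i) \<longlongrightarrow> form_mul n (R a) x i) (nhds a)"
      unfolding isCont_def by (rule tendsto_at_iff_tendsto_nhds[THEN iffD1])
  qed (use x that in auto)
  then have "\<forall>\<^sub>F l in nhds a. \<forall>i\<in>{..<n}. form_mul n (R l) x i > 0"
    by (intro eventually_ball_finite) auto
  then show ?thesis by (rule eventually_mono) (use x in \<open>auto simp: good_def\<close>)
qed

lemma inverse_nonneg:
  assumes "D l \<noteq> 0" "l > 0" "good l" "i < n" "j < n"
  shows "X l i j \<ge> 0"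
proof -
  obtain x where x: "\<forall>i<n. x i > 0" "\<forall>i<n. form_mul n (R l) x i > 0" using assms unfolding good_def by blast
  show ?thesis
    by (rule Z_matrix_monotone[of n "R l" x "\<lambda>i. X l i j"])
      (use x assms R_off inverse(1) in \<open>auto simp: form_mul_def\<close>)
qed

text \<open>Row sums of the inverse solve the system with right side 1, column sums the transposed
  system. The terms off the diagonal are never positive, so the diagonal term, and with it the
  solution, must be.\<close>

lemma good_inverse:
  assumes "D l \<noteq> 0" "l > 0" "\<And>i j. i < n \<Longrightarrow> j < n \<Longrightarrow> X l i j \<ge> 0"
  defines "x \<equiv> (\<lambda>i. \<Sum>j<n. X l i j)" and "y \<equiv> (\<lambda>j. \<Sum>i<n. X l i j)"
  assumes i: "i < n"
  shows "x i > 0" "form_mul n (R l) x i = 1" "y i > 0" "form_mul n (\<lambda>i j. R l j i) y i = 1"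
proof -
  have pos: "z i > 0" if "form_mul n Q z i = 1" "\<And>k. k < n \<Longrightarrow> z k \<ge> 0" "\<And>k. k \<noteq> i \<Longrightarrow> Q i k \<le> 0" "Q i i > 0" for Q z
  proof -
    have "form_mul n Q z i = Q i i * z i + (\<Sum>k\<in>{..<n} - {i}. Q i k * z k)"
      unfolding form_mul_def using i by (simp add: sum.remove)
    moreover have "(\<Sum>k\<in>{..<n} - {i}. Q i k * z k) \<le> 0"
      using that by (intro sum_nonpos mult_nonpos_nonneg) auto
    ultimately have "Q i i * z i > 0" using that by linarith
    then show ?thesis using that by (simp add: zero_less_mult_iff)
  qed
  show x1: "form_mul n (R l) x i = 1"
  proof -
    have "form_mul n (R l) x i = (\<Sum>j<n. \<Sum>k<n. R l i k * X l k j)"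
      unfolding form_mul_def x_def sum_distrib_left by (rule sum.swap)
    also have "\<dots> = (\<Sum>j<n. if i = j then 1 else 0)" using inverse(1) assms(1) i by (intro sum.cong) auto
    finally show ?thesis using i by simp
  qed
  show y1: "form_mul n (\<lambda>i j. R l j i) y i = 1"
  proof -
    have "form_mul n (\<lambda>i j. R l j i) y i = (\<Sum>j<n. \<Sum>k<n. X l j k * R l k i)"
      unfolding form_mul_def y_def sum_distrib_left by (subst sum.swap) (simp add: mult.commute)
    also have "\<dots> = (\<Sum>j<n. if j = i then 1 else 0)" using inverse(2) assms(1) i by (intro sum.cong) auto
    finally show ?thesis using i by simp
  qed
  have diag: "R l i i > 0" using assms(2) by (simp add: R_def)
  show "x i > 0" by (rule pos[OF x1]) (use assms diag R_off in \<open>auto simp: x_def intro!: sum_nonneg\<close>)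
  show "y i > 0" by (rule pos[OF y1]) (use assms diag R_off in \<open>auto simp: y_def intro!: sum_nonneg\<close>)
qed

text \<open>Let \<open>s\<close> be the supremum of the values from \<open>l0\<close> on that are
  not good. Goodness is open, so \<open>s\<close> is not good either. But the inverses for larger
  \<open>l\<close> are nonnegative and converge to the inverse at \<open>s\<close>, whose row sums
  show that \<open>s\<close> is good.\<close>

lemma good_down:
  assumes l0: "l0 > 0" and D: "\<And>l. l \<ge> l0 \<Longrightarrow> D l \<noteq> 0"
  shows "good l0"
proof (rule ccontr)
  assume "\<not> good l0"
  define S where "S = {l. l \<ge> l0 \<and> \<not> good l}"
  obtain L where L: "\<And>l. l \<ge> L \<Longrightarrow> good l" using good_large by blast
  have ne: "l0 \<in> S" using \<open>\<not> good l0\<close> by (simp add: S_def)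
  have bdd: "bdd_above S"
  proof (rule bdd_aboveI)
    fix l assume "l \<in> S"
    then show "l \<le> L" using L[of l] unfolding S_def by fastforce
  qed
  define s where "s = Sup S"
  have s: "s \<ge> l0" unfolding s_def using ne bdd by (rule cSup_upper)
  have above: "good l" if "l > s" for l
  proof (rule ccontr)
    assume "\<not> good l"
    then have "l \<in> S" using that s by (simp add: S_def)
    then show False using cSup_upper[OF _ bdd] that unfolding s_def by fastforce
  qed
  have ns: "\<not> good s"
  proof
    assume "good s"
    then obtain d where d: "d > 0" "\<And>l. dist l s < d \<Longrightarrow> good l"
      using good_open unfolding eventually_nhds_metric by blast
    obtain l where "l \<in> S" "s - d < l" using less_cSupE[of "s - d" S] d ne unfolding s_def by auto
    moreover have "l \<le> s" unfolding s_def using \<open>l \<in> S\<close> bdd by (rule cSup_upper)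
    ultimately show False using d(2)[of l] by (auto simp: S_def dist_real_def)
  qed
  have "X s i j \<ge> 0" if "i < n" "j < n" for i j
  proof (rule tendsto_lowerbound)
    show "((\<lambda>l. X l i j) \<longlongrightarrow> X s i j) (at_right s)"
      using cont_X[OF D[OF s] that] by (simp add: isCont_def filterlim_at_split)
    show "\<forall>\<^sub>F l in at_right s. 0 \<le> X l i j"
      unfolding eventually_at_right_field
      by (rule exI[of _ "s + 1"]) (use inverse_nonneg above that s l0 D in auto)
  qed simp
  then have "good s" unfolding good_def
    using good_inverse(1,2)[OF D[OF s]] s l0 by (intro exI[of _ "\<lambda>i. \<Sum>j<n. X s i j"]) auto
  then show False using ns by blast
qed

lemma symmetric_supersolution:
  assumes l0: "l > 0" and D: "\<And>l'. l' \<ge> l \<Longrightarrow> D l' \<noteq> 0"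
  obtains z where "\<And>i. i < n \<Longrightarrow> z i > 0"
    "\<And>i. i < n \<Longrightarrow> (\<Sum>j<n. (U i j + U j i) * z j) < (l + 1) / sqrt l * z i"
proof -
  have nn: "X l i j \<ge> 0" if "i < n" "j < n" for i j
    using inverse_nonneg[OF D l0 good_down[OF l0 D]] that by auto
  define x where "x = (\<lambda>i. \<Sum>j<n. X l i j)"
  define y where "y = (\<lambda>j. \<Sum>i<n. X l i j)"
  have gi: "x i > 0" "form_mul n (R l) x i = 1" "y i > 0" "form_mul n (\<lambda>i j. R l j i) y i = 1" if "i < n" for i
    using good_inverse[OF D[OF order_refl] l0 nn that] unfolding x_def y_def by auto
  \<comment> \<open>On an edge the coefficients \<open>l\<close> and \<open>1\<close> of the inequalities for \<open>x\<close> and \<open>y\<close> have geometric mean \<open>sqrt l\<close>.\<close>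
  define z where "z i = sqrt (x i * y i)" for i
  have split: "form_mul n Q v i = Q i i * v i + (\<Sum>j<n. (if j = i then 0 else Q i j) * v j)" if "i < n" for Q v i
    unfolding form_mul_def using that
    by (subst (1 2) sum.remove[of _ i]) (auto intro!: sum.cong)
  have diag: "U i i = 0" for i using U_zero[of i i] by simp
  show thesis
  proof
    fix i assume i: "i < n"
    show "z i > 0" unfolding z_def using gi i by simp
    define p where "p j = (l * U i j + U j i) * x j" for j
    define q where "q j = (l * U j i + U i j) * y j" for j
    have "(\<Sum>j<n. (if j = i then 0 else R l i j) * x j) = - (\<Sum>j<n. p j)"
      unfolding p_def sum_negf[symmetric] by (intro sum.cong) (auto simp: R_def diag algebra_simps)
    then have P: "(\<Sum>j<n. p j) < (l + 1) * x i" using gi(2)[OF i] split[OF i, of "R l" x] by (simp add: R_def)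
    have "(\<Sum>j<n. (if j = i then 0 else R l j i) * y j) = - (\<Sum>j<n. q j)"
      unfolding q_def sum_negf[symmetric] by (intro sum.cong) (auto simp: R_def diag algebra_simps)
    then have Q: "(\<Sum>j<n. q j) < (l + 1) * y i" using gi(4)[OF i] split[OF i, of "\<lambda>i j. R l j i" y] by (simp add: R_def)
    have pq: "p j \<ge> 0" "q j \<ge> 0" if "j < n" for j
      unfolding p_def q_def using U_bounds l0 gi(1,3)[OF that] by (auto intro!: mult_nonneg_nonneg add_nonneg_nonneg simp: less_imp_le)
    have edge: "sqrt (p j) * sqrt (q j) = sqrt l * ((U i j + U j i) * z j)" if j: "j < n" for j
    proof -
      have "p j * q j = l * ((U i j + U j i)\<^sup>2 * (x j * y j))"
        using U01[of i j] U01[of j i] U_upper[of i j] U_upper[of j i] unfolding p_def q_def by auto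
      then have "sqrt (p j * q j) = sqrt l * (\<bar>U i j + U j i\<bar> * z j)"
        by (simp add: real_sqrt_mult z_def)
      then show ?thesis using U_bounds[of i j] U_bounds[of j i] by (simp add: real_sqrt_mult)
    qed
    \<comment> \<open>Cauchy-Schwarz multiplies the two row inequalities; the product of their right
      sides is the square of \<open>(l + 1) * z i\<close>.\<close>
    have "(\<Sum>j<n. sqrt (p j) * sqrt (q j))\<^sup>2 \<le> (\<Sum>j<n. (sqrt (p j))\<^sup>2) * (\<Sum>j<n. (sqrt (q j))\<^sup>2)"
      by (rule Cauchy_Schwarz_ineq_sum)
    also have "\<dots> = (\<Sum>j<n. p j) * (\<Sum>j<n. q j)" using pq by (intro arg_cong2[where f = "(*)"] sum.cong) auto
    also have "\<dots> < ((l + 1) * x i) * ((l + 1) * y i)"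
      using P Q pq by (intro mult_strict_mono) (auto intro!: sum_nonneg mult_pos_pos simp: gi(1)[OF i] l0 add_pos_pos)
    also have "\<dots> = ((l + 1) * z i)\<^sup>2" using gi(1,3)[OF i] unfolding z_def by (simp add: power_mult_distrib power2_eq_square less_imp_le)
    finally have "(\<Sum>j<n. sqrt (p j) * sqrt (q j)) < (l + 1) * z i"
      by (rule power_less_imp_less_base) (use l0 \<open>z i > 0\<close> in simp)
    moreover have "(\<Sum>j<n. sqrt (p j) * sqrt (q j)) = sqrt l * (\<Sum>j<n. (U i j + U j i) * z j)"
      using edge by (simp add: sum_distrib_left)
    ultimately show "(\<Sum>j<n. (U i j + U j i) * z j) < (l + 1) / sqrt l * z i"
      using l0 by (simp add: pos_less_divide_eq mult.commute)
  qed
qed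

end

section \<open>The quadratic form of the Seifert matrix\<close>

context acyclic_orientation
begin

definition M :: "nat \<Rightarrow> nat \<Rightarrow> real" where
  "M i j = (if i = j then 1 else - U i j)"

text \<open>Half the value of the symmetric form \<open>M + M^t\<close> at \<open>x\<close>.\<close>

definition Q :: "(nat \<Rightarrow> real) \<Rightarrow> real" where
  "Q x = (\<Sum>i<n. \<Sum>j<n. M i j * (x i * x j))"

lemma R_M: "R l i j = l * M i j + M j i"
  by (simp add: R_def M_def)

lemma superharmonic_if_no_root:
  assumes l: "l > 1" "lehmer_trace (l + 1 / l) = 0" "20264 / 10000 < l + 1 / l" "l + 1 / l < 202643 / 100000"
    and D: "\<And>l'. l' \<ge> l \<Longrightarrow> D l' \<noteq> 0"
  obtains u where "\<And>i. i < n \<Longrightarrow> u i > 0" "\<And>i. i < n \<Longrightarrow> (\<Sum>j<n. (U i j + U j i) * u j) \<le> 2 * u i"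
proof -
  \<comment> \<open>\<open>a^2 - 2\<close> is \<open>l + 1 / l\<close>, the point at which the trace
    polynomial vanishes.\<close>
  define a where "a = (l + 1) / sqrt l"
  have "a > 0" unfolding a_def using l by simp
  have "(l + 1)\<^sup>2 = (l + 1 / l + 2) * l" using l by (simp add: algebra_simps power2_eq_square)
  moreover have "a\<^sup>2 = (l + 1)\<^sup>2 / l" unfolding a_def using l by (simp add: power_divide)
  ultimately have a2: "a\<^sup>2 = l + 1 / l + 2" using l by simp
  have "a > 20065 / 10000"
    by (rule power2_less_imp_less) (use a2 l \<open>a > 0\<close> in \<open>simp_all add: power_divide\<close>)
  moreover have "a < 20066 / 10000"
    by (rule power2_less_imp_less) (use a2 l in \<open>simp_all add: power_divide\<close>)
  ultimately have a: "20065 / 10000 < a" "a < 20066 / 10000" by blast+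
  obtain z where z: "\<And>i. i < n \<Longrightarrow> z i > 0"
    "\<And>i. i < n \<Longrightarrow> (\<Sum>j<n. (U i j + U j i) * z j) < a * z i"
    using symmetric_supersolution[of l] l D unfolding a_def by auto
  define nb where "nb v = {w. v < n \<and> w < n \<and> U v w + U w v = 1}" for v
  have nb_sum: "(\<Sum>w\<in>nb v. f w) = (\<Sum>j<n. (U v j + U j v) * f j)" if "v < n" for v and f :: "nat \<Rightarrow> real"
  proof -
    have "U v w + U w v = (if w \<in> nb v then 1 else 0)" if "w < n" for w
      using U01[of v w] U01[of w v] U_upper[of v w] U_upper[of w v] that \<open>v < n\<close> unfolding nb_def by auto
    then have "(\<Sum>j<n. (U v j + U j v) * f j) = (\<Sum>j<n. if j \<in> nb v then f j else 0)"
      by (intro sum.cong) auto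
    also have "\<dots> = (\<Sum>j\<in>nb v. f j)"
      by (subst sum.inter_filter[symmetric]) (auto intro!: sum.cong simp: nb_def)
    finally show ?thesis by simp
  qed
  \<comment> \<open>Outside the vertex set \<open>z\<close> is replaced by 1, since the locale asks
    for positive values everywhere.\<close>
  interpret small_supersolution "{..<n}" nb a "\<lambda>v. if v < n then z v else 1"
  proof
    show "arm_ratio a 1 + arm_ratio a 2 + arm_ratio a 6 = a"
      by (rule arm_ratio_lehmer[OF a]) (use a2 l in simp)
    fix v assume "v \<in> {..<n}"
    then show "(\<Sum>w\<in>nb v. if w < n then z w else 1) < a * (if v < n then z v else 1)"
      using z(2)[of v] nb_sum[of v "\<lambda>w. if w < n then z w else 1"] by simp
  next
    show "v \<notin> nb v" for v using U_zero[of v v] by (simp add: nb_def)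
  qed (use a z in \<open>auto simp: nb_def add.commute\<close>)
  obtain u where "\<And>v. v \<in> {..<n} \<Longrightarrow> u v > 0" "\<And>v. (\<Sum>w \<in> nb v. u w) \<le> 2 * (u v :: real)"
    using superharmonic by blast
  then show thesis using that nb_sum by (metis lessThan_iff)
qed

text \<open>With the weights \<open>u\<close> the inequality of the means reads
  \<open>2 x_i x_j <= (u_j / u_i) x_i^2 + (u_i / u_j) x_j^2\<close>. Summed over the edges, its
  right side is at most twice the sum of the \<open>x_i^2\<close> by superharmonicity.\<close>

lemma Q_nonneg:
  assumes u: "\<And>i. i < n \<Longrightarrow> u i > 0" "\<And>i. i < n \<Longrightarrow> (\<Sum>j<n. (U i j + U j i) * u j) \<le> 2 * u i"
  shows "Q x \<ge> 0"
proof -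
  let ?A = "\<lambda>i j. U i j + U j i"
  have Msum: "(\<Sum>i<n. \<Sum>j<n. M i j * (x i * x j)) = (\<Sum>i<n. (x i)\<^sup>2) - (\<Sum>i<n. \<Sum>j<n. U i j * (x i * x j))"
  proof -
    have "M i j * (x i * x j) = (if j = i then (x i)\<^sup>2 else 0) - U i j * (x i * x j)" for i j
      using U_zero[of i i] by (simp add: M_def power2_eq_square)
    then show ?thesis by (simp add: sum_subtractf)
  qed
  have "2 * (\<Sum>i<n. \<Sum>j<n. U i j * (x i * x j)) = (\<Sum>i<n. \<Sum>j<n. U i j * (x i * x j)) + (\<Sum>j<n. \<Sum>i<n. U i j * (x i * x j))"
    by (subst (3) sum.swap) simp
  also have "\<dots> = (\<Sum>i<n. \<Sum>j<n. ?A i j * (x i * x j))"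
    by (simp add: sum.distrib[symmetric] algebra_simps)
  also have "\<dots> \<le> (\<Sum>i<n. \<Sum>j<n. ?A i j * (u j / u i * (x i)\<^sup>2 + u i / u j * (x j)\<^sup>2) / 2)"
  proof (intro sum_mono)
    fix i j assume ij: "i \<in> {..<n}" "j \<in> {..<n}"
    then have p: "u i > 0" "u j > 0" using u by auto
    have "0 \<le> (u j * x i - u i * x j)\<^sup>2 / (u i * u j)" using p by simp
    also have "\<dots> = u j / u i * (x i)\<^sup>2 + u i / u j * (x j)\<^sup>2 - 2 * (x i * x j)"
    proof -
      have "(u j * x i)\<^sup>2 / (u i * u j) = u j / u i * (x i)\<^sup>2" "(u i * x j)\<^sup>2 / (u i * u j) = u i / u j * (x j)\<^sup>2"
        "2 * (u j * x i) * (u i * x j) / (u i * u j) = 2 * (x i * x j)"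
        using p by (simp_all add: power2_eq_square)
      then show ?thesis unfolding power2_diff add_divide_distrib diff_divide_distrib by linarith
    qed
    finally have "x i * x j \<le> (u j / u i * (x i)\<^sup>2 + u i / u j * (x j)\<^sup>2) / 2" by simp
    then have "?A i j * (x i * x j) \<le> ?A i j * ((u j / u i * (x i)\<^sup>2 + u i / u j * (x j)\<^sup>2) / 2)"
      using U_bounds by (intro mult_left_mono) auto
    then show "?A i j * (x i * x j) \<le> ?A i j * (u j / u i * (x i)\<^sup>2 + u i / u j * (x j)\<^sup>2) / 2" by simp
  qed
  also have "\<dots> = ((\<Sum>i<n. \<Sum>j<n. ?A i j * (u j / u i * (x i)\<^sup>2)) + (\<Sum>i<n. \<Sum>j<n. ?A i j * (u i / u j * (x j)\<^sup>2))) / 2"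
    by (simp add: sum_divide_distrib[symmetric] sum.distrib distrib_left)
  also have "(\<Sum>i<n. \<Sum>j<n. ?A i j * (u i / u j * (x j)\<^sup>2)) = (\<Sum>i<n. \<Sum>j<n. ?A i j * (u j / u i * (x i)\<^sup>2))"
    by (subst sum.swap) (simp add: add.commute)
  also have "(\<Sum>i<n. \<Sum>j<n. ?A i j * (u j / u i * (x i)\<^sup>2)) \<le> (\<Sum>i<n. 2 * (x i)\<^sup>2)"
  proof (rule sum_mono)
    fix i assume "i \<in> {..<n}"
    then have i: "u i > 0" "(\<Sum>j<n. ?A i j * u j) \<le> 2 * u i" using u by auto
    have "(\<Sum>j<n. ?A i j * (u j / u i * (x i)\<^sup>2)) = (\<Sum>j<n. ?A i j * u j) * ((x i)\<^sup>2 / u i)"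
      unfolding sum_distrib_right by (intro sum.cong) auto
    also have "\<dots> \<le> 2 * u i * ((x i)\<^sup>2 / u i)" using i by (intro mult_right_mono) auto
    finally show "(\<Sum>j<n. ?A i j * (u j / u i * (x i)\<^sup>2)) \<le> 2 * (x i)\<^sup>2" using i by simp
  qed
  finally show ?thesis unfolding Q_def Msum by (simp add: sum_distrib_left[symmetric])
qed

text \<open>An isotropic vector of a semidefinite form lies in the radical: otherwise a small step
  from \<open>x\<close> against the gradient \<open>g\<close> would make \<open>Q\<close>
  negative.\<close>

lemma Q_null:
  assumes pos: "\<And>x. Q x \<ge> 0" and "Q x = 0" "i < n"
  shows "(\<Sum>j<n. (M i j + M j i) * x j) = 0"
proof -
  define g where "g i = (\<Sum>j<n. (M i j + M j i) * x j)" for i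
  define S where "S = (\<Sum>i<n. (g i)\<^sup>2)"
  have expand: "Q (\<lambda>i. x i + t * g i) = Q x + t * S + t\<^sup>2 * Q g" for t
  proof -
    have "(\<Sum>i<n. \<Sum>j<n. M i j * (x j * g i)) + (\<Sum>i<n. \<Sum>j<n. M i j * (x i * g j))
        = (\<Sum>i<n. \<Sum>j<n. M i j * (x j * g i)) + (\<Sum>i<n. \<Sum>j<n. M j i * (x j * g i))"
      by (subst (4) sum.swap) simp
    also have "\<dots> = (\<Sum>i<n. g i * g i)"
    proof -
      have "g i * c = (\<Sum>j<n. M i j * (x j * c)) + (\<Sum>j<n. M j i * (x j * c))" for i c
        unfolding g_def sum_distrib_right sum.distrib[symmetric] by (intro sum.cong) (auto simp: algebra_simps)
      then show ?thesis by (simp add: sum.distrib[symmetric])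
    qed
    finally have S: "S = (\<Sum>i<n. \<Sum>j<n. M i j * (x j * g i)) + (\<Sum>i<n. \<Sum>j<n. M i j * (x i * g j))"
      by (simp add: S_def power2_eq_square)
    show ?thesis unfolding S Q_def
      by (simp add: sum_distrib_left sum.distrib[symmetric] algebra_simps power2_eq_square)
  qed
  have "S = 0"
  proof (rule ccontr)
    assume "S \<noteq> 0"
    moreover have "S \<ge> 0" unfolding S_def by (simp add: sum_nonneg)
    ultimately have S: "S > 0" by simp
    have Qg: "Q g \<ge> 0" using pos by simp
    \<comment> \<open>With this step the linear decrease \<open>t * S\<close> exceeds the quadratic
      term \<open>t^2 * Q g\<close>; the added 1 keeps the denominator positive.\<close>
    define t where "t = S / (2 * (Q g + 1))"
    have t: "t > 0" unfolding t_def using S Qg by simp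
    have "t * Q g < S"
    proof -
      have "t * Q g \<le> t * (Q g + 1)" using t by simp
      also have "\<dots> = S / 2" unfolding t_def using Qg by (simp add: field_simps)
      finally show ?thesis using S by simp
    qed
    then have "t * (t * Q g) < t * S" using t by simp
    moreover have "0 \<le> Q x + (- t) * S + (- t)\<^sup>2 * Q g" using pos expand[of "- t"] by metis
    ultimately show False using assms(2) by (simp add: power2_eq_square)
  qed
  then have "\<forall>i\<in>{..<n}. (g i)\<^sup>2 = 0" unfolding S_def by (subst (asm) sum_nonneg_eq_0_iff) auto
  then show ?thesis using assms(3) by (simp add: g_def)
qed

text \<open>Back substitution in a unitriangular system, from the last index downwards.\<close>

lemma M_injective:
  fixes v :: "nat \<Rightarrow> complex"
  assumes "\<And>i. i < n \<Longrightarrow> (\<Sum>j<n. of_real (M i j) * v j) = 0" "i < n"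
  shows "v i = 0"
  using assms(2)
proof (induction "n - i" arbitrary: i rule: less_induct)
  case less
  have "(\<Sum>j<n. of_real (M i j) * v j) = (\<Sum>j<n. if j = i then v i else 0)"
  proof (rule sum.cong)
    fix j assume j: "j \<in> {..<n}"
    show "of_real (M i j) * v j = (if j = i then v i else 0)"
    proof (cases "i < j")
      case True then show ?thesis using less.hyps[of j] j less.prems by simp
    next
      case False then show ?thesis using U_zero[OF False] by (simp add: M_def)
    qed
  qed simp
  then show ?case using assms(1)[OF less.prems] less.prems by simp
qed

text \<open>Paired with \<open>cnj v\<close>, the equation \<open>M^t v = r M v\<close> becomes
  \<open>cnj m = r * m\<close>, so \<open>r\<close> has modulus 1 unless \<open>m = 0\<close>. In
  that case the real and imaginary parts of \<open>v\<close> lie in the radical, hence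
  \<open>M^t v = - M v\<close> and \<open>r = -1\<close>.\<close>

lemma unimodular_root:
  fixes v :: "nat \<Rightarrow> complex"
  assumes pos: "\<And>x. Q x \<ge> 0"
    and eig: "\<And>i. i < n \<Longrightarrow> (\<Sum>j<n. of_real (M j i) * v j) = r * (\<Sum>j<n. of_real (M i j) * v j)"
    and v: "k < n" "v k \<noteq> 0"
  shows "cmod r = 1"
proof -
  define w where "w i = (\<Sum>j<n. of_real (M i j) * v j)" for i
  define m where "m = (\<Sum>i<n. cnj (v i) * w i)"
  have "cnj m = (\<Sum>i<n. \<Sum>j<n. of_real (M i j) * (cnj (v j) * v i))"
    unfolding m_def w_def by (simp add: sum_distrib_left mult_ac)
  also have "\<dots> = (\<Sum>j<n. cnj (v j) * (\<Sum>i<n. of_real (M i j) * v i))"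
    by (subst sum.swap) (simp add: sum_distrib_left mult_ac)
  also have "\<dots> = (\<Sum>j<n. cnj (v j) * (r * w j))" using eig by (simp add: w_def)
  also have "\<dots> = r * m" unfolding m_def by (simp add: sum_distrib_left mult_ac)
  finally have cm: "cnj m = r * m" .
  show ?thesis
  proof (cases "m = 0")
    case False
    have "cmod m = cmod r * cmod m" using arg_cong[OF cm, of cmod] by (simp add: norm_mult)
    then show ?thesis using False by simp
  next
    case True
    have "Re m = Q (\<lambda>i. Re (v i)) + Q (\<lambda>i. Im (v i))"
      unfolding m_def w_def Q_def by (simp add: sum_distrib_left sum.distrib[symmetric] algebra_simps)
    then have "Q (\<lambda>i. Re (v i)) = 0" "Q (\<lambda>i. Im (v i)) = 0"
      using True pos[of "\<lambda>i. Re (v i)"] pos[of "\<lambda>i. Im (v i)"] by auto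
    note null = Q_null[OF pos this(1)] Q_null[OF pos this(2)]
    have "(1 + r) * w i = 0" if i: "i < n" for i
    proof -
      have "(1 + r) * w i = (\<Sum>j<n. of_real (M i j + M j i) * v j)"
        using eig[OF i] unfolding w_def by (simp add: algebra_simps sum.distrib)
      also have "\<dots> = 0" using null[OF i] by (simp add: complex_eq_iff)
      finally show ?thesis .
    qed
    moreover obtain i where "i < n" "w i \<noteq> 0" using M_injective[of v k] v unfolding w_def by blast
    ultimately have "r = -1" by (metis add_eq_0_iff mult_eq_0_iff)
    then show ?thesis by simp
  qed
qed

end

section \<open>From eigenvalues to the Mahler measure\<close>

lemma mahler_measure_poly_ge_root:
  assumes "monic p" "poly p r = 0"
  shows "mahler_measure_poly p \<ge> cmod r"
proof -
  obtain q where q: "p = [:- r, 1:] * q" using assms(2) by (metis dvdE poly_eq_0_iff_dvd)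
  have "lead_coeff p = lead_coeff [:- r, 1:] * lead_coeff q" unfolding q by (rule lead_coeff_mult)
  then have "lead_coeff q = 1" using assms(1) by simp
  then have "mahler_measure_poly q \<ge> 1" 
    unfolding mahler_measure_poly_via_monic using mahler_measure_monic_ge_1[of q] by simp
  moreover have "mahler_measure_poly p = max 1 (cmod r) * mahler_measure_poly q"
    unfolding q measure_eq_prod by simp
  ultimately show ?thesis using mult_left_mono[of 1 "mahler_measure_poly q" "max 1 (cmod r)"] by simp
qed

lemma mahler_measure_poly_unimodular:
  assumes "monic p" "\<And>r. poly p r = 0 \<Longrightarrow> cmod r = 1"
  shows "mahler_measure_poly p = 1"
proof -
  have "cmod a = 1" if "a \<in> set (complex_roots_complex p)" for a
  proof (rule assms(2))
    have "poly (\<Prod>a\<leftarrow>as. [:- a, 1:]) x = 0" if "x \<in> set as" for as and x :: complex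
      using that by (induction as) auto
    then show "poly p a = 0" using that complex_roots(1)[of p] assms(1) by (metis smult_1_left)
  qed
  then have "map (\<lambda>a. max 1 (cmod a)) (complex_roots_complex p) = map (\<lambda>_. 1) (complex_roots_complex p)" by simp
  moreover have "(\<Prod>_\<leftarrow>as. 1) = (1 :: real)" for as :: "complex list" by (induction as) auto
  ultimately show ?thesis unfolding mahler_measure_poly_def using assms(1) by (simp del: map_eq_conv)
qed

text \<open>\<open>MA\<close> is the equation \<open>M^t = M A\<close> at row \<open>k\<close> and
  column \<open>j\<close>. Since \<open>M\<close> is injective, kernel vectors of
  \<open>l M + M^t\<close> are eigenvectors of \<open>A\<close> for \<open>-l\<close>.\<close>

lemma coxeter_matrix_mahler:
  fixes A :: "real mat" and U :: "nat \<Rightarrow> nat \<Rightarrow> real"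
  assumes A: "A \<in> carrier_mat n n" and U: "\<And>i j. U i j \<in> {0, 1}" "\<And>i j. U i j = 1 \<Longrightarrow> i < j"
    and MA: "\<And>j k. j < n \<Longrightarrow> k < n \<Longrightarrow>
      (if j = k then 1 else - U j k) = (\<Sum>i<n. A $$ (i, j) * (if k = i then 1 else - U k i))"
  shows "mahler_real (char_poly A) = 1 \<or> mahler_real (char_poly A) \<ge> mahler_measure lehmer_poly"
proof -
  interpret acyclic_orientation n U by unfold_locales (use U in auto)
  have MA': "M j k = (\<Sum>i<n. M k i * A $$ (i, j))" if "j < n" "k < n" for j k
    using MA[OF that] unfolding M_def by (simp add: mult.commute)
  let ?p = "map_poly complex_of_real (char_poly A)"
  have monic: "monic ?p" using degree_monic_char_poly[OF A] by simp
  have row: "(A *\<^sub>v v) $ i = (\<Sum>j<n. A $$ (i, j) * v $ j)" if "v \<in> carrier_vec n" "i < n" for v i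
    using that A by (auto simp: scalar_prod_def lessThan_atLeast0)
  obtain l where l: "l > 1" "mahler_measure lehmer_poly = l" "lehmer_trace (l + 1 / l) = 0"
    "20264 / 10000 < l + 1 / l" "l + 1 / l < 202643 / 100000"
    using lehmer_number .
  show ?thesis
  proof (cases "\<exists>l'\<ge>l. D l' = 0")
    case True
    then obtain l' where l': "l' \<ge> l" "D l' = 0" by blast
    then obtain v where v: "v \<in> carrier_vec n" "v \<noteq> 0\<^sub>v n" "mat n n (\<lambda>(i, j). R l' i j) *\<^sub>v v = 0\<^sub>v n"
      unfolding D_def by (subst (asm) det_0_iff_vec_prod_zero[of _ n]) auto
    define w where "w i = l' * v $ i + (\<Sum>j<n. A $$ (i, j) * v $ j)" for i
    have "(\<Sum>i<n. M k i * w i) = 0" if k: "k < n" for k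
    proof -
      have "0 = (mat n n (\<lambda>(i, j). R l' i j) *\<^sub>v v) $ k" using v(3) k by simp
      also have "\<dots> = (\<Sum>j<n. R l' k j * v $ j)"
        using v(1) k by (auto simp: scalar_prod_def lessThan_atLeast0)
      also have "\<dots> = (\<Sum>j<n. l' * (M k j * v $ j)) + (\<Sum>j<n. M j k * v $ j)"
        unfolding R_M by (simp add: sum.distrib algebra_simps)
      also have "(\<Sum>j<n. M j k * v $ j) = (\<Sum>j<n. \<Sum>i<n. M k i * (A $$ (i, j) * v $ j))"
        using MA' k by (simp add: sum_distrib_right mult.assoc)
      also have "\<dots> = (\<Sum>i<n. \<Sum>j<n. M k i * (A $$ (i, j) * v $ j))" by (rule sum.swap)
      finally show ?thesis unfolding w_def
        by (simp add: sum.distrib[symmetric] algebra_simps sum_distrib_left)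
    qed
    then have "(\<Sum>i<n. of_real (M k i) * complex_of_real (w i)) = 0" if "k < n" for k
      using that by (simp flip: of_real_mult of_real_sum)
    then have w0: "w i = 0" if "i < n" for i
      using M_injective[of "\<lambda>i. complex_of_real (w i)" i] that by simp
    have "A *\<^sub>v v = (- l') \<cdot>\<^sub>v v"
      by (rule eq_vecI) (use w0 row[OF v(1)] v(1) A in \<open>auto simp: w_def add_eq_0_iff\<close>)
    then have "eigenvalue A (- l')" unfolding eigenvalue_def eigenvector_def using v A by auto
    then have "poly (char_poly A) (- l') = 0" using eigenvalue_root_char_poly[OF A] by simp
    then have "poly ?p (of_real (- l')) = 0" by (simp del: of_real_minus)
    then have "mahler_measure_poly ?p \<ge> cmod (of_real (- l'))" by (rule mahler_measure_poly_ge_root[OF monic])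
    then show ?thesis unfolding mahler_real_def using l l' by simp
  next
    case False
    then obtain u where "\<And>i. i < n \<Longrightarrow> u i > 0" "\<And>i. i < n \<Longrightarrow> (\<Sum>j<n. (U i j + U j i) * u j) \<le> 2 * u i"
      using superharmonic_if_no_root[OF l(1,3,4,5)] by blast
    then have pos: "Q x \<ge> 0" for x using Q_nonneg by blast
    have "cmod r = 1" if r: "poly ?p r = 0" for r
    proof -
      let ?A = "map_mat complex_of_real A"
      have cA: "?A \<in> carrier_mat n n" using A by simp
      have "char_poly ?A = ?p" by (rule of_real_hom.char_poly_hom[OF A])
      then have "eigenvalue ?A r" using r eigenvalue_root_char_poly[OF cA] by simp
      then obtain v where v: "v \<in> carrier_vec n" "v \<noteq> 0\<^sub>v n" "?A *\<^sub>v v = r \<cdot>\<^sub>v v"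
        unfolding eigenvalue_def eigenvector_def using A by auto
      obtain k where k: "k < n" "v $ k \<noteq> 0" using v(1,2) by (metis carrier_vecD eq_vecI index_zero_vec)
      have ev: "(\<Sum>j<n. of_real (A $$ (i, j)) * v $ j) = r * v $ i" if "i < n" for i
      proof -
        have "(?A *\<^sub>v v) $ i = (\<Sum>j<n. of_real (A $$ (i, j)) * v $ j)"
          using that A v(1) by (auto simp: scalar_prod_def lessThan_atLeast0)
        then show ?thesis using v that by simp
      qed
      show ?thesis
      proof (rule unimodular_root[where v = "\<lambda>j. v $ j", OF pos _ k])
        fix i assume i: "i < n"
        have "(\<Sum>j<n. of_real (M j i) * v $ j) = (\<Sum>j<n. \<Sum>m<n. of_real (M i m) * (of_real (A $$ (m, j)) * v $ j))"
          using MA' i by (simp add: sum_distrib_right mult.assoc)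
        also have "\<dots> = (\<Sum>m<n. of_real (M i m) * (\<Sum>j<n. of_real (A $$ (m, j)) * v $ j))"
          by (subst sum.swap) (simp add: sum_distrib_left)
        also have "\<dots> = r * (\<Sum>j<n. of_real (M i j) * v $ j)"
          using ev by (simp add: sum_distrib_left mult_ac)
        finally show "(\<Sum>j<n. of_real (M j i) * v $ j) = r * (\<Sum>j<n. of_real (M i j) * v $ j)" .
      qed
    qed
    then have "mahler_measure_poly ?p = 1" by (rule mahler_measure_poly_unimodular[OF monic])
    then show ?thesis by (simp add: mahler_real_def)
  qed
qed

section \<open>Winding numbers of chains\<close>

lemma winding_number_log:
  assumes "continuous_on {0..1} q" "\<And>t. t \<in> {0..1} \<Longrightarrow> p t = exp (q t)"
  shows "winding_number p 0 = (q 1 - q 0) / (2 * of_real pi * \<i>)"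
proof -
  have "winding_number p 0 = winding_number (exp \<circ> q) 0"
    by (rule winding_number_cong) (use assms in auto)
  then show ?thesis
    using winding_number_compose_exp[of q] assms(1) by (simp add: path_def pathstart_def pathfinish_def)
qed

definition edge :: "real \<Rightarrow> nat \<Rightarrow> real" where
  "edge t = (\<lambda>i. if i = 0 then 1 - t else if i = 1 then t else 0)"

definition triangle :: "real \<times> real \<Rightarrow> nat \<Rightarrow> real" where
  "triangle = (\<lambda>(s, t) i. if i = 0 then 1 - s - t else if i = 1 then s else if i = 2 then t else 0)"

lemma edge_in: "t \<in> {0..1} \<Longrightarrow> edge t \<in> standard_simplex 1"
  by (auto simp: edge_def standard_simplex_def)

lemma triangle_in: "s \<ge> 0 \<Longrightarrow> t \<ge> 0 \<Longrightarrow> s + t \<le> 1 \<Longrightarrow> triangle (s, t) \<in> standard_simplex 2"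
  by (auto simp: triangle_def standard_simplex_def numeral_2_eq_2)

lemma continuous_triangle:
  "continuous_map (top_of_set {(s, t). s \<ge> 0 \<and> t \<ge> 0 \<and> s + t \<le> 1})
     (subtopology (powertop_real UNIV) (standard_simplex 2)) triangle"
proof -
  have "continuous_on A (\<lambda>x. triangle x i)" for A i
    unfolding triangle_def case_prod_unfold
    by (cases "i = 0"; cases "i = 1"; cases "i = 2") (auto intro!: continuous_intros)
  then show ?thesis
    using triangle_in by (auto simp: continuous_map_in_subtopology continuous_map_componentwise_UNIV)
qed

text \<open>\<open>winding_number\<close> is meaningful for open paths too: it is the increment of a continuous logarithm,
  divided by \<open>2\<pi>\<i>\<close>, and therefore additive on the faces of a triangle.\<close>

definition edge_winding :: "('a \<Rightarrow> complex) \<Rightarrow> ((nat \<Rightarrow> real) \<Rightarrow> 'a) \<Rightarrow> complex" where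
  "edge_winding f \<sigma> = winding_number (\<lambda>t. f (\<sigma> (edge t))) 0"

definition chain_winding :: "('a \<Rightarrow> complex) \<Rightarrow> 'a real_chain \<Rightarrow> complex" where
  "chain_winding f c = (\<Sum>\<sigma> | c \<sigma> \<noteq> 0. of_real (c \<sigma>) * edge_winding f \<sigma>)"

lemma chain_winding_superset:
  assumes "finite T" "{\<sigma>. c \<sigma> \<noteq> 0} \<subseteq> T"
  shows "chain_winding f c = (\<Sum>\<sigma>\<in>T. of_real (c \<sigma>) * edge_winding f \<sigma>)"
  unfolding chain_winding_def using assms by (intro sum.mono_neutral_left) auto

text \<open>A triangle is contractible, so \<open>f\<close> has a single logarithm \<open>q\<close>
  along \<open>\<sigma>\<close>, and the increments of \<open>q\<close> over the three faces cancel
  with their signs.\<close>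

lemma edge_winding_faces:
  assumes \<sigma>: "singular_simplex 2 X \<sigma>" and f: "continuous_map X euclidean f" "\<And>x. x \<in> topspace X \<Longrightarrow> f x \<noteq> 0"
  shows "edge_winding f (singular_face 2 0 \<sigma>) - edge_winding f (singular_face 2 1 \<sigma>)
     + edge_winding f (singular_face 2 2 \<sigma>) = 0"
proof -
  let ?T = "{(s, t). s \<ge> 0 \<and> t \<ge> 0 \<and> s + t \<le> (1::real)}"
  have cm: "continuous_map (subtopology (powertop_real UNIV) (standard_simplex 2)) X \<sigma>"
    using \<sigma> by (simp add: singular_simplex_def)
  have "continuous_map (top_of_set ?T) euclidean (f \<circ> (\<sigma> \<circ> triangle))"
    using continuous_triangle cm f(1) by (intro continuous_map_compose)
  then have cont: "continuous_on ?T (\<lambda>x. f (\<sigma> (triangle x)))" by (simp add: o_def)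
  have ne: "f (\<sigma> (triangle x)) \<noteq> 0" if "x \<in> ?T" for x
  proof -
    have "triangle x \<in> standard_simplex 2" using that triangle_in by auto
    then have "\<sigma> (triangle x) \<in> topspace X" using cm continuous_map_image_subset_topspace by fastforce
    then show ?thesis using f(2) by blast
  qed
  have "convex ?T"
  proof -
    have "?T = {x. (1, 0) \<bullet> x \<ge> 0} \<inter> {x. (0, 1) \<bullet> x \<ge> 0} \<inter> {x. (1, 1) \<bullet> x \<le> 1}"
      by (auto simp: inner_Pair)
    then show ?thesis by (simp only:) (intro convex_Int convex_halfspace_ge convex_halfspace_le)
  qed
  then obtain q where q: "continuous_on ?T q" "\<And>x. x \<in> ?T \<Longrightarrow> f (\<sigma> (triangle x)) = exp (q x)"
    using continuous_logarithm_on_contractible[OF cont convex_imp_contractible ne] by blast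
  have w: "edge_winding f (singular_face 2 k \<sigma>) = (q (g 1) - q (g 0)) / (2 * of_real pi * \<i>)"
    if g: "continuous_on {0..1} g" "g ` {0..1} \<subseteq> ?T"
      "\<And>t. t \<in> {0..1} \<Longrightarrow> simplical_face k (edge t) = triangle (g t)" for k and g :: "real \<Rightarrow> real \<times> real"
    unfolding edge_winding_def
  proof (rule winding_number_log)
    show "continuous_on {0..1} (\<lambda>t. q (g t))"
      by (rule continuous_on_compose2[OF q(1) g(1,2)])
    fix t :: real assume t: "t \<in> {0..1}"
    have "singular_face 2 k \<sigma> (edge t) = \<sigma> (triangle (g t))"
      using edge_in[OF t] g(3)[OF t] by (simp add: singular_face_def)
    moreover have "g t \<in> ?T" by (rule subsetD[OF g(2) imageI[OF t]])
    ultimately show "f (singular_face 2 k \<sigma> (edge t)) = exp (q (g t))" by (simp only: q(2))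
  qed
  have face: "simplical_face 0 (edge t) = triangle (1 - t, t)" "simplical_face 1 (edge t) = triangle (0, t)"
    "simplical_face 2 (edge t) = triangle (t, 0)" for t
    by (auto simp: fun_eq_iff simplical_face_def edge_def triangle_def)
  have cont: "continuous_on {0..1} (\<lambda>t. (1 - t, t :: real))" "continuous_on {0..1} (\<lambda>t. (0 :: real, t :: real))"
    "continuous_on {0..1} (\<lambda>t. (t :: real, 0 :: real))"
    by (intro continuous_intros)+
  have img: "(\<lambda>t. (1 - t, t)) ` {0..1} \<subseteq> ?T" "(\<lambda>t. (0, t)) ` {0..1} \<subseteq> ?T" "(\<lambda>t. (t, 0)) ` {0..1} \<subseteq> ?T"
    by auto
  show ?thesis
    using w[OF cont(1) img(1) face(1)] w[OF cont(2) img(2) face(2)] w[OF cont(3) img(3) face(3)]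
    by (simp add: diff_divide_distrib)
qed

lemma real_boundary_superset:
  assumes "finite T" "{\<sigma>. c \<sigma> \<noteq> 0} \<subseteq> T"
  shows "real_boundary p c \<rho> = (\<Sum>\<sigma>\<in>T. \<Sum>k\<le>p. if singular_face p k \<sigma> = \<rho> then (-1) ^ k * c \<sigma> else 0)"
  unfolding real_boundary_def
proof (rule sum.mono_neutral_left[OF assms], rule ballI)
  fix \<sigma> assume "\<sigma> \<in> T - {\<sigma>. c \<sigma> \<noteq> 0}"
  then show "(\<Sum>k\<le>p. if singular_face p k \<sigma> = \<rho> then (-1) ^ k * c \<sigma> else 0) = 0"
    by (intro sum.neutral) simp
qed

lemma chain_winding_boundary:
  assumes d: "is_chain 2 X d" and f: "continuous_map X euclidean f" "\<And>x. x \<in> topspace X \<Longrightarrow> f x \<noteq> 0"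
  shows "chain_winding f (real_boundary 2 d) = 0"
proof -
  let ?D = "{\<sigma>. d \<sigma> \<noteq> 0}"
  define T where "T = (\<lambda>(k, \<sigma>). singular_face 2 k \<sigma>) ` ({..2} \<times> ?D)"
  have fin: "finite ?D" "finite T" unfolding T_def using d by (auto simp: is_chain_def)
  have face: "singular_face 2 k \<sigma> \<in> T" if "\<sigma> \<in> ?D" "k \<le> 2" for k \<sigma>
    unfolding T_def using that by force
  have "{\<rho>. real_boundary 2 d \<rho> \<noteq> 0} \<subseteq> T"
  proof
    fix \<rho> assume "\<rho> \<in> {\<rho>. real_boundary 2 d \<rho> \<noteq> 0}"
    then have "(\<Sum>\<sigma>\<in>?D. \<Sum>k\<le>2. if singular_face 2 k \<sigma> = \<rho> then (-1) ^ k * d \<sigma> else 0) \<noteq> 0"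
      by (simp add: real_boundary_def)
    then obtain \<sigma> where \<sigma>: "\<sigma> \<in> ?D" "(\<Sum>k\<le>2. if singular_face 2 k \<sigma> = \<rho> then (-1) ^ k * d \<sigma> else 0) \<noteq> 0"
      by (meson sum.not_neutral_contains_not_neutral)
    obtain k where "k \<in> {..2}" "(if singular_face 2 k \<sigma> = \<rho> then (-1) ^ k * d \<sigma> else 0) \<noteq> 0"
      using sum.not_neutral_contains_not_neutral[OF \<sigma>(2)] by blast
    then show "\<rho> \<in> T" using face \<sigma>(1) by (auto split: if_splits)
  qed
  then have "chain_winding f (real_boundary 2 d) = (\<Sum>\<rho>\<in>T. of_real (real_boundary 2 d \<rho>) * edge_winding f \<rho>)"
    by (rule chain_winding_superset[OF fin(2)])
  also have "\<dots> = (\<Sum>\<rho>\<in>T. \<Sum>\<sigma>\<in>?D. \<Sum>k\<le>2. if singular_face 2 k \<sigma> = \<rho> then (-1) ^ k * of_real (d \<sigma>) * edge_winding f \<rho> else 0)"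
    unfolding real_boundary_def of_real_sum sum_distrib_right
    by (intro sum.cong) auto
  also have "\<dots> = (\<Sum>\<sigma>\<in>?D. \<Sum>k\<le>2. \<Sum>\<rho>\<in>T. if singular_face 2 k \<sigma> = \<rho> then (-1) ^ k * of_real (d \<sigma>) * edge_winding f \<rho> else 0)"
    by (subst sum.swap, rule sum.cong[OF refl], rule sum.swap)
  also have "\<dots> = (\<Sum>\<sigma>\<in>?D. \<Sum>k\<le>2. (-1) ^ k * of_real (d \<sigma>) * edge_winding f (singular_face 2 k \<sigma>))"
    using face fin(2) by (intro sum.cong) auto
  also have "\<dots> = (\<Sum>\<sigma>\<in>?D. 0)"
  proof (rule sum.cong[OF refl])
    fix \<sigma> assume "\<sigma> \<in> ?D"
    then have "singular_simplex 2 X \<sigma>" using d by (auto simp: is_chain_def)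
    from edge_winding_faces[OF this f] have "of_real (d \<sigma>) * (edge_winding f (singular_face 2 0 \<sigma>) 
        - edge_winding f (singular_face 2 1 \<sigma>) + edge_winding f (singular_face 2 2 \<sigma>)) = 0" by auto
    then show "(\<Sum>k\<le>2. (-1) ^ k * of_real (d \<sigma>) * edge_winding f (singular_face 2 k \<sigma>)) = 0"
      by (simp add: numeral_2_eq_2 algebra_simps)
  qed
  finally show ?thesis by simp
qed

lemma chain_winding_homologous:
  assumes c: "c \<in> cycles1 X" "hclass X c = hclass X c'" "finite {\<sigma>. c' \<sigma> \<noteq> 0}"
    and f: "continuous_map X euclidean f" "\<And>x. x \<in> topspace X \<Longrightarrow> f x \<noteq> 0"
  shows "chain_winding f c = chain_winding f c'"
proof -
  \<comment> \<open>A cycle lies in its own class because 0 is a boundary; the equality of the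
    classes then makes \<open>c - c'\<close> a boundary.\<close>
  have "(\<lambda>_. 0) \<in> boundaries1 X"
    unfolding boundaries1_def by (rule image_eqI[of _ _ "\<lambda>_. 0"]) (auto simp: real_boundary_def is_chain_def)
  then have "c \<in> hclass X c" using c(1) by (simp add: hclass_def)
  then have "c \<in> hclass X c'" using c(2) by blast
  then have "(\<lambda>\<sigma>. c \<sigma> - c' \<sigma>) \<in> boundaries1 X" by (simp add: hclass_def)
  then obtain d where d: "is_chain 2 X d" "(\<lambda>\<sigma>. c \<sigma> - c' \<sigma>) = real_boundary 2 d"
    unfolding boundaries1_def by auto
  let ?T = "{\<sigma>. c \<sigma> \<noteq> 0} \<union> {\<sigma>. c' \<sigma> \<noteq> 0}"
  have fin: "finite ?T" using c(1,3) by (simp add: cycles1_def is_chain_def)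
  have "chain_winding f c - chain_winding f c' = chain_winding f (\<lambda>\<sigma>. c \<sigma> - c' \<sigma>)"
  proof -
    have "chain_winding f c = (\<Sum>\<sigma>\<in>?T. of_real (c \<sigma>) * edge_winding f \<sigma>)"
      "chain_winding f c' = (\<Sum>\<sigma>\<in>?T. of_real (c' \<sigma>) * edge_winding f \<sigma>)"
      "chain_winding f (\<lambda>\<sigma>. c \<sigma> - c' \<sigma>) = (\<Sum>\<sigma>\<in>?T. of_real (c \<sigma> - c' \<sigma>) * edge_winding f \<sigma>)"
      by (rule chain_winding_superset[OF fin]; auto)+
    then show ?thesis by (simp add: sum_subtractf left_diff_distrib)
  qed
  also have "\<dots> = 0" unfolding d(2) by (rule chain_winding_boundary[OF d(1) f])
  finally show ?thesis by simp
qed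

section \<open>Path cycles, chain maps and the monodromy relation\<close>

definition path_simplex :: "(real \<Rightarrow> 'a) \<Rightarrow> (nat \<Rightarrow> real) \<Rightarrow> 'a" where
  "path_simplex g = restrict (\<lambda>x. g (x 1)) (standard_simplex 1)"

lemma path_chain_eq: "path_chain g \<sigma> = (if \<sigma> = path_simplex g then 1 else 0)"
  by (simp add: path_chain_def path_simplex_def)

lemma simplex_map_path: "simplex_map 1 f (path_simplex g) = path_simplex (f \<circ> g)"
  by (auto simp: simplex_map_def path_simplex_def fun_eq_iff)

lemma edge_winding_path: "edge_winding f (path_simplex g) = winding_number (\<lambda>t. f (g t)) 0"
  unfolding edge_winding_def
  by (rule winding_number_cong) (use edge_in in \<open>auto simp: path_simplex_def edge_def\<close>)

lemma path_chain_cycle: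
  assumes g: "continuous_map (top_of_set {0..1}) X g" "g 0 = g 1"
  shows "path_chain g \<in> cycles1 X"
proof -
  have supp: "{\<sigma>. path_chain g \<sigma> \<noteq> 0} = {path_simplex g}" by (auto simp: path_chain_eq)
  have "continuous_map (subtopology (powertop_real UNIV) (standard_simplex 1)) (top_of_set {0..1}) (\<lambda>x. x 1)"
    by (auto simp: continuous_map_in_subtopology standard_simplex_def intro: continuous_map_from_subtopology continuous_map_product_projection)
  from continuous_map_compose[OF this g(1)]
  have simplex: "singular_simplex 1 X (path_simplex g)"
    unfolding singular_simplex_def path_simplex_def by (auto simp: o_def elim!: continuous_map_eq)
  have "singular_face 1 0 (path_simplex g) = singular_face 1 1 (path_simplex g)"
    using g(2) simplical_face_in_standard_simplex[of 1 0] simplical_face_in_standard_simplex[of 1 1]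
    by (auto simp: singular_face_def path_simplex_def fun_eq_iff simplical_face_def standard_simplex_0)
  moreover have "{..1} = {0, 1::nat}" by auto
  ultimately have "real_boundary 1 (path_chain g) = (\<lambda>_. 0)"
    unfolding real_boundary_def supp by (intro ext) (simp add: path_chain_eq)
  then show ?thesis using simplex by (simp add: cycles1_def is_chain_def supp)
qed

lemma cycles1_sum:
  assumes "\<And>i. i \<in> I \<Longrightarrow> c i \<in> cycles1 X" "finite I"
  shows "(\<lambda>\<sigma>. \<Sum>i\<in>I. a i * c i \<sigma>) \<in> cycles1 X"
proof -
  let ?s = "\<lambda>\<sigma>. \<Sum>i\<in>I. a i * c i \<sigma>"
  define T where "T = (\<Union>i\<in>I. {\<sigma>. c i \<sigma> \<noteq> 0})"
  have T: "finite T" "T \<subseteq> singular_simplex_set 1 X" "i \<in> I \<Longrightarrow> {\<sigma>. c i \<sigma> \<noteq> 0} \<subseteq> T" for i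
    unfolding T_def using assms by (auto simp: cycles1_def is_chain_def)
  have supp: "{\<sigma>. ?s \<sigma> \<noteq> 0} \<subseteq> T"
  proof
    fix \<sigma> assume "\<sigma> \<in> {\<sigma>. ?s \<sigma> \<noteq> 0}"
    then obtain i where "i \<in> I" "a i * c i \<sigma> \<noteq> 0" by (auto elim: sum.not_neutral_contains_not_neutral)
    then show "\<sigma> \<in> T" unfolding T_def by auto
  qed
  have "real_boundary 1 ?s \<rho> = 0" for \<rho>
  proof -
    have "real_boundary 1 ?s \<rho> = (\<Sum>\<sigma>\<in>T. \<Sum>k\<le>1. \<Sum>i\<in>I. a i * (if singular_face 1 k \<sigma> = \<rho> then (-1) ^ k * c i \<sigma> else 0))"
      unfolding real_boundary_superset[OF T(1) supp]
      by (intro sum.cong refl) (auto simp: sum_distrib_left sum_negf mult.left_commute)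
    also have "\<dots> = (\<Sum>i\<in>I. \<Sum>\<sigma>\<in>T. \<Sum>k\<le>1. a i * (if singular_face 1 k \<sigma> = \<rho> then (-1) ^ k * c i \<sigma> else 0))"
      by (subst (2) sum.swap, subst sum.swap) (rule refl)
    also have "\<dots> = (\<Sum>i\<in>I. a i * real_boundary 1 (c i) \<rho>)"
      by (intro sum.cong refl) (simp only: real_boundary_superset[OF T(1,3)] sum_distrib_left)
    also have "\<dots> = 0" using assms(1) by (simp add: cycles1_def)
    finally show ?thesis .
  qed
  then show ?thesis using T supp by (auto simp: cycles1_def is_chain_def intro: finite_subset)
qed

lemma real_chain_map_finite: "finite {\<sigma>. c \<sigma> \<noteq> 0} \<Longrightarrow> finite {\<rho>. real_chain_map p g c \<rho> \<noteq> 0}"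
proof -
  assume fin: "finite {\<sigma>. c \<sigma> \<noteq> 0}"
  have "{\<rho>. real_chain_map p g c \<rho> \<noteq> 0} \<subseteq> simplex_map p g ` {\<sigma>. c \<sigma> \<noteq> 0}"
  proof
    fix \<rho> assume "\<rho> \<in> {\<rho>. real_chain_map p g c \<rho> \<noteq> 0}"
    then show "\<rho> \<in> simplex_map p g ` {\<sigma>. c \<sigma> \<noteq> 0}"
      unfolding real_chain_map_def by (auto elim: sum.not_neutral_contains_not_neutral)
  qed
  then show ?thesis using fin by (meson finite_imageI finite_subset)
qed

lemma chain_winding_chain_map:
  assumes T: "finite T" "{\<sigma>. c \<sigma> \<noteq> 0} \<subseteq> T"
  shows "chain_winding f (real_chain_map 1 g c) = (\<Sum>\<sigma>\<in>T. of_real (c \<sigma>) * edge_winding f (simplex_map 1 g \<sigma>))"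
proof -
  let ?D = "{\<sigma>. c \<sigma> \<noteq> 0}" and ?h = "simplex_map 1 g"
  have fin: "finite ?D" using T finite_subset by blast
  have "{\<rho>. real_chain_map 1 g c \<rho> \<noteq> 0} \<subseteq> ?h ` ?D"
    unfolding real_chain_map_def by (auto elim: sum.not_neutral_contains_not_neutral)
  then have "chain_winding f (real_chain_map 1 g c) = (\<Sum>\<rho>\<in>?h ` ?D. of_real (real_chain_map 1 g c \<rho>) * edge_winding f \<rho>)"
    using fin by (intro chain_winding_superset) auto
  also have "\<dots> = (\<Sum>\<rho>\<in>?h ` ?D. \<Sum>\<sigma>\<in>{\<sigma> \<in> ?D. ?h \<sigma> = \<rho>}. of_real (c \<sigma>) * edge_winding f (?h \<sigma>))"
    unfolding real_chain_map_def of_real_sum sum_distrib_right by (intro sum.cong) auto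
  also have "\<dots> = (\<Sum>\<sigma>\<in>?D. of_real (c \<sigma>) * edge_winding f (?h \<sigma>))"
    by (rule sum.image_gen[OF fin, symmetric])
  also have "\<dots> = (\<Sum>\<sigma>\<in>T. of_real (c \<sigma>) * edge_winding f (?h \<sigma>))"
    using T by (intro sum.mono_neutral_left) auto
  finally show ?thesis .
qed

lemma real_chain_map_path: "real_chain_map 1 f (path_chain g) = path_chain (f \<circ> g)"
proof
  fix \<rho>
  have "{\<sigma>. path_chain g \<sigma> \<noteq> 0 \<and> simplex_map 1 f \<sigma> = \<rho>} = (if \<rho> = path_simplex (f \<circ> g) then {path_simplex g} else {})"
    using simplex_map_path[of f g] by (auto simp: path_chain_eq)
  then show "real_chain_map 1 f (path_chain g) \<rho> = path_chain (f \<circ> g) \<rho>"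
    unfolding real_chain_map_def by (simp add: path_chain_eq)
qed

text \<open>Such a point would also be its own image at level 0, against the injectivity of the
  collar.\<close>

lemma pushoff_in_complement:
  assumes "bicollar S \<Phi>" "t \<in> {-1..1}" "t \<noteq> 0" "x \<in> S"
  shows "\<Phi> x t \<notin> S"
proof
  assume y: "\<Phi> x t \<in> S"
  then have "\<Phi> (\<Phi> x t) 0 = \<Phi> x t" using assms by (simp add: bicollar_def)
  moreover have "inj_on (\<lambda>(x, t). \<Phi> x t) (S \<times> {-1..1})" using assms by (simp add: bicollar_def)
  ultimately have "(\<Phi> x t, 0) = (x, t)" using y assms by (auto dest!: inj_onD[of _ _ "(\<Phi> x t, 0)" "(x, t)"])
  then show False using assms by simp
qed

lemma continuous_pushoff:
  assumes "bicollar S \<Phi>" "t \<in> {-1..1}"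
  shows "continuous_on S (\<lambda>x. \<Phi> x t)"
proof -
  have "continuous_on (S \<times> {-1..1}) (\<lambda>(x, t). \<Phi> x t)" using assms by (simp add: bicollar_def)
  moreover have "continuous_on S (\<lambda>x. (x, t))" by (intro continuous_intros)
  ultimately show ?thesis using assms(2) by (auto intro: continuous_on_compose2[of _ "\<lambda>(x, t). \<Phi> x t" _ "\<lambda>x. (x, t)", simplified])
qed

text \<open>Through winding numbers, a nowhere vanishing \<open>f\<close> on the complement defines
  a linear functional on cycles that kills boundaries. It is applied to the relation characterizing
  the monodromy, with the combination of loops in column \<open>j\<close> as representative of the
  image.\<close>

lemma monodromy_winding:
  assumes S: "bicollar S \<Phi>" "homology_monodromy S \<Phi> h"
    and A: "H1_matrix (top_of_set S) h n (\<lambda>i. path_chain (\<gamma> i)) A"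
    and \<gamma>: "\<And>i. i < n \<Longrightarrow> continuous_on {0..1} (\<gamma> i)" "\<And>i. i < n \<Longrightarrow> \<gamma> i ` {0..1} \<subseteq> S"
      "\<And>i. i < n \<Longrightarrow> \<gamma> i 0 = \<gamma> i 1"
    and f: "continuous_map (complement_in_S3 S) euclidean f" "\<And>x. x \<in> topspace (complement_in_S3 S) \<Longrightarrow> f x \<noteq> 0"
    and j: "j < n"
  shows "winding_number (\<lambda>s. f (Some (\<Phi> (\<gamma> j s) 1))) 0 =
     (\<Sum>i<n. of_real (A $$ (i, j)) * winding_number (\<lambda>s. f (Some (\<Phi> (\<gamma> i s) (-1)))) 0)"
proof -
  let ?X = "top_of_set S" and ?Y = "complement_in_S3 S"
  have cyc: "path_chain (\<gamma> i) \<in> cycles1 ?X" if "i < n" for i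
    by (rule path_chain_cycle) (use \<gamma> that in \<open>auto simp: continuous_map_in_subtopology\<close>)
  let ?\<beta> = "\<lambda>\<sigma>. \<Sum>i<n. A $$ (i, j) * path_chain (\<gamma> i) \<sigma>"
  have \<beta>: "?\<beta> \<in> cycles1 ?X" using cyc by (intro cycles1_sum) auto
  have "(\<lambda>_. 0) \<in> boundaries1 ?X"
    unfolding boundaries1_def by (rule image_eqI[of _ _ "\<lambda>_. 0"]) (auto simp: real_boundary_def is_chain_def)
  then have "?\<beta> \<in> hclass ?X ?\<beta>" using \<beta> by (simp add: hclass_def)
  then have "?\<beta> \<in> h (hclass ?X (path_chain (\<gamma> j)))" using A j by (simp add: H1_matrix_def)
  then have eq: "hclass ?Y (push_plus \<Phi> (path_chain (\<gamma> j))) = hclass ?Y (push_minus \<Phi> ?\<beta>)"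
    using S(2) cyc[OF j] unfolding homology_monodromy_def by blast
  have push: "continuous_map ?X ?Y (\<lambda>x. Some (\<Phi> x 1))"
  proof -
    have "continuous_map ?X euclidean (\<lambda>x. \<Phi> x 1)" using continuous_pushoff[OF S(1), of 1] by simp
    from continuous_map_compose[OF this continuous_map_Some]
    moreover have "Some (\<Phi> x 1) \<notin> Some ` S" if "x \<in> S" for x
      using pushoff_in_complement[OF S(1), of 1 x] that by auto
    ultimately show ?thesis unfolding complement_in_S3_def S3_def
      by (simp add: continuous_map_in_subtopology o_def Pi_iff)
  qed
  have "push_plus \<Phi> (path_chain (\<gamma> j)) = path_chain ((\<lambda>x. Some (\<Phi> x 1)) \<circ> \<gamma> j)"
    unfolding push_plus_def by (rule real_chain_map_path)
  moreover have "path_chain ((\<lambda>x. Some (\<Phi> x 1)) \<circ> \<gamma> j) \<in> cycles1 ?Y"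
    by (rule path_chain_cycle, rule continuous_map_compose[OF _ push])
      (use \<gamma> j in \<open>auto simp: continuous_map_in_subtopology\<close>)
  ultimately have c: "push_plus \<Phi> (path_chain (\<gamma> j)) \<in> cycles1 ?Y" by simp
  have fin\<beta>: "finite {\<sigma>. ?\<beta> \<sigma> \<noteq> 0}" using \<beta> by (simp add: cycles1_def is_chain_def)
  define T where "T = path_simplex ` \<gamma> ` {..<n}"
  have "{\<sigma>. ?\<beta> \<sigma> \<noteq> 0} \<subseteq> T"
    unfolding T_def by (auto simp: path_chain_eq elim!: sum.not_neutral_contains_not_neutral split: if_splits)
  then have "chain_winding f (push_minus \<Phi> ?\<beta>) =
      (\<Sum>\<sigma>\<in>T. of_real (?\<beta> \<sigma>) * edge_winding f (simplex_map 1 (\<lambda>x. Some (\<Phi> x (-1))) \<sigma>))"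
    unfolding push_minus_def by (intro chain_winding_chain_map) (auto simp: T_def)
  also have "\<dots> = (\<Sum>i<n. \<Sum>\<sigma>\<in>T. of_real (A $$ (i, j) * path_chain (\<gamma> i) \<sigma>) * edge_winding f (simplex_map 1 (\<lambda>x. Some (\<Phi> x (-1))) \<sigma>))"
    unfolding of_real_sum sum_distrib_right by (rule sum.swap)
  also have "\<dots> = (\<Sum>i<n. \<Sum>\<sigma>\<in>T. if \<sigma> = path_simplex (\<gamma> i) then of_real (A $$ (i, j)) * winding_number (\<lambda>s. f (Some (\<Phi> (\<gamma> i s) (-1)))) 0 else 0)"
    by (intro sum.cong refl) (auto simp: path_chain_eq simplex_map_path[unfolded One_nat_def] edge_winding_path)
  also have "\<dots> = (\<Sum>i<n. of_real (A $$ (i, j)) * winding_number (\<lambda>s. f (Some (\<Phi> (\<gamma> i s) (-1)))) 0)"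
    by (intro sum.cong refl) (auto simp: T_def)
  finally have m: "chain_winding f (push_minus \<Phi> ?\<beta>) = \<dots>" .
  have "chain_winding f (push_plus \<Phi> (path_chain (\<gamma> j))) =
     (\<Sum>\<sigma>\<in>{path_simplex (\<gamma> j)}. of_real (path_chain (\<gamma> j) \<sigma>) * edge_winding f (simplex_map 1 (\<lambda>x. Some (\<Phi> x 1)) \<sigma>))"
    unfolding push_plus_def by (intro chain_winding_chain_map) (auto simp: path_chain_eq)
  also have "\<dots> = winding_number (\<lambda>s. f (Some (\<Phi> (\<gamma> j s) 1))) 0"
    by (simp add: path_chain_eq simplex_map_path[unfolded One_nat_def] edge_winding_path)
  finally show ?thesis
    using chain_winding_homologous[OF c eq _ f] m
      real_chain_map_finite[OF fin\<beta>, of 1 "\<lambda>x. Some (\<Phi> x (-1))"] by (simp add: push_minus_def)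
qed

section \<open>Winding numbers with respect to a chord loop\<close>

lemma loop_winding_halfplane:
  assumes g: "continuous_on {0..1} g" "g 0 = g 1" and pos: "\<And>s. s \<in> {0..1} \<Longrightarrow> Re (d * g s) > 0"
  shows "winding_number g 0 = 0"
proof -
  have d: "d \<noteq> 0" using pos[of 0] by auto
  have nn: "d * g s \<notin> \<real>\<^sub>\<le>\<^sub>0" if "s \<in> {0..1}" for s
    using pos[OF that] by (simp add: complex_nonpos_Reals_iff)
  have "winding_number g 0 = ((Ln (d * g 1) - Ln d) - (Ln (d * g 0) - Ln d)) / (2 * of_real pi * \<i>)"
  proof (rule winding_number_log[of "\<lambda>s. Ln (d * g s) - Ln d"])
    show "continuous_on {0..1} (\<lambda>s. Ln (d * g s) - Ln d)"
      by (intro continuous_intros g) (use nn in auto)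
    fix s :: real assume s: "s \<in> {0..1}"
    then have "d * g s \<noteq> 0" using nn by force
    then show "g s = exp (Ln (d * g s) - Ln d)" using d by (simp add: exp_diff)
  qed
  then show ?thesis using g(2) by simp
qed

text \<open>The first half of the loop can cross the real axis only on the side
  \<open>e * Re < 0\<close>, the second only on the other side. The signs of the imaginary part at
  the switching points make both passages counterclockwise, for either \<open>e\<close>.\<close>

lemma loop_winding_crossing:
  fixes e :: real
  assumes g: "continuous_on {0..1} g" "g 0 = g 1" and e: "e \<in> {1, -1}"
    and first: "\<And>s. s \<in> {0..1/2} \<Longrightarrow> e * Re (g s) < 0"
    and second: "\<And>s. s \<in> {1/2..1} \<Longrightarrow> Im (g s) = 0 \<Longrightarrow> e * Re (g s) > 0"
    and ends: "e * Im (g 0) > 0" "e * Im (g (1/2)) < 0"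
  shows "winding_number g 0 = 1"
proof -
  \<comment> \<open>Each half has a principal logarithm after multiplication by \<open>-e\<close> or
    \<open>e\<close>. The summand \<open>i * pi\<close> makes the two agree at
    \<open>s = 1/2\<close>, and \<open>Ln (- e)\<close> undoes the factor.\<close>
  define q where "q s = Ln (- of_real e) + (if s \<le> 1/2 then Ln (- of_real e * g s) else Ln (of_real e * g s) + \<i> * pi)" for s
  have e2: "complex_of_real e * of_real e = 1" using e by auto
  have nn1: "- of_real e * g s \<notin> \<real>\<^sub>\<le>\<^sub>0" if "s \<in> {0..1/2}" for s
    using first[OF that] by (simp add: complex_nonpos_Reals_iff)
  have nn2: "of_real e * g s \<notin> \<real>\<^sub>\<le>\<^sub>0" if "s \<in> {1/2..1}" for s
    using second[OF that] e by (auto simp: complex_nonpos_Reals_iff)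
  have "e \<noteq> 0" "g (1/2) \<noteq> 0" "g 0 \<noteq> 0" "Im (g 0) \<noteq> 0" using ends e by auto
  then have "Ln (of_real e * g (1/2)) = Ln (- of_real e * g (1/2)) - \<i> * pi"
    "Ln (of_real e * g 0) = Ln (- of_real e * g 0) + \<i> * pi"
    using Ln_minus[of "- of_real e * g (1/2)"] Ln_minus[of "- of_real e * g 0"] ends by simp_all
  then have half: "Ln (- of_real e * g (1/2)) = Ln (of_real e * g (1/2)) + \<i> * pi"
    and zero: "Ln (of_real e * g 0) = Ln (- of_real e * g 0) + \<i> * pi" by simp_all
  have "winding_number g 0 = (q 1 - q 0) / (2 * of_real pi * \<i>)"
  proof (rule winding_number_log)
    have "continuous_on {s \<in> {0..1}. s \<le> 1/2} (\<lambda>s. Ln (- of_real e * g s))"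
      by (intro continuous_intros continuous_on_subset[OF g(1)]) (use nn1 in auto)
    moreover have "continuous_on {s \<in> {0..1}. 1/2 \<le> s} (\<lambda>s. Ln (of_real e * g s) + \<i> * pi)"
      by (intro continuous_intros continuous_on_subset[OF g(1)]) (use nn2 in auto)
    ultimately have "continuous_on {0..1} (\<lambda>s. if s \<le> 1/2 then Ln (- of_real e * g s) else Ln (of_real e * g s) + \<i> * pi)"
      by (rule continuous_on_cases_le[OF _ _ continuous_on_id]) (simp only: half)
    then show "continuous_on {0..1} q" unfolding q_def by (intro continuous_on_add continuous_on_const)
    fix s :: real assume s: "s \<in> {0..1}"
    show "g s = exp (q s)"
    proof (cases "s \<le> 1/2")
      case True
      then have "- of_real e * g s \<noteq> 0" using nn1[of s] s by force
      then show ?thesis using True e by (auto simp: q_def exp_add)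
    next
      case False
      then have "of_real e * g s \<noteq> 0" using nn2[of s] s by force
      then show ?thesis using False e by (auto simp: q_def exp_add)
    qed
  qed
  moreover have "q 1 - q 0 = 2 * of_real pi * \<i>" using g(2) zero by (simp add: q_def)
  ultimately show ?thesis by simp
qed

lemma winding_number_homotopy:
  fixes H :: "real \<times> real \<Rightarrow> complex"
  assumes H: "continuous_on ({0..1} \<times> {0..1}) H"
    and ne: "\<And>u s. u \<in> {0..1} \<Longrightarrow> s \<in> {0..1} \<Longrightarrow> H (u, s) \<noteq> 0"
    and loop: "\<And>u. u \<in> {0..1} \<Longrightarrow> H (u, 0) = H (u, 1)"
  shows "winding_number (\<lambda>s. H (0, s)) 0 = winding_number (\<lambda>s. H (1, s)) 0"
proof (rule winding_number_homotopic_loops)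
  show "homotopic_loops (- {0}) (\<lambda>s. H (0, s)) (\<lambda>s. H (1, s))"
    unfolding homotopic_loops
    by (rule exI[of _ H]) (use H ne loop in \<open>auto simp: pathfinish_def pathstart_def\<close>)
qed

lemma zero_notin_segment:
  assumes "Re (d * a) > 0" "Re (d * b) > 0" shows "(0::complex) \<notin> closed_segment a b"
proof
  assume "0 \<in> closed_segment a b"
  then obtain u where u: "0 \<le> u" "u \<le> 1" "0 = (1 - u) *\<^sub>R a + u *\<^sub>R b" by (auto simp: in_segment)
  have "Re (d * ((1 - u) *\<^sub>R a + u *\<^sub>R b)) = (1 - u) * Re (d * a) + u * Re (d * b)"
    by (simp add: algebra_simps)
  then have "(1 - u) * Re (d * a) + u * Re (d * b) = 0" using u(3) by simp
  moreover have "(1 - u) * Re (d * a) + u * Re (d * b) > 0"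
  proof (cases "u = 0")
    case False
    then have "u * Re (d * b) > 0" "(1 - u) * Re (d * a) \<ge> 0" using u assms by auto
    then show ?thesis by linarith
  qed (use assms in simp)
  ultimately show False by simp
qed

section \<open>A map to the plane that vanishes on a chord loop\<close>

definition frame :: "chord \<Rightarrow> complex \<Rightarrow> complex" where
  "frame l x = cnj (chord_dir l) * x"

text \<open>The signed distance to the line of the chord, positive on its left: \<open>frame\<close>
  rotates the chord direction to the positive real axis.\<close>

definition side :: "chord \<Rightarrow> complex \<Rightarrow> real" where
  "side l x = Im (frame l x) - chord_offset l"

text \<open>The function \<open>link_height c\<close> is positive exactly between the disk and the paraboloid carrying the
  core, so that the zero set of \<open>link_map\<close> is the loop formed by the chord and the core.  The winding
  number of \<open>link_map\<close> along a cycle is minus the linking number with that loop.  Cutting off at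
  \<open>-L\<close> makes \<open>link_map\<close> constant near infinity.\<close>

definition link_height :: "real \<Rightarrow> space3 \<Rightarrow> real" where
  "link_height c p = min (snd p) (c * (1 - (cmod (fst p))\<^sup>2) - snd p)"

definition link_map :: "real \<Rightarrow> real \<Rightarrow> chord \<Rightarrow> space3 \<Rightarrow> complex" where
  "link_map L c l p =
     Complex (max (link_height c p) (- L)) (side l (fst p) * max 0 (L + link_height c p))"

lemma continuous_link_height [continuous_intros]:
  "continuous_on A f \<Longrightarrow> continuous_on A (\<lambda>x. link_height c (f x))"
  unfolding link_height_def by (intro continuous_intros)

lemma continuous_side [continuous_intros]:
  "continuous_on A f \<Longrightarrow> continuous_on A (\<lambda>x. side l (f x))"
  unfolding side_def frame_def by (intro continuous_intros)

lemma continuous_link_map [continuous_intros]: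
  "continuous_on A f \<Longrightarrow> continuous_on A (\<lambda>x. link_map L c l (f x))"
  unfolding link_map_def Complex_eq by (intro continuous_intros)

lemma continuous_map_one_point_extension:
  fixes F :: "'a::t2_space \<Rightarrow> 'b::topological_space"
  assumes F: "continuous_on UNIV F" and K: "compact K" "\<And>p. p \<notin> K \<Longrightarrow> F p = w"
  shows "continuous_map (Alexandroff_compactification euclidean) euclidean (case_option w F)"
  unfolding continuous_map_def
proof (intro conjI allI impI)
  fix U :: "'b set" assume "openin euclidean U"
  then have U: "open U" by simp
  let ?V = "{x \<in> topspace (Alexandroff_compactification euclidean). case_option w F x \<in> U}"
  show "openin (Alexandroff_compactification euclidean) ?V"
  proof (cases "w \<in> U")
    case False
    then have "?V = Some ` (F -` U)" by (auto simp: image_iff split: option.splits)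
    moreover have "open (F -` U)" using F U by (simp add: continuous_on_open_vimage)
    ultimately show ?thesis by simp
  next
    case True
    let ?C = "F -` (- U)"
    have "closed ?C" using F U by (simp add: continuous_on_closed_vimage closed_Compl)
    moreover have "?C \<subseteq> K" using K(2) True by auto
    ultimately have C: "compact ?C" "closed ?C" using K(1) by (metis compact_Int_closed inf.absorb_iff2)+
    then have cc: "compactin euclidean ?C" "closedin euclidean ?C" by simp_all
    have V: "?V = insert None (Some ` (topspace euclidean - ?C))"
    proof (rule Set.set_eqI)
      show "x \<in> ?V \<longleftrightarrow> x \<in> insert None (Some ` (topspace euclidean - ?C))" for x
        using True by (cases x) auto
    qed
    show ?thesis
      by (subst V, rule openin_Alexandroff_compactification[THEN iffD2], rule disjI2, rule exI[of _ ?C], simp only: cc simp_thms)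
  qed
qed auto

text \<open>Where the height is at least \<open>-L\<close>, \<open>z\<close> lies between
  \<open>-L\<close> and \<open>c * (1 - |x|^2) + L\<close>, which bounds both \<open>z\<close> and
  \<open>x\<close>. Outside this compact set the map is constantly \<open>-L\<close>, the value at
  infinity.\<close>

lemma continuous_map_link_map:
  assumes "c > 0"
  shows "continuous_map S3 euclidean (case_option (of_real (- L)) (link_map L c l))"
  unfolding S3_def
proof (rule continuous_map_one_point_extension)
  let ?K = "{p. link_height c p \<ge> - L}"
  show "continuous_on UNIV (link_map L c l)" by (intro continuous_intros)
  have "closed ?K" by (intro closed_Collect_le continuous_intros)
  moreover have "?K \<subseteq> cball 0 (sqrt ((c + 2 * \<bar>L\<bar>) / c)) \<times> {- \<bar>L\<bar> .. c + \<bar>L\<bar>}"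
  proof
    fix p assume "p \<in> ?K"
    then have h: "snd p \<ge> - L" "c * (1 - (cmod (fst p))\<^sup>2) - snd p \<ge> - L" by (auto simp: link_height_def)
    have "c * (cmod (fst p))\<^sup>2 \<ge> 0" using assms by simp
    then have z: "snd p \<le> c + \<bar>L\<bar>" "snd p \<ge> - \<bar>L\<bar>" using h by (auto simp: algebra_simps)
    have "c * (cmod (fst p))\<^sup>2 \<le> c + 2 * \<bar>L\<bar>" using h by (simp add: algebra_simps)
    then have "(cmod (fst p))\<^sup>2 \<le> (c + 2 * \<bar>L\<bar>) / c" using assms by (simp add: pos_le_divide_eq mult.commute)
    then have "cmod (fst p) \<le> sqrt ((c + 2 * \<bar>L\<bar>) / c)" by (simp add: real_le_rsqrt)
    then show "p \<in> cball 0 (sqrt ((c + 2 * \<bar>L\<bar>) / c)) \<times> {- \<bar>L\<bar> .. c + \<bar>L\<bar>}"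
      using z by (cases p) auto
  qed
  moreover have "compact (cball (0::complex) (sqrt ((c + 2 * \<bar>L\<bar>) / c)) \<times> {- \<bar>L\<bar> .. c + \<bar>L\<bar>})"
    by (intro compact_Times compact_cball compact_Icc)
  ultimately show "compact ?K" using compact_Int_closed inf.absorb_iff2 by metis
  show "link_map L c l p = of_real (- L)" if "p \<notin> ?K" for p
    using that by (simp add: link_map_def complex_eq_iff)
qed

section \<open>Coordinates along a chord of the unit circle\<close>

locale unit_chord =
  fixes l :: chord
  assumes on_circle: "cmod (fst l) = 1" "cmod (snd l) = 1" and distinct_ends: "fst l \<noteq> snd l"
begin

abbreviation "u \<equiv> chord_dir l"
abbreviation "o\<^sub>l \<equiv> chord_offset l"

lemma norm_u [simp]: "cmod u = 1"
  using distinct_ends by (simp add: chord_dir_def norm_sgn)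

lemma cnj_u [simp]: "cnj u * u = 1" "u * cnj u = 1"
  using complex_norm_square[of u] by (simp_all add: mult.commute)

lemma u_frame: "u * frame l x = x"
  by (simp add: frame_def mult.assoc[symmetric])

lemma frame_u: "frame l (u * x) = x"
  by (simp add: frame_def mult.assoc[symmetric])

lemma norm_frame: "cmod (frame l x) = cmod x"
  by (simp add: frame_def norm_mult)

lemma offset_frame: "o\<^sub>l = Im (frame l (fst l))"
  by (simp add: chord_offset_def frame_def inner_complex_def)

lemma diff_dir: "snd l - fst l = of_real (cmod (snd l - fst l)) * u"
  using distinct_ends by (simp add: chord_dir_def sgn_eq)

lemma strip_point_eq: "strip_point l \<tau> y = u * Complex (sqrt (1 - (o\<^sub>l + y)\<^sup>2) * \<tau>) (o\<^sub>l + y)"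
  by (simp add: strip_point_def Complex_eq algebra_simps)

lemma side_strip [simp]: "side l (strip_point l \<tau> y) = y"
  by (simp add: side_def strip_point_eq frame_u)

lemma norm_strip:
  assumes "\<bar>o\<^sub>l + y\<bar> \<le> 1"
  shows "1 - (cmod (strip_point l \<tau> y))\<^sup>2 = (1 - (o\<^sub>l + y)\<^sup>2) * (1 - \<tau>\<^sup>2)"
proof -
  have "(o\<^sub>l + y)\<^sup>2 \<le> 1" using assms by (simp add: abs_square_le_1)
  then show ?thesis
    by (simp add: strip_point_eq norm_mult cmod_power2 power_mult_distrib algebra_simps)
qed

lemma frame_ends:
  "frame l (fst l) = Complex (- sqrt (1 - o\<^sub>l\<^sup>2)) o\<^sub>l" "frame l (snd l) = Complex (sqrt (1 - o\<^sub>l\<^sup>2)) o\<^sub>l"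
  "\<bar>o\<^sub>l\<bar> < 1"
proof -
  let ?a = "Re (frame l (fst l))" and ?b = "Re (frame l (snd l))"
  have "frame l (snd l) - frame l (fst l) = frame l (snd l - fst l)" by (simp add: frame_def algebra_simps)
  also have "\<dots> = of_real (cmod (snd l - fst l))"
    by (subst diff_dir) (simp add: frame_def mult.left_commute)
  finally have d: "frame l (snd l) - frame l (fst l) = of_real (cmod (snd l - fst l))" .
  then have im: "Im (frame l (snd l)) = o\<^sub>l" unfolding offset_frame
    by (metis Im_complex_of_real eq_iff_diff_eq_0 minus_complex.sel(2))
  have re: "?b - ?a > 0" using d distinct_ends
    by (metis Re_complex_of_real minus_complex.sel(1) right_minus_eq zero_less_norm_iff)
  have sq: "?a\<^sup>2 + o\<^sub>l\<^sup>2 = 1" "?b\<^sup>2 + o\<^sub>l\<^sup>2 = 1"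
    using norm_frame[of "fst l"] norm_frame[of "snd l"] on_circle im cmod_power2[of "frame l (fst l)"]
      cmod_power2[of "frame l (snd l)"] offset_frame by simp_all
  then have "?b\<^sup>2 = ?a\<^sup>2" by simp
  then have "?b = - ?a" using re by (auto simp: power2_eq_iff)
  then have a: "?a < 0" "?b > 0" using re by auto
  then have "?a\<^sup>2 > 0" by simp
  then have "o\<^sub>l\<^sup>2 < 1" using sq by linarith
  then show "\<bar>o\<^sub>l\<bar> < 1" by (simp add: abs_square_less_1)
  have "sqrt (1 - o\<^sub>l\<^sup>2) = \<bar>?a\<bar>" "sqrt (1 - o\<^sub>l\<^sup>2) = \<bar>?b\<bar>"
    using sq by (metis add_diff_cancel_right' real_sqrt_abs)+
  then show "frame l (fst l) = Complex (- sqrt (1 - o\<^sub>l\<^sup>2)) o\<^sub>l" "frame l (snd l) = Complex (sqrt (1 - o\<^sub>l\<^sup>2)) o\<^sub>l"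
    using a im offset_frame by (auto simp: complex_eq_iff)
qed

lemma strip_ends: "strip_point l (-1) 0 = fst l" "strip_point l 1 0 = snd l"
  using u_frame[of "fst l"] u_frame[of "snd l"] by (simp_all add: strip_point_eq frame_ends(1,2))

lemma side_zero_strip:
  assumes "side l x = 0" "cmod x \<le> 1"
  obtains \<tau> where "\<tau> \<in> {-1..1}" "x = strip_point l \<tau> 0"
proof -
  define s where "s = sqrt (1 - o\<^sub>l\<^sup>2)"
  have s: "s > 0" "s\<^sup>2 = 1 - o\<^sub>l\<^sup>2" using frame_ends(3) by (auto simp: s_def abs_square_less_1 less_imp_le)
  have im: "Im (frame l x) = o\<^sub>l" using assms by (simp add: side_def)
  have "(Re (frame l x))\<^sup>2 + o\<^sub>l\<^sup>2 \<le> 1"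
    using norm_frame[of x] assms(2) im cmod_power2[of "frame l x"] by (metis abs_norm_cancel abs_square_le_1)
  then have "(Re (frame l x))\<^sup>2 \<le> s\<^sup>2" using s by simp
  then have "\<bar>Re (frame l x)\<bar> \<le> s" using s(1) by (simp add: abs_le_square_iff[symmetric])
  moreover have "x = strip_point l (Re (frame l x) / s) 0"
    using u_frame[of x] im s(1) unfolding strip_point_eq s_def[symmetric]
    by (metis Complex_eq add_0_right complex_surj s_def nonzero_mult_div_cancel_left times_divide_eq_right less_irrefl)
  ultimately show thesis using that[of "Re (frame l x) / s"] s(1) by (auto simp: divide_le_eq le_divide_eq abs_le_iff)
qed

lemma circle_strip:
  assumes "cmod (strip_point l \<tau> 0) = 1" shows "strip_point l \<tau> 0 \<in> {fst l, snd l}"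
proof -
  have "(1 - o\<^sub>l\<^sup>2) * (1 - \<tau>\<^sup>2) = 0" using norm_strip[of 0 \<tau>] assms frame_ends(3) by simp
  moreover have "o\<^sub>l\<^sup>2 < 1" using frame_ends(3) by (simp add: abs_square_less_1)
  ultimately have "\<tau> = 1 \<or> \<tau> = -1" by (auto simp: power2_eq_1_iff)
  then show ?thesis using strip_ends by auto
qed

lemma side_zero_circle:
  assumes "side l x = 0" "cmod x = 1" shows "x \<in> {fst l, snd l}"
  using side_zero_strip[OF assms(1)] circle_strip assms(2) by (metis order_refl)

text \<open>A zero has height 0, where the cut-off is inactive, so the imaginary part forces
  \<open>side\<close> to vanish as well. The point is then on the disk or on the paraboloid over the
  chord.\<close>

lemma link_map_zero:
  assumes c: "c > 0" and L: "L > 0" and 0: "link_map L c l p = 0"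
  shows "p \<in> disk \<or> (\<exists>\<tau>\<in>{-1..1}. p = band_point c l \<tau> 0)"
proof -
  obtain x z where p: "p = (x, z)" by force
  have "max (link_height c p) (- L) = 0" using 0 by (simp add: link_map_def complex_eq_iff)
  then have h: "link_height c p = 0" using L by (auto simp: max_def split: if_splits)
  then have side: "side l x = 0" using 0 L by (simp add: link_map_def complex_eq_iff p)
  have cases: "z = 0 \<and> c * (1 - (cmod x)\<^sup>2) \<ge> 0 \<or> z \<ge> 0 \<and> z = c * (1 - (cmod x)\<^sup>2)"
    using h by (auto simp: link_height_def p min_def split: if_splits)
  then have "(cmod x)\<^sup>2 \<le> 1" using c by (auto simp: zero_le_mult_iff)
  then have x: "cmod x \<le> 1" by (simp add: abs_square_le_1)
  show ?thesis
  proof (cases "z = 0")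
    case True then show ?thesis using x by (simp add: p disk_def)
  next
    case False
    obtain \<tau> where "\<tau> \<in> {-1..1}" "x = strip_point l \<tau> 0" using side_zero_strip[OF side x] .
    then show ?thesis using cases False by (auto simp: p band_point_def Let_def)
  qed
qed

end

text \<open>For \<open>t = 0\<close> this is \<open>chord_loop\<close>; otherwise it is a parallel copy running at distance \<open>t\<close> in the surface.\<close>

definition par_loop :: "real \<Rightarrow> chord \<Rightarrow> real \<Rightarrow> real \<Rightarrow> space3" where
  "par_loop c l t s = (if s \<le> 1/2 then (strip_point l (4 * s - 1) t, 0) else band_point c l (3 - 4 * s) t)"

context unit_chord
begin

lemma linepath_strip: "linepath (fst l) (snd l) r = strip_point l (2 * r - 1) 0"
  unfolding linepath_def strip_ends[symmetric] strip_point_def by (simp add: algebra_simps scaleR_conv_of_real)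

end

lemma continuous_strip_point [continuous_intros]:
  "continuous_on A f \<Longrightarrow> continuous_on A g \<Longrightarrow> continuous_on A (\<lambda>x. strip_point l (f x) (g x))"
  unfolding strip_point_def by (intro continuous_intros)

lemma continuous_band_point [continuous_intros]:
  fixes A :: "'a::t2_space set"
  shows "continuous_on A f \<Longrightarrow> continuous_on A g \<Longrightarrow> continuous_on A (\<lambda>x. band_point c l (f x) (g x))"
  unfolding band_point_def Let_def by (intro continuous_intros continuous_on_cos continuous_on_sin)

lemma band_point_core: "band_point c l \<tau> 0 = (strip_point l \<tau> 0, c * (1 - (cmod (strip_point l \<tau> 0))\<^sup>2))"
  by (simp add: band_point_def Let_def)

text \<open>Origin of the coefficients in \<open>par_loop\<close>: \<open>joinpaths\<close> runs
  each half at double speed, the parameter \<open>r\<close> on the chord has strip coordinate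
  \<open>2 * r - 1\<close>, and the core is traversed backwards.\<close>

lemma chord_loop_par_loop:
  assumes "unit_chord (ls ! j)"
  shows "chord_loop ls j s = par_loop (real (Suc j)) (ls ! j) 0 s"
proof -
  interpret unit_chord "ls ! j" by fact
  have "linepath (fst (ls ! j), 0::real) (snd (ls ! j), 0) r = (linepath (fst (ls ! j)) (snd (ls ! j)) r, 0)" for r
    by (simp add: linepath_def)
  then show ?thesis
    by (simp add: chord_loop_def joinpaths_def par_loop_def linepath_strip reversepath_def core_path_def algebra_simps)
qed

context unit_chord
begin

lemma band_point_ends:
  assumes "\<bar>o\<^sub>l + t\<bar> \<le> 1"
  shows "band_point c l 1 t = (strip_point l 1 t, 0)" "band_point c l (-1) t = (strip_point l (-1) t, 0)"
  using norm_strip[OF assms, of 1] norm_strip[OF assms, of "-1"] by (simp_all add: band_point_def)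

lemma continuous_par_loop:
  assumes "continuous_on A f" "continuous_on A g" "\<And>x. x \<in> A \<Longrightarrow> \<bar>o\<^sub>l + f x\<bar> \<le> 1"
  shows "continuous_on (A :: 'a::t2_space set) (\<lambda>x. par_loop c l (f x) (g x))"
  unfolding par_loop_def
proof (rule continuous_on_cases_le)
  show "continuous_on {x \<in> A. g x \<le> 1/2} (\<lambda>x. (strip_point l (4 * g x - 1) (f x), 0::real))"
    by (intro continuous_intros continuous_on_subset[OF assms(1)] continuous_on_subset[OF assms(2)]) auto
  show "continuous_on {x \<in> A. 1/2 \<le> g x} (\<lambda>x. band_point c l (3 - 4 * g x) (f x))"
    by (intro continuous_intros continuous_on_subset[OF assms(1)] continuous_on_subset[OF assms(2)]) auto
  show "(strip_point l (4 * g x - 1) (f x), 0) = band_point c l (3 - 4 * g x) (f x)" if "x \<in> A" "g x = 1/2" for x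
    unfolding that(2) using band_point_ends(1)[OF assms(3)[OF that(1)]] by simp
qed fact

lemma par_loop_closed: "\<bar>o\<^sub>l + t\<bar> \<le> 1 \<Longrightarrow> par_loop c l t 0 = par_loop c l t 1"
  using band_point_ends(2) by (simp add: par_loop_def)

lemma norm_strip_le:
  assumes "\<bar>o\<^sub>l + y\<bar> \<le> 1" "\<tau> \<in> {-1..1}" shows "1 - (cmod (strip_point l \<tau> y))\<^sup>2 \<ge> 0"
proof -
  have "\<bar>\<tau>\<bar> \<le> 1" using assms(2) by auto
  then have "(o\<^sub>l + y)\<^sup>2 \<le> 1" "\<tau>\<^sup>2 \<le> 1" using assms(1) by (simp_all add: abs_square_le_1)
  then show ?thesis unfolding norm_strip[OF assms(1)] by simp
qed

text \<open>The image is compared with \<open>i * t * L * exp (i * \<phi>)\<close>, whose angle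
  rests at \<open>2 * pi\<close> along the chord and returns to 0 through the twisted band; this
  full turn is the \<open>-1\<close>. At every time both values lie in a common open half-plane. The
  last bound on \<open>t\<close> keeps the copy above the disk where it passes vertically below the
  core.\<close>

lemma par_loop_winding:
  assumes c: "c > 0" and t: "0 < t" "t < L" "\<bar>o\<^sub>l\<bar> + t \<le> 1" "t < c * (1 - o\<^sub>l\<^sup>2) / pi"
  shows "winding_number (\<lambda>s. link_map L c l (par_loop c l t s)) 0 = - 1"
    and "\<And>s. s \<in> {0..1} \<Longrightarrow> link_map L c l (par_loop c l t s) \<noteq> 0"
proof -
  have L: "L > 0" using t by linarith
  have off: "\<bar>o\<^sub>l + t * a\<bar> \<le> 1" if "\<bar>a\<bar> \<le> 1" for a
  proof -
    have "\<bar>t * a\<bar> \<le> t" using that t by (simp add: abs_mult mult_left_le)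
    then show ?thesis using t by linarith
  qed
  have off1: "\<bar>o\<^sub>l + t\<bar> \<le> 1" using off[of 1] by simp
  \<comment> \<open>The maximum with \<open>1/2\<close> freezes the angle on the first half, where
    the loop stays in the disk.\<close>
  define \<phi> :: "real \<Rightarrow> real" where "\<phi> s = pi * (4 - 4 * max s (1/2))" for s
  define G where "G s = Complex (- (t * L * sin (\<phi> s))) (t * L * cos (\<phi> s))" for s
  let ?f = "\<lambda>s. link_map L c l (par_loop c l t s)"
  have q: "continuous_on {0..1} (\<lambda>s. Ln (\<i> * of_real (t * L)) + \<i> * of_real (\<phi> s))"
    unfolding \<phi>_def by (intro continuous_intros)
  have Gexp: "G s = exp (Ln (\<i> * of_real (t * L)) + \<i> * of_real (\<phi> s))" for s
    using t L by (simp add: exp_add G_def complex_eq_iff exp_Euler cos_of_real sin_of_real)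
  have seg: "0 \<notin> closed_segment (G s) (?f s)" if s: "s \<in> {0..1}" for s
  proof (cases "s \<le> 1/2")
    case True
    then have "G s = Complex 0 (t * L)" by (simp add: G_def \<phi>_def)
    moreover have "1 - (cmod (strip_point l (4 * s - 1) t))\<^sup>2 \<ge> 0"
      by (rule norm_strip_le[OF off1]) (use s True in auto)
    then have "link_height c (par_loop c l t s) = 0"
      using True c by (simp add: link_height_def par_loop_def min_def)
    then have "?f s = Complex 0 (t * L)" using True L by (simp add: link_map_def par_loop_def)
    ultimately show ?thesis using zero_notin_segment[of "- \<i>" "Complex 0 (t * L)" "Complex 0 (t * L)"] t L by simp
  next
    case False
    define \<tau> where "\<tau> = 3 - 4 * s"
    have \<tau>: "\<tau> \<in> {-1..1}" using s False by (auto simp: \<tau>_def)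
    define \<theta> where "\<theta> = pi * (\<tau> + 1)"
    have \<phi>\<theta>: "\<phi> s = \<theta>" using False by (simp add: \<phi>_def \<theta>_def \<tau>_def algebra_simps)
    define r where "r = 1 - (cmod (strip_point l \<tau> (t * cos \<theta>)))\<^sup>2"
    have r: "r \<ge> 0" unfolding r_def by (rule norm_strip_le[OF off \<tau>]) simp
    define H where "H = min (c * r + t * sin \<theta>) (- t * sin \<theta>)"
    have h: "link_height c (par_loop c l t s) = H"
      using False by (simp add: link_height_def par_loop_def band_point_def Let_def H_def r_def \<tau>_def \<theta>_def)
    have "c * r \<ge> 0" "t * sin \<theta> \<ge> - t" "- t * sin \<theta> \<ge> - t"
      using c r t mult_left_mono[of "-1" "sin \<theta>" t] mult_left_mono[of "sin \<theta>" 1 t] by simp_all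
    then have H: "H \<ge> - t" unfolding H_def by auto
    have side: "side l (fst (par_loop c l t s)) = t * cos \<theta>"
      using False by (simp add: par_loop_def band_point_def Let_def \<tau>_def \<theta>_def)
    have f: "?f s = Complex H (t * cos \<theta> * (L + H))"
      unfolding link_map_def h side using H t by simp
    have LH: "L + H > 0" using H t by linarith
    have G: "G s = Complex (- (t * L * sin \<theta>)) (t * L * cos \<theta>)" by (simp add: G_def \<phi>\<theta>)
    have unit: "cos \<theta> = 0 \<Longrightarrow> sin \<theta> = 1 \<or> sin \<theta> = -1"
      using sin_cos_squared_add[of \<theta>] by (simp add: power2_eq_1_iff)
    consider "cos \<theta> > 0" | "cos \<theta> < 0" | "cos \<theta> = 0" "sin \<theta> = 1" | "cos \<theta> = 0" "sin \<theta> = -1"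
      using unit by (meson linorder_cases)
    then show ?thesis
    proof cases
      case 1
      then show ?thesis unfolding f G using t L LH by (intro zero_notin_segment[of "- \<i>"]) simp_all
    next
      case 2
      then have "t * L * cos \<theta> < 0" "t * cos \<theta> * (L + H) < 0" using t L LH by (simp_all add: mult_pos_neg mult_neg_pos)
      then show ?thesis unfolding f G by (intro zero_notin_segment[of \<i>]) simp_all
    next
      case 3
      then have "H < 0" using t by (simp add: H_def)
      then show ?thesis unfolding f G using 3 t L by (intro zero_notin_segment[of "-1"]) simp_all
    next
      case 4
      \<comment> \<open>Here \<open>\<tau>\<close> is in fact \<open>1/2\<close>, but a lower bound
        for \<open>1 - \<tau>^2\<close> suffices; it comes from \<open>sin x <= x\<close> at
        \<open>x = pi - pi * \<tau>\<close>.\<close>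
      have sp: "sin (pi * \<tau>) = 1" using 4(2) by (simp add: \<theta>_def distrib_left)
      have "\<tau> > 0"
      proof (rule ccontr)
        assume "\<not> \<tau> > 0"
        then have "0 \<le> pi * (- \<tau>)" "pi * (- \<tau>) \<le> pi" using \<tau> mult_left_mono[of 0 "- \<tau>" pi] mult_left_mono[of "- \<tau>" 1 pi] by simp_all
        then have "sin (pi * (- \<tau>)) \<ge> 0" by (rule sin_ge_zero)
        then show False using sp by simp
      qed
      have "1 = sin (pi - pi * \<tau>)" using sp by simp
      also have "\<dots> \<le> pi - pi * \<tau>" using \<tau> by (intro sin_x_le_x) simp
      finally have "1 \<le> pi * (1 - \<tau>)" by (simp add: algebra_simps)
      also have "\<dots> \<le> pi * (1 - \<tau>) * (1 + \<tau>)"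
        using mult_left_mono[of 1 "1 + \<tau>" "pi * (1 - \<tau>)"] \<open>\<tau> > 0\<close> \<tau> by (simp add: mult_nonneg_nonneg)
      also have "\<dots> = pi * (1 - \<tau>\<^sup>2)" by (simp add: power2_eq_square algebra_simps)
      finally have "1 / pi \<le> 1 - \<tau>\<^sup>2" by (simp add: divide_le_eq mult.commute)
      moreover have "r = (1 - o\<^sub>l\<^sup>2) * (1 - \<tau>\<^sup>2)"
        unfolding r_def using norm_strip[of 0 \<tau>] frame_ends(3) 4 by simp
      moreover have "1 - o\<^sub>l\<^sup>2 > 0" using frame_ends(3) by (simp add: abs_square_less_1)
      ultimately have "r \<ge> (1 - o\<^sub>l\<^sup>2) * (1 / pi)"
        using mult_left_mono[of "1 / pi" "1 - \<tau>\<^sup>2" "1 - o\<^sub>l\<^sup>2"] by linarith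
      then have "c * r \<ge> c * ((1 - o\<^sub>l\<^sup>2) * (1 / pi))" using c by (intro mult_left_mono) auto
      moreover have "c * ((1 - o\<^sub>l\<^sup>2) * (1 / pi)) = c * (1 - o\<^sub>l\<^sup>2) / pi" by simp
      ultimately have "c * r > t" using t(4) by linarith
      then have "H > 0" using 4 t by (simp add: H_def)
      then show ?thesis unfolding f G using 4 t L by (intro zero_notin_segment[of 1]) simp_all
    qed
  qed
  have "winding_number G 0 = - 1"
    using winding_number_log[OF q Gexp] by (simp add: \<phi>_def)
  moreover have "winding_number ?f 0 = winding_number G 0"
  proof (rule winding_number_loops_linear_eq[OF _ _ _ _ seg])
    show "path G" unfolding path_def Gexp by (intro continuous_intros q)
    show "path ?f" unfolding path_def
      by (intro continuous_intros continuous_par_loop) (use off1 in auto)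
    show "pathfinish G = pathstart G" by (simp add: pathfinish_def pathstart_def G_def \<phi>_def)
    show "pathfinish ?f = pathstart ?f" using par_loop_closed[OF off1] by (simp add: pathfinish_def pathstart_def)
  qed
  ultimately show "winding_number ?f 0 = - 1" by simp
  show "?f s \<noteq> 0" if "s \<in> {0..1}" for s using seg[OF that] ends_in_segment(2) by metis
qed

end

section \<open>Push-offs of the chord loops\<close>

text \<open>A Lebesgue number argument: finitely many balls of local radii cover \<open>K\<close>,
  and \<open>Q\<close> survives passing to the least radius.\<close>

lemma compact_uniform:
  fixes K :: "'a::metric_space set"
  assumes K: "compact K" and anti: "\<And>y d d'. Q y d \<Longrightarrow> d' \<le> d \<Longrightarrow> Q y d'"
    and loc: "\<And>x. x \<in> K \<Longrightarrow> \<exists>d>0. \<forall>y\<in>K. dist x y < d \<longrightarrow> Q y d"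
  shows "\<exists>d>0. \<forall>y\<in>K. Q y (d::real)"
proof -
  obtain d where d: "\<And>x. x \<in> K \<Longrightarrow> d x > 0" "\<And>x y. x \<in> K \<Longrightarrow> y \<in> K \<Longrightarrow> dist x y < d x \<Longrightarrow> Q y (d x)"
    using loc by metis
  have "K \<subseteq> (\<Union>x\<in>K. ball x (d x))" using d(1) by force
  then obtain C where C: "C \<subseteq> K" "finite C" "K \<subseteq> (\<Union>x\<in>C. ball x (d x))"
    using compactE_image[OF K, of K "\<lambda>x. ball x (d x)"] by auto
  define m where "m = Min (insert 1 (d ` C))"
  have "m > 0" unfolding m_def using C d(1) by auto
  moreover have "Q y m" if y: "y \<in> K" for y
  proof -
    obtain x where x: "x \<in> C" "y \<in> ball x (d x)" using C(3) y by blast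
    then have "Q y (d x)" using d(2)[of x y] C(1) y by auto
    moreover have "m \<le> d x" unfolding m_def using x C(2) by auto
    ultimately show ?thesis using anti by blast
  qed
  ultimately show ?thesis by blast
qed

locale collared_surface =
  fixes ls :: "chord list" and \<epsilon> :: real and \<Phi> :: "space3 \<Rightarrow> real \<Rightarrow> space3"
  assumes system: "chord_system ls" and width: "band_width ls \<epsilon>"
    and collar: "bicollar (chord_surface ls \<epsilon>) \<Phi>"
begin

abbreviation "S \<equiv> chord_surface ls \<epsilon>"
abbreviation "n \<equiv> length ls"

abbreviation \<gamma> :: "nat \<Rightarrow> real \<Rightarrow> real \<Rightarrow> space3" where
  "\<gamma> i \<equiv> par_loop (real (Suc i)) (ls ! i)"

text \<open>The cut-off \<open>n + 1\<close> exceeds the coefficients of all the paraboloids, so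
  that it is not active on the chord loops.\<close>

abbreviation F :: "nat \<Rightarrow> space3 \<Rightarrow> complex" where
  "F i \<equiv> link_map (real n + 1) (real (Suc i)) (ls ! i)"

lemma unit_chord: "i < n \<Longrightarrow> unit_chord (ls ! i)"
proof
  assume i: "i < n"
  then have "(fst (ls ! i), snd (ls ! i)) \<in> set ls" by simp
  then show "cmod (fst (ls ! i)) = 1" "cmod (snd (ls ! i)) = 1"
    using system unfolding chord_system_def by fastforce+
  have "fst (ls ! i) \<in> set (map fst ls)" "snd (ls ! i) \<in> set (map snd ls)" using i by auto
  then show "fst (ls ! i) \<noteq> snd (ls ! i)" using system unfolding chord_system_def
    by (metis disjoint_iff distinct_append)
qed

lemma ends_disjoint:
  assumes "i < n" "j < n" "i \<noteq> j"
  shows "{fst (ls ! i), snd (ls ! i)} \<inter> {fst (ls ! j), snd (ls ! j)} = {}"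
proof -
  have d: "distinct (map fst ls)" "distinct (map snd ls)" "set (map fst ls) \<inter> set (map snd ls) = {}"
    using system unfolding chord_system_def by auto
  have "fst (ls ! i) \<noteq> fst (ls ! j)" "snd (ls ! i) \<noteq> snd (ls ! j)"
    using d(1,2) assms by (auto simp: distinct_conv_nth)
  moreover have "fst (ls ! a) \<noteq> snd (ls ! b)" if "a < n" "b < n" for a b
  proof -
    have "fst (ls ! a) \<in> set (map fst ls)" "snd (ls ! b) \<in> set (map snd ls)" using that by auto
    then show ?thesis using d(3) by (metis disjoint_iff)
  qed
  ultimately show ?thesis using assms by auto
qed

lemma eps: "\<epsilon> > 0" "i < n \<Longrightarrow> \<bar>chord_offset (ls ! i)\<bar> + \<epsilon> < 1"
  using width by (auto simp: band_width_def)

lemma offset_le: "i < n \<Longrightarrow> t \<in> {-\<epsilon>..\<epsilon>} \<Longrightarrow> \<bar>chord_offset (ls ! i) + t\<bar> \<le> 1"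
  using eps(2)[of i] by (auto simp: abs_le_iff abs_if split: if_splits)

lemma loop_in_surface: "i < n \<Longrightarrow> t \<in> {-\<epsilon>..\<epsilon>} \<Longrightarrow> s \<in> {0..1} \<Longrightarrow> \<gamma> i t s \<in> S"
proof -
  assume a: "i < n" "t \<in> {-\<epsilon>..\<epsilon>}" "s \<in> {0..1}"
  interpret unit_chord "ls ! i" by (rule unit_chord[OF a(1)])
  show ?thesis
  proof (cases "s \<le> 1/2")
    case True
    then have "1 - (cmod (strip_point (ls ! i) (4 * s - 1) t))\<^sup>2 \<ge> 0"
      using a offset_le by (intro norm_strip_le) auto
    then have "cmod (strip_point (ls ! i) (4 * s - 1) t) \<le> 1" by (simp add: abs_square_le_1)
    then show ?thesis using True by (simp add: par_loop_def chord_surface_def disk_def)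
  next
    case False
    then have "\<gamma> i t s \<in> band ls \<epsilon> i" unfolding par_loop_def band_def using a(2,3) by auto
    then show ?thesis using a(1) by (auto simp: chord_surface_def)
  qed
qed

lemma continuous_loop: "i < n \<Longrightarrow> t \<in> {-\<epsilon>..\<epsilon>} \<Longrightarrow> continuous_on {0..1} (\<gamma> i t)"
  by (intro unit_chord.continuous_par_loop[OF unit_chord] continuous_intros) (auto intro: offset_le)

lemma loop_closed: "i < n \<Longrightarrow> t \<in> {-\<epsilon>..\<epsilon>} \<Longrightarrow> \<gamma> i t 0 = \<gamma> i t 1"
  by (intro unit_chord.par_loop_closed unit_chord offset_le)

lemma link_map_zero_surface:
  assumes "i < n" "F i p = 0" shows "p \<in> S"
proof -
  interpret unit_chord "ls ! i" by (rule unit_chord[OF assms(1)])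
  have "p \<in> disk \<or> (\<exists>\<tau>\<in>{-1..1}. p = band_point (real (Suc i)) (ls ! i) \<tau> 0)"
    by (rule link_map_zero) (use assms in auto)
  then show ?thesis
  proof
    assume "\<exists>\<tau>\<in>{-1..1}. p = band_point (real (Suc i)) (ls ! i) \<tau> 0"
    then obtain \<tau> where "\<tau> \<in> {-1..1}" "p = band_point (real (Suc i)) (ls ! i) \<tau> 0" by blast
    then have "p \<in> band ls \<epsilon> i" unfolding band_def using eps(1) by (intro image_eqI[of _ _ "(\<tau>, 0)"]) auto
    then show ?thesis using assms(1) by (auto simp: chord_surface_def)
  qed (simp add: chord_surface_def)
qed

lemma continuous_collar:
  assumes "continuous_on X f" "continuous_on X g" "\<And>x. x \<in> X \<Longrightarrow> f x \<in> S" "\<And>x. x \<in> X \<Longrightarrow> g x \<in> {-1..1}"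
  shows "continuous_on X (\<lambda>x. \<Phi> (f x) (g x))"
proof -
  have c: "continuous_on (S \<times> {-1..1}) (\<lambda>(x, t). \<Phi> x t)" using collar by (simp add: bicollar_def)
  have "continuous_on X (\<lambda>x. (\<lambda>(x, t). \<Phi> x t) (f x, g x))"
    by (rule continuous_on_compose2[OF c]) (use assms in \<open>auto intro!: continuous_intros\<close>)
  then show ?thesis by simp
qed

lemma pushoff_nonzero: "i < n \<Longrightarrow> x \<in> S \<Longrightarrow> t \<in> {-1..1} \<Longrightarrow> t \<noteq> 0 \<Longrightarrow> F i (\<Phi> x t) \<noteq> 0"
  using link_map_zero_surface pushoff_in_complement[OF collar] by blast

lemma collar_zero: "x \<in> S \<Longrightarrow> \<Phi> x 0 = x"
  using collar by (simp add: bicollar_def)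

text \<open>Sliding along the collar from level \<open>e\<close> to level \<open>e * t\<close>
  avoids the surface, and thus the zeros of \<open>F i\<close>, except at the end if
  \<open>t = 0\<close>; that case is what \<open>ne\<close> covers.\<close>

lemma winding_pushoff_retract:
  assumes i: "i < n" and g: "continuous_on {0..1} g" "g 0 = g 1" "\<And>s. s \<in> {0..1} \<Longrightarrow> g s \<in> S"
    and e: "e \<in> {1, -1}" and t: "0 \<le> t" "t \<le> 1"
    and ne: "t > 0 \<or> (\<forall>s\<in>{0..1}. F i (g s) \<noteq> 0)"
  shows "winding_number (\<lambda>s. F i (\<Phi> (g s) e)) 0 = winding_number (\<lambda>s. F i (\<Phi> (g s) (e * t))) 0"
proof -
  define H where "H = (\<lambda>(u, s). F i (\<Phi> (g s) (e * (1 - u + u * t))))"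
  have range: "0 \<le> 1 - u + u * t \<and> 1 - u + u * t \<le> 1" if u: "u \<in> {0..1}" for u
  proof -
    have "0 \<le> u * (1 - t)" "u * (1 - t) \<le> 1" using u t by (simp_all add: mult_le_one)
    moreover have "1 - u + u * t = 1 - u * (1 - t)" by (simp add: algebra_simps)
    ultimately show ?thesis by linarith
  qed
  have range': "e * (1 - u + u * t) \<in> {-1..1}" if "u \<in> {0..1}" for u
  proof -
    have "e * x \<in> {-1..1}" if "0 \<le> x \<and> x \<le> 1" for x using e that by auto
    then show ?thesis using range[OF that] by blast
  qed
  have "winding_number (\<lambda>s. H (0, s)) 0 = winding_number (\<lambda>s. H (1, s)) 0"
  proof (rule winding_number_homotopy)
    have "continuous_on ({0..1} \<times> {0..1}) (\<lambda>x. g (snd x))"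
      by (rule continuous_on_compose2[OF g(1)]) (auto intro!: continuous_intros)
    then show "continuous_on ({0..1} \<times> {0..1}) H" unfolding H_def case_prod_unfold
      by (intro continuous_intros continuous_collar) (use g range' in auto)
    fix u s :: real assume us: "u \<in> {0..1}" "s \<in> {0..1}"
    show "H (u, s) \<noteq> 0"
    proof (cases "e * (1 - u + u * t) = 0")
      case False
      then show ?thesis unfolding H_def using pushoff_nonzero[OF i g(3)[OF us(2)] range'[OF us(1)]] by simp
    next
      case True
      then have "(1 - u) + u * t = 0" using e by auto
      moreover have "1 - u \<ge> 0" "u * t \<ge> 0" using us t by auto
      ultimately have "1 - u = 0" "u * t = 0" by linarith+
      then have "u = 1" "t = 0" by auto
      then show ?thesis using ne us g(3)[OF us(2)] by (simp add: H_def collar_zero)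
    qed
  next
    show "H (u, 0) = H (u, 1)" for u using g(2) by (simp add: H_def)
  qed
  then show ?thesis by (simp add: H_def)
qed

text \<open>Unlike the loop itself, its parallel copy is disjoint from the zero set of \<open>F i\<close>, so that its push-off can
  be retracted into the surface; which side it was pushed to is irrelevant.\<close>

lemma winding_pushoff_self:
  assumes i: "i < n" and e: "e \<in> {1, -1}"
  shows "winding_number (\<lambda>s. F i (\<Phi> (\<gamma> i 0 s) e)) 0 = - 1"
proof -
  interpret unit_chord "ls ! i" by (rule unit_chord[OF i])
  let ?c = "real (Suc i)"
  have "1 - o\<^sub>l\<^sup>2 > 0" using frame_ends(3) by (simp add: abs_square_less_1)
  then have "0 < min \<epsilon> (min (real n + 1) (?c * (1 - o\<^sub>l\<^sup>2) / pi))" using eps(1) by simp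
  then obtain m where "0 < m" "m < min \<epsilon> (min (real n + 1) (?c * (1 - o\<^sub>l\<^sup>2) / pi))" using dense by blast
  then have m: "0 < m" "m < \<epsilon>" "m < real n + 1" "m < ?c * (1 - o\<^sub>l\<^sup>2) / pi" by simp_all
  have loop: "winding_number (\<lambda>s. F i (\<gamma> i m s)) 0 = - 1" "\<And>s. s \<in> {0..1} \<Longrightarrow> F i (\<gamma> i m s) \<noteq> 0"
    by (rule par_loop_winding; use m eps(2)[OF i] in auto)+
  have m_in: "m \<in> {-\<epsilon>..\<epsilon>}" using m by auto
  have um: "u * m \<in> {-\<epsilon>..\<epsilon>}" if "u \<in> {0..1}" for u
  proof -
    have "0 \<le> u * m" "u * m \<le> m" using that m by (auto simp: mult_left_le_one_le)
    then show ?thesis using m unfolding atLeastAtMost_iff by linarith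
  qed
  \<comment> \<open>This homotopy keeps the level \<open>e\<close> and slides the loop sideways to
    its parallel copy; only afterwards is the level lowered to 0.\<close>
  define H where "H = (\<lambda>(u, s). F i (\<Phi> (\<gamma> i (u * m) s) e))"
  have "winding_number (\<lambda>s. H (0, s)) 0 = winding_number (\<lambda>s. H (1, s)) 0"
  proof (rule winding_number_homotopy)
    have "continuous_on ({0..1} \<times> {0..1}) (\<lambda>x. \<gamma> i (fst x * m) (snd x))"
      by (intro continuous_par_loop continuous_intros) (use um offset_le[OF i] in auto)
    then show "continuous_on ({0..1} \<times> {0..1}) H" unfolding H_def case_prod_unfold
      by (intro continuous_intros continuous_collar) (use loop_in_surface[OF i um] e in auto)
    fix u s :: real assume us: "u \<in> {0..1}" "s \<in> {0..1}"
    show "H (u, s) \<noteq> 0" unfolding H_def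
      using pushoff_nonzero[OF i loop_in_surface[OF i um[OF us(1)] us(2)], of e] e by auto
  next
    show "H (u, 0) = H (u, 1)" if "u \<in> {0..1}" for u using loop_closed[OF i um[OF that]] by (simp add: H_def)
  qed
  then have "winding_number (\<lambda>s. F i (\<Phi> (\<gamma> i 0 s) e)) 0 = winding_number (\<lambda>s. F i (\<Phi> (\<gamma> i m s) e)) 0"
    by (simp add: H_def)
  also have "\<dots> = winding_number (\<lambda>s. F i (\<Phi> (\<gamma> i m s) (e * 0))) 0"
  proof (rule winding_pushoff_retract[OF i continuous_loop[OF i m_in] loop_closed[OF i m_in] loop_in_surface[OF i m_in] e])
    show "0 < (0::real) \<or> (\<forall>s\<in>{0..1}. F i (\<gamma> i m s) \<noteq> 0)"
      using loop(2) by blast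
  qed auto
  also have "\<dots> = winding_number (\<lambda>s. F i (\<gamma> i m s)) 0"
    by (rule winding_number_cong) (use collar_zero loop_in_surface[OF i m_in] in auto)
  finally show ?thesis using loop by simp
qed

end

declare of_nat_Suc [simp del]

lemma continuous_on_near:
  fixes f :: "'a::metric_space \<Rightarrow> 'b::metric_space"
  assumes "continuous_on A f" "a \<in> A" "m > 0"
  obtains d where "d > 0" "\<And>x. x \<in> A \<Longrightarrow> dist x a < d \<Longrightarrow> dist (f x) (f a) < m"
  using assms unfolding continuous_on_iff by blast

section \<open>The side to which a push-off leaves the disk\<close>

context collared_surface
begin

lemma surface_flat_near_disk_point:
  assumes q: "cmod q < 1"
  obtains r where "r > 0" "\<And>p. p \<in> S \<Longrightarrow> dist (q, 0) p < r \<Longrightarrow> snd p = 0"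
proof -
  let ?B = "\<Union>i<n. band ls \<epsilon> i"
  have "compact (band ls \<epsilon> i)" for i
    unfolding band_def case_prod_unfold
    by (intro compact_continuous_image continuous_intros compact_Times compact_Icc)
  then have "closed ?B" by (intro compact_imp_closed compact_UN) auto
  moreover have "(q, 0) \<notin> ?B"
  proof
    assume "(q, 0) \<in> ?B"
    then obtain i where i: "i < n" "(q, 0) \<in> band ls \<epsilon> i" by blast
    moreover have "(q, 0) \<in> disk" using q by (simp add: disk_def)
    ultimately have "(q, 0) \<in> sphere 0 1 \<times> {0::real}" using width unfolding band_width_def by blast
    then show False using q by simp
  qed
  ultimately obtain r where r: "r > 0" "\<And>p. p \<in> ?B \<Longrightarrow> r \<le> dist (q, 0) p"
    using separate_point_closed[of ?B "(q, 0)"] by blast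
  show thesis
  proof (rule that[OF r(1)])
    fix p assume p: "p \<in> S" "dist (q, 0) p < r"
    then have "p \<in> disk" using r(2)[of p] unfolding chord_surface_def by fastforce
    then show "snd p = 0" by (auto simp: disk_def)
  qed
qed

text \<open>A bicollar fixes the sides only for times that depend on the point; here the time is
  uniform near \<open>q\<close>. The third coordinate of a push-off near \<open>q\<close> cannot
  vanish, since the point would lie in the disk. On the connected set of nearby points and times its
  sign is therefore constant, and it is known at \<open>q\<close>.\<close>

lemma pushoff_side:
  assumes q: "cmod q < 1" and W: "open W" "(q, 0) \<in> W" and e: "e \<in> {1, -1}"
  obtains d where "d > 0" "\<And>x t. dist q x < d \<Longrightarrow> 0 < t \<Longrightarrow> t < d \<Longrightarrow>
    e * snd (\<Phi> (x, 0) (e * t)) < 0 \<and> \<Phi> (x, 0) (e * t) \<in> W"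
proof -
  obtain r where r: "r > 0" "\<And>p. p \<in> S \<Longrightarrow> dist (q, 0) p < r \<Longrightarrow> snd p = 0"
    using surface_flat_near_disk_point[OF q] by blast
  obtain w where "w > 0" "ball (q, 0) w \<subseteq> W" using openE[OF W] by blast
  then have w: "w > 0" "\<And>p. dist (q, 0) p < w \<Longrightarrow> p \<in> W" by auto
  define m where "m = min w (1 - cmod q)"
  have m: "m > 0" using w q by (simp add: m_def)
  have disk_S: "(x, 0) \<in> S" if "cmod x \<le> 1" for x using that by (simp add: chord_surface_def disk_def)
  have "continuous_on (S \<times> {-1..1}) (\<lambda>(x, t). \<Phi> x t)" using collar by (simp add: bicollar_def)
  moreover have "((q, 0), 0::real) \<in> S \<times> {-1..1}" using disk_S q by simp
  ultimately obtain d0 where d0: "d0 > 0"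
    "\<And>y. y \<in> S \<times> {-1..1} \<Longrightarrow> dist y ((q, 0), 0) < d0 \<Longrightarrow>
      dist (case y of (x, t) \<Rightarrow> \<Phi> x t) (case ((q, 0), 0) of (x, t) \<Rightarrow> \<Phi> x t) < m"
    using m by (rule continuous_on_near) blast
  define d where "d = min (d0 / 2) (min (1 - cmod q) 1)"
  have d: "d > 0" using d0 q by (simp add: d_def)
  have near: "cmod x < 1 \<and> dist (q, 0) (\<Phi> (x, 0) t) < m" if x: "dist q x < d" and t: "\<bar>t\<bar> < d" for x t
  proof -
    have "cmod x \<le> cmod q + dist q x" using norm_triangle_ineq[of q "x - q"] by (simp add: dist_norm norm_minus_commute)
    then have x1: "cmod x < 1" using x by (simp add: d_def)
    have t1: "-1 \<le> t \<and> t \<le> 1" using t unfolding d_def by linarith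
    have "dist ((x, 0::real), t) ((q, 0), 0) \<le> dist x q + \<bar>t\<bar>"
      unfolding dist_Pair_Pair using sqrt_sum_squares_le_sum[of "dist x q" "\<bar>t\<bar>"] by (simp add: dist_real_def)
    also have "\<dots> < d0" using x t by (simp add: d_def dist_commute)
    finally have "dist (\<Phi> (x, 0) t) (\<Phi> (q, 0) 0) < m"
      using d0(2)[of "((x, 0), t)"] disk_S x1 t1 by simp
    then show ?thesis using x1 collar_zero[OF disk_S, of q] q by (simp add: dist_commute)
  qed
  define f where "f = (\<lambda>(x, t). e * snd (\<Phi> (x, 0) (e * t)))"
  let ?D = "ball q d \<times> {0<..<d}"
  have et: "\<bar>e * t\<bar> = \<bar>t\<bar>" for t using e by (auto simp: abs_mult)
  have in1: "e * t \<in> {-1..1}" if "t \<in> {0<..<d}" for t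
  proof -
    have "d \<le> 1" unfolding d_def by linarith
    then have "\<bar>e * t\<bar> \<le> 1" using that unfolding et by auto
    then show ?thesis by (simp add: abs_le_iff)
  qed
  have ne: "f y \<noteq> 0" if yD: "y \<in> ?D" for y
  proof
    assume "f y = 0"
    obtain x t where xt: "y = (x, t)" by (cases y)
    then have y: "y = (x, t)" "dist q x < d" "0 < t" "t < d" using yD by simp_all
    have z: "snd (\<Phi> (x, 0) (e * t)) = 0" using \<open>f y = 0\<close> e y by (auto simp: f_def)
    have nr: "cmod x < 1" "dist (q, 0) (\<Phi> (x, 0) (e * t)) < m" using near[of x "e * t"] y et[of t] by auto
    obtain x' where x': "\<Phi> (x, 0) (e * t) = (x', 0)" using z by (metis prod.collapse)
    have "cmod x' \<le> cmod q + dist q x'" using norm_triangle_ineq[of q "x' - q"] by (simp add: dist_norm norm_minus_commute)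
    also have "dist q x' = dist (q, 0::real) (x', 0)" by (simp add: dist_Pair_Pair)
    also have "cmod q + \<dots> < 1" using nr(2) x' by (simp add: m_def)
    finally have "\<Phi> (x, 0) (e * t) \<in> S" using x' disk_S by simp
    moreover have "e * t \<noteq> 0" using e y by auto
    ultimately show False using pushoff_in_complement[OF collar in1 _ disk_S, of t x] nr(1) y by auto
  qed
  have cont: "continuous_on ?D f" unfolding f_def case_prod_unfold
    by (intro continuous_intros continuous_collar) (use in1 near[of _ 0] d disk_S in \<open>auto simp: less_imp_le\<close>)
  have "connected ?D" by (intro convex_connected convex_Times convex_ball convex_real_interval)
  then have conn: "connected (f ` ?D)" by (intro connected_continuous_image cont)
  have "\<forall>\<^sub>F t in at_right 0. snd (\<Phi> (q, 0) t) < 0 \<and> snd (\<Phi> (q, 0) (- t)) > 0"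
    using collar q by (simp add: bicollar_def)
  then obtain b where b: "b > 0" "\<And>t. 0 < t \<Longrightarrow> t < b \<Longrightarrow> snd (\<Phi> (q, 0) t) < 0 \<and> snd (\<Phi> (q, 0) (- t)) > 0"
    unfolding eventually_at_right_field by blast
  obtain t0 where t0: "0 < t0" "t0 < min b d" using dense[of 0 "min b d"] b d by auto
  have neg: "f (q, t0) < 0" using b(2)[of t0] t0 e by (auto simp: f_def)
  have "f y < 0" if "y \<in> ?D" for y
  proof (rule ccontr)
    assume "\<not> f y < 0"
    then have "f (q, t0) \<le> 0" "0 \<le> f y" using neg by auto
    moreover have "f (q, t0) \<in> f ` ?D" "f y \<in> f ` ?D" using that t0 d by auto
    ultimately have "0 \<in> f ` ?D" using connectedD_interval[OF conn] by blast
    then show False using ne by auto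
  qed
  then have "e * snd (\<Phi> (x, 0) (e * t)) < 0" if "dist q x < d" "0 < t" "t < d" for x t
    using that by (force simp: f_def)
  moreover have "\<Phi> (x, 0) (e * t) \<in> W" if "dist q x < d" "0 < t" "t < d" for x t
    using near[of x "e * t"] that et[of t] w(2) by (auto simp: m_def)
  ultimately show thesis using that[OF d] by blast
qed

end

text \<open>Two chord loops meet at most in one point of the open disk.  There the push-off leaves the disk towards
  \<open>z < 0\<close> or \<open>z > 0\<close>, where \<open>F i\<close> has negative or positive real part, and the winding number is that of
  the loop \<open>F i \<circ> \<gamma> j 0\<close> around a small positive or negative number.\<close>

locale two_chords = collared_surface +
  fixes i j :: nat
  assumes ij: "i < n" "j < n" "i \<noteq> j"
begin

sublocale I: unit_chord "ls ! i" by (rule unit_chord[OF ij(1)])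
sublocale J: unit_chord "ls ! j" by (rule unit_chord[OF ij(2)])

abbreviation "ya \<equiv> side (ls ! i) (fst (ls ! j))"
abbreviation "yb \<equiv> side (ls ! i) (snd (ls ! j))"

definition loop_strip :: "real \<Rightarrow> complex" where
  "loop_strip s = strip_point (ls ! j) (if s \<le> 1/2 then 4 * s - 1 else 3 - 4 * s) 0"

text \<open>The height over the loop of the paraboloid with \<open>c = 1\<close>; the core of
  \<open>j\<close> and the paraboloid of \<open>i\<close> lie at multiples of it.\<close>

definition loop_gap :: "real \<Rightarrow> real" where
  "loop_gap s = 1 - (cmod (loop_strip s))\<^sup>2"

lemma fst_loop: "fst (\<gamma> j 0 s) = loop_strip s"
  by (simp add: par_loop_def loop_strip_def band_point_core)

lemma snd_loop: "snd (\<gamma> j 0 s) = (if s \<le> 1/2 then 0 else real (Suc j) * loop_gap s)"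
  by (simp add: par_loop_def loop_strip_def loop_gap_def band_point_core)

lemma loop_gap: "s \<in> {0..1} \<Longrightarrow> 0 \<le> loop_gap s \<and> loop_gap s \<le> 1"
  unfolding loop_gap_def loop_strip_def using J.norm_strip_le[of 0] J.frame_ends(3) by auto

lemma side_affine: "side (ls ! i) (strip_point (ls ! j) (2 * r - 1) 0) = (1 - r) * ya + r * yb"
  unfolding J.linepath_strip[symmetric] linepath_def side_def frame_def by (simp add: algebra_simps)

lemma side_ends: "ya \<noteq> 0" "yb \<noteq> 0"
  using I.side_zero_circle J.on_circle ends_disjoint[OF ij] by blast+

lemma circle_side:
  assumes "cmod (strip_point (ls ! j) \<tau> 0) = 1" shows "side (ls ! i) (strip_point (ls ! j) \<tau> 0) \<noteq> 0"
  using J.circle_strip[OF assms] side_ends by auto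

text \<open>On the core of band \<open>j\<close>, away from the circle, the height is positive for
  \<open>j < i\<close> and negative for \<open>j > i\<close>: this is how the stacking order of the
  bands enters.\<close>

lemma height_loop:
  assumes s: "s \<in> {0..1}"
  shows "link_height (real (Suc i)) (\<gamma> j 0 s) =
    (if s \<le> 1/2 then 0 else min (real (Suc j)) (real (Suc i) - real (Suc j)) * loop_gap s)"
proof -
  have r: "0 \<le> loop_gap s" using loop_gap[OF s] by simp
  have "link_height (real (Suc i)) (\<gamma> j 0 s) =
    min (snd (\<gamma> j 0 s)) (real (Suc i) * loop_gap s - snd (\<gamma> j 0 s))"
    by (simp add: link_height_def fst_loop loop_gap_def)
  moreover have "min (a * loop_gap s) (b * loop_gap s - a * loop_gap s) = min a (b - a) * loop_gap s" for a b
    using r min_mult_distrib_right[of a "b - a" "loop_gap s"] by (simp add: left_diff_distrib)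
  ultimately show ?thesis using r by (simp add: snd_loop)
qed

lemma height_bound: "s \<in> {0..1} \<Longrightarrow> link_height (real (Suc i)) (\<gamma> j 0 s) > - (real n + 1)"
proof -
  assume s: "s \<in> {0..1}"
  have "min (real (Suc j)) (real (Suc i) - real (Suc j)) \<ge> - real n" using ij by auto
  then have "- real n * loop_gap s \<le> min (real (Suc j)) (real (Suc i) - real (Suc j)) * loop_gap s"
    using loop_gap[OF s] by (intro mult_right_mono) auto
  moreover have "real n * loop_gap s \<le> real n" using loop_gap[OF s] by (simp add: mult_left_le)
  ultimately show ?thesis unfolding height_loop[OF s] by auto
qed

lemma F_loop:
  assumes s: "s \<in> {0..1}"
  defines "H \<equiv> link_height (real (Suc i)) (\<gamma> j 0 s)"
  shows "F i (\<gamma> j 0 s) = Complex H (side (ls ! i) (loop_strip s) * (real n + 1 + H))"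
  using height_bound[OF s] unfolding link_map_def fst_loop H_def by simp

text \<open>Zeros lie over the line of chord \<open>i\<close>. The ends of chord \<open>j\<close>
  are not on it, and away from them the core has nonzero height, so only a point of the chord in the
  open disk remains.\<close>

lemma F_loop_zero:
  assumes s: "s \<in> {0..1}" and z: "F i (\<gamma> j 0 s) = 0"
  shows "s < 1/2" "cmod (loop_strip s) < 1" "\<gamma> j 0 s = (loop_strip s, 0)"
proof -
  have h: "link_height (real (Suc i)) (\<gamma> j 0 s) = 0" "side (ls ! i) (loop_strip s) = 0"
    using z height_bound[OF s] by (auto simp: F_loop[OF s] complex_eq_iff)
  then have "cmod (loop_strip s) \<noteq> 1" using circle_side unfolding loop_strip_def by blast
  moreover have "cmod (loop_strip s) \<le> 1" using loop_gap[OF s] by (simp add: loop_gap_def abs_square_le_1)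
  ultimately show lt: "cmod (loop_strip s) < 1" by simp
  then have gap: "loop_gap s > 0" by (simp add: loop_gap_def abs_square_less_1)
  have "min (real (Suc j)) (real (Suc i) - real (Suc j)) \<noteq> 0" using ij by (auto simp: min_def)
  then have le: "s \<le> 1/2" using h(1) gap unfolding height_loop[OF s] by (auto split: if_splits)
  moreover have "s \<noteq> 1/2"
  proof
    assume half: "s = 1/2"
    have "loop_strip s = snd (ls ! j)" unfolding half using J.strip_ends by (simp add: loop_strip_def)
    then show False using J.on_circle lt by simp
  qed
  ultimately show "s < 1/2" by simp
  show "\<gamma> j 0 s = (loop_strip s, 0)" using le by (simp add: prod_eq_iff fst_loop snd_loop)
qed

lemma zero_in: "0 \<in> {-\<epsilon>..\<epsilon>}" using eps(1) by simp

text \<open>Near a zero, the push-off to level \<open>e * t\<close> and the shift by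
  \<open>- e * \<eta>\<close> both produce a real part of sign \<open>-e\<close>, so the segment
  between them misses 0. Elsewhere \<open>F i\<close> stays away from 0 and both are small
  perturbations of it.\<close>

lemma segment_nonzero_near:
  assumes e: "e \<in> {1, -1}" and s0: "s0 \<in> {0..1}"
  shows "\<exists>d>0. \<forall>s\<in>{0..1}. dist s0 s < d \<longrightarrow> (\<forall>t \<eta>. 0 < t \<and> t < d \<and> t \<le> 1 \<and> 0 < \<eta> \<and> \<eta> < d \<longrightarrow>
    0 \<notin> closed_segment (F i (\<Phi> (\<gamma> j 0 s) (e * t))) (F i (\<gamma> j 0 s) - of_real (e * \<eta>)))"
proof (cases "F i (\<gamma> j 0 s0) = 0")
  case True
  note z = F_loop_zero[OF s0 True]
  let ?q = "loop_strip s0"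
  \<comment> \<open>Below half the height of the paraboloid, \<open>link_height\<close> is the
    coordinate \<open>z\<close>, so the side of the push-off decides the sign of the real
    part.\<close>
  let ?W = "{p. snd p < real (Suc i) * (1 - (cmod (fst p))\<^sup>2) - snd p}"
  have "open ?W" by (intro open_Collect_less continuous_intros)
  moreover have "(?q, 0) \<in> ?W" using z(2) by (simp add: abs_square_less_1)
  ultimately obtain d where d: "d > 0" "\<And>x t. dist ?q x < d \<Longrightarrow> 0 < t \<Longrightarrow> t < d \<Longrightarrow>
    e * snd (\<Phi> (x, 0) (e * t)) < 0 \<and> \<Phi> (x, 0) (e * t) \<in> ?W"
    using pushoff_side[OF z(2) _ _ e, of ?W] by blast
  have "continuous_on UNIV (\<lambda>s. strip_point (ls ! j) (4 * s - 1) 0)" by (intro continuous_intros)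
  then obtain d' where d': "d' > 0" "\<And>s. dist s s0 < d' \<Longrightarrow>
      dist (strip_point (ls ! j) (4 * s - 1) 0) (strip_point (ls ! j) (4 * s0 - 1) 0) < d"
    unfolding continuous_on_iff using d(1) by blast
  define \<delta> where "\<delta> = min d (min d' (1/2 - s0))"
  have "\<delta> > 0" using d d' z(1) by (simp add: \<delta>_def)
  moreover have "0 \<notin> closed_segment (F i (\<Phi> (\<gamma> j 0 s) (e * t))) (F i (\<gamma> j 0 s) - of_real (e * \<eta>))"
    if s: "s \<in> {0..1}" "dist s0 s < \<delta>" and t: "0 < t" "t < \<delta>" "0 < \<eta>" for s t \<eta>
  proof (rule zero_notin_segment)
    have s12: "s \<le> 1/2" using s by (auto simp: \<delta>_def dist_real_def abs_if split: if_splits)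
    have g: "\<gamma> j 0 s = (strip_point (ls ! j) (4 * s - 1) 0, 0)" using s12 by (simp add: par_loop_def)
    have "dist ?q (strip_point (ls ! j) (4 * s - 1) 0) < d"
      using d'(2)[of s] s(2) z(1) by (simp add: \<delta>_def dist_commute loop_strip_def)
    then have p: "e * snd (\<Phi> (\<gamma> j 0 s) (e * t)) < 0" "\<Phi> (\<gamma> j 0 s) (e * t) \<in> ?W"
      unfolding g using d(2) t by (auto simp: \<delta>_def)
    have h: "link_height (real (Suc i)) (\<Phi> (\<gamma> j 0 s) (e * t)) = snd (\<Phi> (\<gamma> j 0 s) (e * t))"
      using p(2) by (simp add: link_height_def)
    show "Re (- of_real e * F i (\<Phi> (\<gamma> j 0 s) (e * t))) > 0"
      using p(1) e unfolding link_map_def h by (auto simp: max_def)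
    show "Re (- of_real e * (F i (\<gamma> j 0 s) - of_real (e * \<eta>))) > 0"
      using e t height_loop[OF s(1)] s12 by (auto simp: F_loop[OF s(1)])
  qed
  ultimately show ?thesis by blast
next
  case False
  define m where "m = cmod (F i (\<gamma> j 0 s0)) / 2"
  have m: "m > 0" using False by (simp add: m_def)
  let ?D = "{0..1} \<times> {0..1::real}"
  have cl: "continuous_on ?D (\<lambda>x. \<gamma> j 0 (fst x))"
    by (rule continuous_on_compose2[OF continuous_loop[OF ij(2) zero_in]]) (auto intro!: continuous_intros)
  have c1: "continuous_on ?D (\<lambda>x. F i (\<Phi> (\<gamma> j 0 (fst x)) (e * snd x)))"
    by (intro continuous_intros continuous_collar cl) (use loop_in_surface[OF ij(2) zero_in] e in auto)
  have c2: "continuous_on ?D (\<lambda>x. F i (\<gamma> j 0 (fst x)) - of_real (e * snd x))"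
    by (intro continuous_intros cl)
  have in0: "(s0, 0) \<in> ?D" using s0 by simp
  obtain d1 where d1: "d1 > 0" "\<And>x. x \<in> ?D \<Longrightarrow> dist x (s0, 0) < d1 \<Longrightarrow>
     dist (F i (\<Phi> (\<gamma> j 0 (fst x)) (e * snd x))) (F i (\<Phi> (\<gamma> j 0 (fst (s0, 0::real))) (e * snd (s0, 0)))) < m"
    using c1 in0 m by (rule continuous_on_near) blast
  obtain d2 where d2: "d2 > 0" "\<And>x. x \<in> ?D \<Longrightarrow> dist x (s0, 0) < d2 \<Longrightarrow>
     dist (F i (\<gamma> j 0 (fst x)) - of_real (e * snd x)) (F i (\<gamma> j 0 (fst (s0, 0::real))) - of_real (e * snd (s0, 0))) < m"
    using c2 in0 m by (rule continuous_on_near) blast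
  define d where "d = min 1 (min (d1 / 2) (d2 / 2))"
  have "d > 0" using d1 d2 by (simp add: d_def)
  moreover have "0 \<notin> closed_segment (F i (\<Phi> (\<gamma> j 0 s) (e * t))) (F i (\<gamma> j 0 s) - of_real (e * \<eta>))"
    if s: "s \<in> {0..1}" "dist s0 s < d" and t: "0 < t" "t < d" "t \<le> 1" "0 < \<eta>" "\<eta> < d" for s t \<eta>
  proof
    have dist: "dist (s, v) (s0, 0) < min d1 d2" if "0 < v" "v < d" for v
    proof -
      have "dist (s, v) (s0, 0) \<le> dist s s0 + \<bar>v\<bar>"
        unfolding dist_Pair_Pair using sqrt_sum_squares_le_sum[of "dist s s0" "\<bar>v\<bar>"] by (simp add: dist_real_def)
      then show ?thesis using that s(2) by (auto simp: d_def dist_commute)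
    qed
    have a: "F i (\<Phi> (\<gamma> j 0 s) (e * t)) \<in> ball (F i (\<gamma> j 0 s0)) m"
      using d1(2)[of "(s, t)"] dist[of t] s t collar_zero[OF loop_in_surface[OF ij(2) zero_in s0]] by (auto simp: dist_commute)
    have b: "F i (\<gamma> j 0 s) - of_real (e * \<eta>) \<in> ball (F i (\<gamma> j 0 s0)) m"
      using d2(2)[of "(s, \<eta>)"] dist[of \<eta>] s t by (auto simp: dist_commute d_def)
    assume "0 \<in> closed_segment (F i (\<Phi> (\<gamma> j 0 s) (e * t))) (F i (\<gamma> j 0 s) - of_real (e * \<eta>))"
    then have "0 \<in> ball (F i (\<gamma> j 0 s0)) m" using closed_segment_subset[OF a b convex_ball] by blast
    then show False using m by (simp add: m_def dist_norm)
  qed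
  ultimately show ?thesis by blast
qed

text \<open>Compactness makes the local comparison uniform in \<open>s\<close>, and the push-off is
  first retracted to a level within its range.\<close>

lemma winding_pushoff_shift:
  assumes e: "e \<in> {1, -1}"
  obtains d where "d > 0" "\<And>\<eta>. 0 < \<eta> \<Longrightarrow> \<eta> < d \<Longrightarrow>
    winding_number (\<lambda>s. F i (\<Phi> (\<gamma> j 0 s) e)) 0 = winding_number (\<lambda>s. F i (\<gamma> j 0 s) - of_real (e * \<eta>)) 0"
proof -
  have "\<exists>d>0. \<forall>s\<in>{0..1::real}. \<forall>t \<eta>. 0 < t \<and> t < d \<and> t \<le> 1 \<and> 0 < \<eta> \<and> \<eta> < d \<longrightarrow>
    0 \<notin> closed_segment (F i (\<Phi> (\<gamma> j 0 s) (e * t))) (F i (\<gamma> j 0 s) - of_real (e * \<eta>))"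
    by (rule compact_uniform[OF compact_Icc _ segment_nonzero_near[OF e]]) auto
  then obtain d where d: "d > 0" "\<And>s t \<eta>. s \<in> {0..1} \<Longrightarrow> 0 < t \<Longrightarrow> t < d \<Longrightarrow> t \<le> 1 \<Longrightarrow> 0 < \<eta> \<Longrightarrow> \<eta> < d \<Longrightarrow>
    0 \<notin> closed_segment (F i (\<Phi> (\<gamma> j 0 s) (e * t))) (F i (\<gamma> j 0 s) - of_real (e * \<eta>))" by metis
  obtain t where t: "0 < t" "t < d" "t \<le> 1" using dense[of 0 "min d 1"] d(1) by auto
  have et: "e * t \<in> {-1..1}" using e t by auto
  note loop = continuous_loop[OF ij(2) zero_in] loop_closed[OF ij(2) zero_in] loop_in_surface[OF ij(2) zero_in]
  show thesis
  proof (rule that[OF d(1)])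
    fix \<eta> assume \<eta>: "0 < \<eta>" "\<eta> < d"
    have "winding_number (\<lambda>s. F i (\<Phi> (\<gamma> j 0 s) e)) 0 = winding_number (\<lambda>s. F i (\<Phi> (\<gamma> j 0 s) (e * t))) 0"
      by (rule winding_pushoff_retract[OF ij(1) loop e]) (use t in auto)
    also have "\<dots> = winding_number (\<lambda>s. F i (\<gamma> j 0 s) - of_real (e * \<eta>)) 0"
    proof (rule winding_number_loops_linear_eq[symmetric])
      show "path (\<lambda>s. F i (\<Phi> (\<gamma> j 0 s) (e * t)))" unfolding path_def
        by (intro continuous_intros continuous_collar loop(1)) (use loop(3) et in auto)
      show "path (\<lambda>s. F i (\<gamma> j 0 s) - of_real (e * \<eta>))" unfolding path_def
        by (intro continuous_intros loop(1))
    qed (use d(2) \<eta> t loop(2) in \<open>auto simp: pathfinish_def pathstart_def\<close>)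
    finally show "winding_number (\<lambda>s. F i (\<Phi> (\<gamma> j 0 s) e)) 0 = winding_number (\<lambda>s. F i (\<gamma> j 0 s) - of_real (e * \<eta>)) 0" .
  qed
qed

text \<open>The line of chord \<open>i\<close> meets the disk exactly in chord \<open>i\<close>, so
  crossing means that \<open>side\<close>, which is affine along chord \<open>j\<close>, changes its
  sign there.\<close>

lemma chords_meet_iff:
  "closed_segment (fst (ls ! i)) (snd (ls ! i)) \<inter> closed_segment (fst (ls ! j)) (snd (ls ! j)) \<noteq> {} \<longleftrightarrow> ya * yb < 0"
proof
  assume "closed_segment (fst (ls ! i)) (snd (ls ! i)) \<inter> closed_segment (fst (ls ! j)) (snd (ls ! j)) \<noteq> {}"
  then obtain x where x: "x \<in> closed_segment (fst (ls ! i)) (snd (ls ! i))" "x \<in> closed_segment (fst (ls ! j)) (snd (ls ! j))"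
    by blast
  obtain r' where "x = linepath (fst (ls ! i)) (snd (ls ! i)) r'"
    using x(1) unfolding linepath_image_01[symmetric] by (rule imageE)
  moreover obtain r where "r \<in> {0..1}" "x = linepath (fst (ls ! j)) (snd (ls ! j)) r"
    using x(2) unfolding linepath_image_01[symmetric] by (rule imageE)
  ultimately have r: "r \<in> {0..1}" "x = strip_point (ls ! i) (2 * r' - 1) 0" "x = strip_point (ls ! j) (2 * r - 1) 0"
    unfolding I.linepath_strip J.linepath_strip by blast+
  have "side (ls ! i) x = 0" unfolding r(2) by simp
  then have 0: "(1 - r) * ya + r * yb = 0" using side_affine r(3) by simp
  show "ya * yb < 0"
  proof (rule ccontr)
    assume "\<not> ya * yb < 0"
    then have "ya > 0 \<and> yb > 0 \<or> ya < 0 \<and> yb < 0" using side_ends by (auto simp: mult_less_0_iff)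
    then have "(1 - r) * ya + r * yb \<noteq> 0"
    proof
      assume p: "ya > 0 \<and> yb > 0"
      show ?thesis
      proof (cases "r = 0")
        case False
        then have "r * yb > 0" "(1 - r) * ya \<ge> 0" using p r(1) by auto
        then show ?thesis by linarith
      qed (use p in simp)
    next
      assume p: "ya < 0 \<and> yb < 0"
      show ?thesis
      proof (cases "r = 0")
        case False
        then have "r * yb < 0" "(1 - r) * ya \<le> 0" using p r(1) by (auto simp: mult_pos_neg mult_nonneg_nonpos)
        then show ?thesis by linarith
      qed (use p in simp)
    qed
    then show False using 0 by simp
  qed
next
  assume neg: "ya * yb < 0"
  define r where "r = ya / (ya - yb)"
  have ne: "ya - yb \<noteq> 0" using neg by (metis eq_iff_diff_eq_0 not_square_less_zero)
  have r: "r \<in> {0..1}" unfolding r_def using neg by (auto simp: mult_less_0_iff divide_simps)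
  define x where "x = strip_point (ls ! j) (2 * r - 1) 0"
  have xj: "x \<in> closed_segment (fst (ls ! j)) (snd (ls ! j))"
    unfolding x_def J.linepath_strip[symmetric] linepath_def using r by (auto simp: in_segment)
  have "side (ls ! i) x = (1 - r) * ya + r * yb" unfolding x_def by (rule side_affine)
  also have "\<dots> = 0" unfolding r_def using ne by (simp add: field_simps)
  finally have side: "side (ls ! i) x = 0" .
  have "cmod x \<le> 1"
    using xj J.on_circle closed_segment_subset[of "fst (ls ! j)" "cball 0 1" "snd (ls ! j)"] by auto
  then obtain \<tau> where \<tau>: "\<tau> \<in> {-1..1}" "x = strip_point (ls ! i) \<tau> 0" using I.side_zero_strip[OF side] by blast
  have "x = linepath (fst (ls ! i)) (snd (ls ! i)) ((\<tau> + 1) / 2)" unfolding I.linepath_strip using \<tau>(2) by simp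
  moreover have "(\<tau> + 1) / 2 \<in> {0..1}" using \<tau>(1) by auto
  ultimately have "x \<in> closed_segment (fst (ls ! i)) (snd (ls ! i))"
    unfolding linepath_image_01[symmetric] by blast
  then show "closed_segment (fst (ls ! i)) (snd (ls ! i)) \<inter> closed_segment (fst (ls ! j)) (snd (ls ! j)) \<noteq> {}"
    using xj by blast
qed

lemma side_difference:
  "Im (cnj (snd (ls ! i) - fst (ls ! i)) * (snd (ls ! j) - fst (ls ! j))) = cmod (snd (ls ! i) - fst (ls ! i)) * (yb - ya)"
proof -
  have "cnj (snd (ls ! i) - fst (ls ! i)) * (snd (ls ! j) - fst (ls ! j)) =
    of_real (cmod (snd (ls ! i) - fst (ls ! i))) * (cnj I.u * (snd (ls ! j) - fst (ls ! j)))"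
    using arg_cong[OF I.diff_dir, of cnj] by (simp add: mult.assoc)
  moreover have "Im (cnj I.u * (snd (ls ! j) - fst (ls ! j))) = yb - ya"
    by (simp add: side_def frame_def algebra_simps)
  moreover have "Im (of_real c * w) = c * Im w" for c w by simp
  ultimately show ?thesis by metis
qed

text \<open>For \<open>j < i\<close> the chords enter \<open>chord_link\<close> in the reverse
  order, which reverses the determinant; \<open>e\<close> absorbs this sign.\<close>

lemma link_sign:
  assumes "chord_link (ls ! min i j) (ls ! max i j) \<le> 0" and e: "e = (if j < i then 1 else -1)"
  shows "chord_link (ls ! min i j) (ls ! max i j) = (if ya * yb < 0 then -1 else 0)"
    and "ya * yb < 0 \<Longrightarrow> e * ya > 0 \<and> e * yb < (0 :: real)"
proof -
  let ?di = "snd (ls ! i) - fst (ls ! i)" and ?dj = "snd (ls ! j) - fst (ls ! j)"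
  have meet: "closed_segment (fst (ls ! min i j)) (snd (ls ! min i j)) \<inter> closed_segment (fst (ls ! max i j)) (snd (ls ! max i j)) = {}
     \<longleftrightarrow> \<not> ya * yb < 0"
    using chords_meet_iff by (cases "i < j") (auto simp: min_def max_def Int_commute)
  then show "chord_link (ls ! min i j) (ls ! max i j) = (if ya * yb < 0 then -1 else 0)"
    using assms(1) unfolding chord_link_def by (auto split: if_splits)
  assume neg: "ya * yb < 0"
  then have "Im (cnj (snd (ls ! min i j) - fst (ls ! min i j)) * (snd (ls ! max i j) - fst (ls ! max i j))) > 0"
    using meet assms(1) unfolding chord_link_def by (auto split: if_splits)
  moreover have "Im (cnj (snd (ls ! min i j) - fst (ls ! min i j)) * (snd (ls ! max i j) - fst (ls ! max i j)))
     = - e * Im (cnj ?di * ?dj)"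
    using ij(3) e by (cases "i < j") (simp_all add: min_def max_def algebra_simps)
  ultimately have "- e * (cmod ?di * (yb - ya)) > 0" unfolding side_difference by simp
  moreover have "cmod ?di > 0" using I.distinct_ends by simp
  moreover have "- e * (cmod ?di * (yb - ya)) = cmod ?di * (e * (ya - yb))" by (simp add: algebra_simps)
  ultimately have "e * (ya - yb) > 0" by (metis zero_less_mult_pos)
  then show "e * ya > 0 \<and> e * yb < 0" using neg e by (auto simp: mult_less_0_iff split: if_splits)
qed

text \<open>Along the chord the values of \<open>F i\<close> are imaginary, along the core their
  real parts have the sign of \<open>i - j\<close> or vanish. A shift in the direction of that sign
  keeps the loop in a half-plane. After a shift in the other direction, if the chords cross, chord
  and core pass the real axis on different sides of 0 and the loop winds once.\<close>

lemma winding_pushoff_other: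
  assumes link: "chord_link (ls ! min i j) (ls ! max i j) \<le> 0" and e: "e \<in> {1, -1}"
  shows "winding_number (\<lambda>s. F i (\<Phi> (\<gamma> j 0 s) e)) 0 =
    (if (j < i) = (e = 1) then - of_int (chord_link (ls ! min i j) (ls ! max i j)) else 0)"
proof -
  obtain d where d: "d > 0" "\<And>\<eta>. 0 < \<eta> \<Longrightarrow> \<eta> < d \<Longrightarrow>
    winding_number (\<lambda>s. F i (\<Phi> (\<gamma> j 0 s) e)) 0 = winding_number (\<lambda>s. F i (\<gamma> j 0 s) - of_real (e * \<eta>)) 0"
    using winding_pushoff_shift[OF e] by blast
  let ?g = "\<lambda>\<eta> s. F i (\<gamma> j 0 s) - complex_of_real (e * \<eta>)"
  let ?H = "\<lambda>s. link_height (real (Suc i)) (\<gamma> j 0 s)"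
  let ?y = "\<lambda>s. side (ls ! i) (loop_strip s)"
  have cont: "continuous_on {0..1} (?g \<eta>)" for \<eta>
    by (intro continuous_intros continuous_loop[OF ij(2) zero_in])
  have loop: "?g \<eta> 0 = ?g \<eta> 1" for \<eta> using loop_closed[OF ij(2) zero_in] by simp
  have Re: "Re (?g \<eta> s) = ?H s - e * \<eta>" and Im: "Im (?g \<eta> s) = ?y s * (real n + 1 + ?H s)" if "s \<in> {0..1}" for \<eta> s
    using F_loop[OF that] by simp_all
  have pos: "real n + 1 + ?H s > 0" if "s \<in> {0..1}" for s using height_bound[OF that] by simp
  have y1: "?y s = (1 - 2 * s) * ya + 2 * s * yb" if "s \<le> 1/2" for s
    using that side_affine[of "2 * s"] by (simp add: loop_strip_def)
  have y2: "?y s = (2 * s - 1) * ya + (2 - 2 * s) * yb" if "s \<ge> 1/2" for s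
  proof (cases "s = 1/2")
    case True
    show ?thesis unfolding True using y1[of "1/2"] by simp
  next
    case False
    then show ?thesis using that side_affine[of "2 - 2 * s"] by (simp add: loop_strip_def algebra_simps)
  qed
  have He: "s \<in> {0..1} \<Longrightarrow> (if j < i then ?H s \<ge> 0 else ?H s \<le> 0)" for s
    using loop_gap[of s] ij(3) unfolding height_loop by (auto intro!: mult_nonneg_nonneg mult_nonpos_nonneg simp: min_def of_nat_Suc)
  show ?thesis
  proof (cases "(j < i) = (e = 1)")
    case False
    obtain \<eta> where \<eta>: "0 < \<eta>" "\<eta> < d" using dense[OF d(1)] by blast
    have "winding_number (?g \<eta>) 0 = 0"
    proof (rule loop_winding_halfplane[OF cont loop])
      fix s :: real assume s: "s \<in> {0..1}"
      have "Re (- of_real e * ?g \<eta> s) = - e * Re (?g \<eta> s)" by simp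
      also have "\<dots> > 0" using False e \<eta> He[OF s] unfolding Re[OF s] by auto
      finally show "Re (- of_real e * ?g \<eta> s) > 0" .
    qed
    then show ?thesis using d(2)[OF \<eta>] False by simp
  next
    case True
    then have e': "e = (if j < i then 1 else -1)" using e by auto
    show ?thesis
    proof (cases "ya * yb < 0")
      case no: False
      obtain \<eta> where \<eta>: "0 < \<eta>" "\<eta> < d" using dense[OF d(1)] by blast
      have "winding_number (?g \<eta>) 0 = 0"
      proof (rule loop_winding_halfplane[OF cont loop])
        fix s :: real assume s: "s \<in> {0..1}"
        have same: "sgn yb = sgn ya" using no side_ends by (auto simp: mult_less_0_iff sgn_if)
        have conv: "sgn ya * ((1 - r) * ya + r * yb) > 0" if "0 \<le> r" "r \<le> 1" for r
        proof -
          have "sgn ya * ((1 - r) * ya + r * yb) = (1 - r) * \<bar>ya\<bar> + r * \<bar>yb\<bar>"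
            using same by (simp add: abs_sgn algebra_simps)
          also have "\<dots> > 0"
          proof (cases "r = 0")
            case False
            then have "r * \<bar>yb\<bar> > 0" "(1 - r) * \<bar>ya\<bar> \<ge> 0" using that side_ends by auto
            then show ?thesis by linarith
          qed (use side_ends in simp)
          finally show ?thesis .
        qed
        have "sgn ya * ?y s > 0"
        proof (cases "s \<le> 1/2")
          case True then show ?thesis using conv[of "2 * s"] y1[of s] s by (simp add: mult.assoc)
        next
          case False then show ?thesis using conv[of "2 - 2 * s"] y2[of s] s by simp
        qed
        then have "sgn ya * ?y s * (real n + 1 + ?H s) > 0" using pos[OF s] by (rule mult_pos_pos)
        then have "sgn ya * Im (?g \<eta> s) > 0" unfolding Im[OF s] by (simp only: mult.assoc)
        moreover have "Re (- \<i> * of_real (sgn ya) * ?g \<eta> s) = sgn ya * Im (?g \<eta> s)" by simp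
        ultimately show "Re (- \<i> * of_real (sgn ya) * ?g \<eta> s) > 0" by (simp only:)
      qed
      then show ?thesis using d(2)[OF \<eta>] link_sign(1)[OF link e'] no by simp
    next
      case cross: True
      note sign = link_sign(2)[OF link e' cross]
      have ne: "ya - yb \<noteq> 0" using cross by (metis eq_iff_diff_eq_0 not_square_less_zero)
      define r where "r = ya / (ya - yb)"
      have r: "0 \<le> r" "r \<le> 1" unfolding r_def using cross by (auto simp: mult_less_0_iff divide_simps)
      \<comment> \<open>The time at which the core passes over the crossing point; \<open>r\<close>
        is the parameter of this point on the chord, which the second half runs through
        backwards.\<close>
      define s0 where "s0 = 1 - r / 2"
      have s0: "s0 \<in> {0..1}" "s0 \<ge> 1/2" using r by (auto simp: s0_def)
      have y0: "s = s0" if "?y s = 0" "s \<ge> 1/2" for s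
      proof -
        have "ya - (2 - 2 * s) * (ya - yb) = 0" using y2[OF that(2)] that(1) by (simp add: algebra_simps)
        then have "2 - 2 * s = r" unfolding r_def using ne by (simp add: field_simps)
        then show ?thesis by (simp add: s0_def)
      qed
      have ys0: "?y s0 = 0"
      proof -
        have "?y s0 = ya - r * (ya - yb)" using y2[OF s0(2)] by (simp add: s0_def algebra_simps)
        then show ?thesis unfolding r_def using ne by simp
      qed
      have "F i (\<gamma> j 0 s0) \<noteq> 0" using F_loop_zero(1)[OF s0(1)] s0(2) by auto
      then have "?H s0 \<noteq> 0" using ys0 F_loop[OF s0(1)] by (auto simp: complex_eq_iff)
      then have Hpos: "e * ?H s0 > 0" using He[OF s0(1)] e' by (auto split: if_splits)
      \<comment> \<open>The bound \<open>e * ?H s0\<close> prevents the shift from carrying the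
        passage of the core across 0.\<close>
      obtain \<eta> where "0 < \<eta>" "\<eta> < min d (e * ?H s0)" using dense[of 0 "min d (e * ?H s0)"] d(1) Hpos by auto
      then have \<eta>: "0 < \<eta>" "\<eta> < d" "\<eta> < e * ?H s0" by auto
      have ee: "e * e = 1" using e by auto
      have "winding_number (?g \<eta>) 0 = 1"
      proof (rule loop_winding_crossing[OF cont loop e])
        fix s :: real assume s: "s \<in> {0..1/2}"
        then have s1: "s \<in> {0..1}" by auto
        have "?H s = 0" using height_loop[OF s1] s by simp
        then show "e * Re (?g \<eta> s) < 0" unfolding Re[OF s1] using \<eta> ee by (simp add: mult.assoc[symmetric])
      next
        fix s :: real assume s: "s \<in> {1/2..1}" "Im (?g \<eta> s) = 0"
        then have s1: "s \<in> {0..1}" by auto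
        have "?y s = 0" using s(2) pos[OF s1] unfolding Im[OF s1] by simp
        then have "s = s0" using y0 s by auto
        then show "e * Re (?g \<eta> s) > 0" unfolding Re[OF s1] using \<eta> ee
          by (simp add: right_diff_distrib mult.assoc[symmetric])
      next
        have "Im (?g \<eta> 0) = ya * (real n + 1 + ?H 0)" using Im[of 0] y1[of 0] by simp
        moreover have "e * ya * (real n + 1 + ?H 0) > 0" using sign pos[of 0] mult_pos_pos[of "e * ya"] by simp
        ultimately show "e * Im (?g \<eta> 0) > 0" by (simp only: mult.assoc)
        have "Im (?g \<eta> (1/2)) = yb * (real n + 1 + ?H (1/2))" using Im[of "1/2"] y1[of "1/2"] by simp
        moreover have "e * yb * (real n + 1 + ?H (1/2)) < 0" using sign pos[of "1/2"] mult_neg_pos[of "e * yb"] by simp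
        ultimately show "e * Im (?g \<eta> (1/2)) < 0" by (simp only: mult.assoc)
      qed
      then show ?thesis using d(2)[OF \<eta>(1,2)] True link_sign(1)[OF link e'] cross by simp
    qed
  qed
qed

end

theorem theorem7p1:
  fixes ls :: "chord list" and \<epsilon> :: real and K S :: "space3 set"
    and \<Phi> :: "space3 \<Rightarrow> real \<Rightarrow> space3"
    and h :: "space3 real_chain set \<Rightarrow> space3 real_chain set"
    and A :: "real mat" and p :: "real poly"
  assumes "coxeter_link ls \<epsilon> K S"
    and "bicollar S \<Phi>"
    and "homology_monodromy S \<Phi> h"
    and "H1_matrix (top_of_set S) h (length ls) (\<lambda>i. path_chain (chord_loop ls i)) A"
    and "p = char_poly A"
    and "mahler_real p \<noteq> 1"
  shows "mahler_real p \<ge> mahler_measure lehmer_poly"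
proof -
  have S: "S = chord_surface ls \<epsilon>" and cox: "coxeter_type ls"
    using assms(1) by (auto simp: coxeter_link_def)
  interpret collared_surface ls \<epsilon> \<Phi>
    using assms(1,2) by unfold_locales (auto simp: coxeter_link_def)
  \<comment> \<open>By the Coxeter type the linking numbers are 0 or -1; the reversed sign makes
    \<open>U\<close> an adjacency matrix.\<close>
  define U where "U i j = (if i < j \<and> j < n then - real_of_int (chord_link (ls ! i) (ls ! j)) else 0)" for i j
  have link: "chord_link (ls ! i) (ls ! j) \<in> {0, -1}" if "i < j" "j < n" for i j
  proof -
    have "chord_link (ls ! i) (ls ! j) \<le> 0" using cox that by (simp add: coxeter_type_def)
    then show ?thesis unfolding chord_link_def by (auto split: if_splits)
  qed
  have loop: "chord_loop ls i = \<gamma> i 0" if "i < n" for i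
    using chord_loop_par_loop[OF unit_chord[OF that]] by (intro ext)
  have zero: "0 \<in> {-\<epsilon>..\<epsilon>}" using eps(1) by simp
  \<comment> \<open>Up to the sign between winding and linking, the positive push-off gives the
    entry \<open>(j, k)\<close> of the Seifert matrix and the negative one the entry
    \<open>(k, j)\<close>.\<close>
  have W: "winding_number (\<lambda>s. F k (\<Phi> (\<gamma> j 0 s) e)) 0 =
     - of_real (if j = k then 1 else - (if e = 1 then U j k else U k j))"
    if "k < n" "j < n" "e \<in> {1, -1}" for j k e
  proof (cases "j = k")
    case True then show ?thesis using winding_pushoff_self that by simp
  next
    case False
    interpret two_chords ls \<epsilon> \<Phi> k j using that False by unfold_locales auto
    have le: "chord_link (ls ! min k j) (ls ! max k j) \<le> 0"
      using link[of "min k j" "max k j"] that False by (cases "k < j") (auto simp: min_def max_def)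
    show ?thesis using winding_pushoff_other[OF le that(3)] that False
      by (cases "j < k") (auto simp: U_def min_def max_def)
  qed
  have Wp: "winding_number (\<lambda>s. F k (\<Phi> (\<gamma> j 0 s) 1)) 0 = - of_real (if j = k then 1 else - U j k)"
    and Wm: "winding_number (\<lambda>s. F k (\<Phi> (\<gamma> j 0 s) (-1))) 0 = - of_real (if j = k then 1 else - U k j)"
    if "k < n" "j < n" for j k
    using W[OF that, of 1] W[OF that, of "-1"] by (cases "j = k"; simp)+
  have MA: "(if j = k then 1 else - U j k) = (\<Sum>i<n. A $$ (i, j) * (if k = i then 1 else - U k i))"
    if jk: "j < n" "k < n" for j k
  proof -
    let ?f = "case_option (complex_of_real (- (real n + 1))) (F k)"
    have f: "continuous_map (complement_in_S3 S) euclidean ?f"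
      unfolding complement_in_S3_def by (intro continuous_map_from_subtopology continuous_map_link_map) simp
    have ne: "?f x \<noteq> 0" if "x \<in> topspace (complement_in_S3 S)" for x
    proof (cases x)
      case None
      have "complex_of_real (- (real n + 1)) \<noteq> 0" unfolding of_real_eq_0_iff by linarith
      then show ?thesis using None by simp
    next
      case (Some p)
      then have "p \<notin> S" using that by (auto simp: complement_in_S3_def)
      then have "F k p \<noteq> 0" using link_map_zero_surface[OF jk(2)] S by blast
      then show ?thesis using Some by simp
    qed
    have "winding_number (\<lambda>s. ?f (Some (\<Phi> (chord_loop ls j s) 1))) 0 =
     (\<Sum>i<n. of_real (A $$ (i, j)) * winding_number (\<lambda>s. ?f (Some (\<Phi> (chord_loop ls i s) (-1)))) 0)"
    proof (rule monodromy_winding[OF assms(2,3,4) _ _ _ f ne jk(1)])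
      fix i assume "i < n"
      then show "continuous_on {0..1} (chord_loop ls i)" "chord_loop ls i ` {0..1} \<subseteq> S" "chord_loop ls i 0 = chord_loop ls i 1"
        using continuous_loop[of i 0] loop_in_surface[of i 0] loop_closed[of i 0] zero loop S by auto
    qed
    then have "- complex_of_real (if j = k then 1 else - U j k) =
      (\<Sum>i<n. of_real (A $$ (i, j)) * - of_real (if i = k then 1 else - U k i))"
      using Wp[OF jk(2,1)] Wm[OF jk(2)] jk loop by simp
    also have "\<dots> = - of_real (\<Sum>i<n. A $$ (i, j) * (if k = i then 1 else - U k i))"
      by (simp add: sum_negf eq_commute)
    finally show ?thesis by (simp only: neg_equal_iff_equal of_real_eq_iff)
  qed
  have U: "U i j \<in> {0, 1}" "U i j = 1 \<Longrightarrow> i < j" for i j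
    using link[of i j] by (auto simp: U_def split: if_splits)
  have "A \<in> carrier_mat n n" using assms(4) by (simp add: H1_matrix_def)
  then have "mahler_real (char_poly A) = 1 \<or> mahler_real (char_poly A) \<ge> mahler_measure lehmer_poly"
    using U MA by (rule coxeter_matrix_mahler)
  then show ?thesis using assms(5,6) by blast
qed

end
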